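(* Let $\xi\in W^{1,4}(\mathbb T^2)\cap\mathcal E$. Then for all sufficiently small $\tau>0$ (the smallness may depend on $\xi$), the equation $$\Phi_\tau(\xi)=\xi-\tau(K*\xi)\cdot\nabla\Phi_\tau(\xi)$$ has a unique strong solution $\Phi_\tau(\xi)\in W^{1,4}(\mathbb T^2)\cap\mathcal E$.
   Context: $\mathbb T^2=\mathbb R^2/\mathbb Z^2$; $\mathcal E$ is the space of square integrable periodic functions on $\mathbb T^2$ with zero mean; $W^{1,4}(\mathbb T^2)$ is the usual Sobolev space. For $\xi\in\mathcal E$, $K*\xi$ ($K$ the Biot–Savart kernel on $\mathbb T^2$) denotes the unique zero-mean divergence free vector field $u$ on $\mathbb T^2$ with $\nabla^\perp\cdot u=\partial_1u_2-\partial_2u_1=\xi$. A strong solution is an element of $W^{1,4}(\mathbb T^2)\cap\mathcal E$ satisfying the equation almost everywhere on $\mathbb T^2$. *)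

theory Defs
  imports "HOL-Analysis.Analysis"
begin

(* A function on the torus R^2/Z^2 is a Z^2-periodic function on R^2, integrated over the unit
   cell. Elements of Lebesgue and Sobolev spaces are represented by periodic functions, two of
   which stand for the same element iff they agree almost everywhere. *)

definition torus :: "(real^2) measure" where
  "torus = lebesgue_on (cbox 0 1)"

definition periodic :: "(real^2 \<Rightarrow> 'b) \<Rightarrow> bool" where
  "periodic f \<longleftrightarrow> (\<forall>x i. f (x + axis i 1) = f x)"

definition Lp_torus :: "nat \<Rightarrow> (real^2 \<Rightarrow> 'b::euclidean_space) set" where
  "Lp_torus p = {f. periodic f \<and> f \<in> borel_measurable torus \<and>
                    integrable torus (\<lambda>x. norm (f x) ^ p)}"

definition mean_zero :: "(real^2 \<Rightarrow> 'b::euclidean_space) \<Rightarrow> bool" where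
  "mean_zero f \<longleftrightarrow> (LINT x|torus. f x) = 0"

definition E_space :: "(real^2 \<Rightarrow> real) set" where
  "E_space = {f \<in> Lp_torus 2. mean_zero f}"

text \<open>Classical partial derivatives; only applied to differentiable functions.\<close>

definition partial :: "2 \<Rightarrow> (real^2 \<Rightarrow> real) \<Rightarrow> real^2 \<Rightarrow> real" where
  "partial i f x = frechet_derivative f (at x) (axis i 1)"

primrec Ck :: "nat \<Rightarrow> (real^2 \<Rightarrow> real) \<Rightarrow> bool" where
  "Ck 0 f \<longleftrightarrow> continuous_on UNIV f"
| "Ck (Suc k) f \<longleftrightarrow> (\<forall>x. f differentiable (at x)) \<and> (\<forall>i. Ck k (partial i f))"

definition test_functions :: "(real^2 \<Rightarrow> real) set" where
  "test_functions = {\<phi>. periodic \<phi> \<and> (\<forall>k. Ck k \<phi>)}"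

definition has_weak_partial :: "2 \<Rightarrow> (real^2 \<Rightarrow> real) \<Rightarrow> (real^2 \<Rightarrow> real) \<Rightarrow> bool" where
  "has_weak_partial i f g \<longleftrightarrow> f \<in> Lp_torus 1 \<and> g \<in> Lp_torus 1 \<and>
     (\<forall>\<phi>\<in>test_functions.
        (LINT x|torus. f x * partial i \<phi> x) = - (LINT x|torus. g x * \<phi> x))"

definition W1p_torus :: "nat \<Rightarrow> (real^2 \<Rightarrow> real) set" where
  "W1p_torus p = {f \<in> Lp_torus p. \<forall>i. \<exists>g\<in>Lp_torus p. has_weak_partial i f g}"

text \<open>Weak derivatives are determined up to null sets, so the choice of a representative
  is immaterial.\<close>

definition weak_grad :: "(real^2 \<Rightarrow> real) \<Rightarrow> real^2 \<Rightarrow> real^2" where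
  "weak_grad f x = (\<chi> i. (SOME g. has_weak_partial i f g) x)"

text \<open>The equations \<open>div u = 0\<close> and \<open>\<partial>\<^sub>1 u\<^sub>2 - \<partial>\<^sub>2 u\<^sub>1 = \<xi>\<close> for a square integrable vector field,
  in the sense of distributions.\<close>

definition weak_div_free :: "(real^2 \<Rightarrow> real^2) \<Rightarrow> bool" where
  "weak_div_free u \<longleftrightarrow>
     (\<forall>\<phi>\<in>test_functions.
        (LINT x|torus. u x $ 1 * partial 1 \<phi> x + u x $ 2 * partial 2 \<phi> x) = 0)"

definition has_weak_curl :: "(real^2 \<Rightarrow> real^2) \<Rightarrow> (real^2 \<Rightarrow> real) \<Rightarrow> bool" where
  "has_weak_curl u \<xi> \<longleftrightarrow>
     (\<forall>\<phi>\<in>test_functions.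
        (LINT x|torus. u x $ 2 * partial 1 \<phi> x - u x $ 1 * partial 2 \<phi> x)
          = - (LINT x|torus. \<xi> x * \<phi> x))"

text \<open>A representative of \<open>K * \<xi>\<close>, which is unique up to null sets.\<close>

definition biot_savart :: "(real^2 \<Rightarrow> real) \<Rightarrow> real^2 \<Rightarrow> real^2" where
  "biot_savart \<xi> = (SOME u. u \<in> Lp_torus 2 \<and> mean_zero u \<and> weak_div_free u \<and> has_weak_curl u \<xi>)"

definition strong_solution :: "real \<Rightarrow> (real^2 \<Rightarrow> real) \<Rightarrow> (real^2 \<Rightarrow> real) \<Rightarrow> bool" where
  "strong_solution \<tau> \<xi> \<eta> \<longleftrightarrow> \<eta> \<in> W1p_torus 4 \<inter> E_space \<and>
     (AE x in torus. \<eta> x = \<xi> x - \<tau> * (biot_savart \<xi> x \<bullet> weak_grad \<eta> x))"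

end

(* Proof idea. Replacing u.grad f by the difference quotient (f(x) - f(x - h u(x)))/h turns the equation
   into a fixed-point problem for the averaging map  f |-> (h xi + tau f(x - h u(x)))/(h + tau).  Its
   iterates satisfy an L^4 bound on the gradient which is uniform in h as soon as tau times the Lipschitz
   constant of u is small, because x |-> x - h u(x) changes volumes and lengths by factors 1 + O(h).
   For smooth data the iterates have bounded second differences, so for small h they solve the equation
   up to a small error. The approximate solutions with a given error and gradient bound form a convex
   set; elements of nearly minimal L^2 norm of these sets form a Cauchy sequence, whose limit is a
   solution. Uniqueness is the energy identity: w u.grad w has integral zero since u is divergence free.

   That u = K * xi is Lipschitz is seen as follows. Let k(y) = (1/|y|^2 - 1) y / (2 pi) on the unit disc.
   The integral of f(x + y) k(y) dy has divergence A f - f, where A is the mean over the unit disc, and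
   its curl vanishes by rotation symmetry. On the torus A contracts functions of mean zero, so
   f - A f = xi is solved by a Neumann series, and grad u is given by integrals of grad f against k,
   which are bounded since k is in L^(4/3) and grad f in L^4. *)

theory Submission
  imports Defs "HOL-Complex_Analysis.Great_Picard"
begin

section \<open>Integration on the torus\<close>

text \<open>The order in which constants are fixed shapes the proof. The data are rough, so the
  scheme is run for mollified \<xi> and for a C11 field uniformly close to u. Its second-difference
  bounds may blow up with the mollification; this is harmless because the step h is chosen after
  them. Whatever must survive the limit depends only on L^4 norms and on a gradient bound L common
  to all those fields. The restriction 128 \<tau> L \<le> 1 comes from a single iteration: pulling
  back along x - h u(x) multiplies the fourth-power integral of the gradient by at most (1 + 2 h
  L)^4 / (1 - 2 h L) \<le> 1 + 64 h L. The bound to be reproduced is twice that of the data, so the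
  excess is 128 h \<tau> L times the data, while the data enter with weight h and leave room for h
  times their own integral. That the exponent 4 exceeds the dimension 2 is what makes the gradient
  of K * \<xi> bounded. \<open>biot_savart\<close> is a representative picked by SOME and may be bad
  on a null set, so it is exchanged for a continuous version before any composition with x - h u(x)
  is formed.\<close>

lemma space_torus [simp]: "space torus = cbox 0 1"
  by (simp add: torus_def)

lemma inner_one_Basis [simp]: "b \<in> Basis \<Longrightarrow> (1::real^2) \<bullet> b = 1"
  by (auto simp: Basis_vec_def inner_axis)

lemma emeasure_torus: "emeasure torus (space torus) = 1"
proof -
  have "emeasure torus (cbox 0 1) = emeasure lebesgue (cbox 0 1 :: (real^2) set)"
    unfolding torus_def by (subst emeasure_restrict_space) auto
  also have "\<dots> = 1"
    by (simp add: emeasure_lborel_cbox_eq)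
  finally show ?thesis by simp
qed

lemma finite_torus: "finite_measure torus"
  by (rule finite_measureI) (simp add: emeasure_torus del: space_torus)

interpretation torus: finite_measure torus
  by (rule finite_torus)

lemma prob_torus: "measure torus (space torus) = 1"
  by (simp add: measure_def emeasure_torus del: space_torus)

lemma integral_torus_const [simp]: "(LINT x|torus. c) = (c::'b::euclidean_space)"
  using prob_torus by simp

lemma borel_measurable_torus [measurable (raw)]:
  assumes "f \<in> borel_measurable borel" shows "f \<in> borel_measurable torus"
proof -
  have "f \<in> borel_measurable lborel" using assms by simp
  then have "f \<in> borel_measurable lebesgue" by (rule measurable_completion)
  then show ?thesis unfolding torus_def by (rule measurable_restrict_space1)
qed

lemma continuous_torus_measurable:
  fixes f :: "real^2 \<Rightarrow> 'b::euclidean_space"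
  assumes "continuous_on UNIV f" shows "f \<in> borel_measurable torus"
  using borel_measurable_continuous_onI[OF assms] by (rule borel_measurable_torus)

lemma nn_integral_torus:
  assumes "f \<in> borel_measurable borel"
  shows "(\<integral>\<^sup>+x. f x \<partial>torus) = (\<integral>\<^sup>+x. f x * indicator (cbox 0 1) x \<partial>lborel)"
  unfolding torus_def
  by (subst nn_integral_restrict_space) (auto simp: nn_integral_completion)

section \<open>Lattice translates, fundamental cells and translation invariance\<close>

definition lattice :: "(real^2) set" where
  "lattice = {k. \<forall>i. k $ i \<in> \<int>}"

lemma lattice_simps [simp]:
  "0 \<in> lattice" "axis i 1 \<in> lattice"
  "k \<in> lattice \<Longrightarrow> l \<in> lattice \<Longrightarrow> k + l \<in> lattice"
  "k \<in> lattice \<Longrightarrow> l \<in> lattice \<Longrightarrow> k - l \<in> lattice"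
  "- k \<in> lattice \<longleftrightarrow> k \<in> lattice"
  by (auto simp: lattice_def axis_def)

lemma periodic_of_int:
  assumes "periodic f" shows "f (x + of_int n *\<^sub>R axis i 1) = f x"
proof -
  have nat: "f (x + of_nat n *\<^sub>R axis i 1) = f x" for n x
  proof (induction n)
    case (Suc n)
    have "x + of_nat (Suc n) *\<^sub>R axis i 1 = (x + of_nat n *\<^sub>R axis i 1) + axis i 1"
      by (simp add: algebra_simps)
    then have "f (x + of_nat (Suc n) *\<^sub>R axis i 1) = f (x + of_nat n *\<^sub>R axis i 1)"
      using assms by (simp only: periodic_def)
    then show ?case using Suc by simp
  qed simp
  show ?thesis
  proof (cases "n \<ge> 0")
    case True
    then show ?thesis using nat[of x "nat n"] by simp
  next
    case False
    then show ?thesis using nat[of "x + of_int n *\<^sub>R axis i 1" "nat (-n)"]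
      by (simp add: algebra_simps)
  qed
qed

lemma vec2_decomp: "(k::real^2) = (k$1) *\<^sub>R axis 1 1 + (k$2) *\<^sub>R axis 2 1"
  by (auto simp: vec_eq_iff axis_def forall_2)

lemma periodic_lattice:
  assumes "periodic f" "k \<in> lattice" shows "f (x + k) = f x"
proof -
  obtain a b where ab: "k$1 = of_int a" "k$2 = of_int b"
    using assms(2) by (auto simp: lattice_def forall_2 elim!: Ints_cases)
  have "x + k = (x + of_int a *\<^sub>R axis 1 1) + of_int b *\<^sub>R axis 2 1"
    by (subst vec2_decomp[of k]) (simp add: ab)
  then show ?thesis using periodic_of_int[OF assms(1)] by (simp only:)
qed

definition fracv :: "real^2 \<Rightarrow> real^2" where
  "fracv x = (\<chi> i. frac (x $ i))"

text \<open>Half-open, so that its lattice translates tile the plane without overlap. The closed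
  square carrying \<open>torus\<close> differs from it by a null set only.\<close>

definition unit_cell :: "(real^2) set" where
  "unit_cell = {x. \<forall>i. 0 \<le> x $ i \<and> x $ i < 1}"

lemma fracv_cell: "fracv x \<in> unit_cell"
  by (auto simp: fracv_def unit_cell_def frac_lt_1)

lemma fracv_lattice: "x - fracv x \<in> lattice"
  by (auto simp: fracv_def lattice_def frac_def)

lemma periodic_fracv: "periodic f \<Longrightarrow> f (fracv x) = f x"
  using periodic_lattice[OF _ fracv_lattice[of x], of f "fracv x"] by simp

lemma unit_cell_subset: "unit_cell \<subseteq> cbox 0 1"
  by (auto simp: unit_cell_def mem_box_cart less_imp_le)

lemma unit_cell_sets [measurable]: "unit_cell \<in> sets borel"
  unfolding unit_cell_def by measurable

lemma countable_lattice: "countable lattice"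
proof -
  have "lattice \<subseteq> (\<lambda>(a,b). of_int a *\<^sub>R axis 1 1 + of_int b *\<^sub>R axis 2 1) ` (UNIV :: (int \<times> int) set)"
  proof
    fix k assume "k \<in> lattice"
    then obtain a b where "k$1 = of_int a" "k$2 = of_int b"
      by (auto simp: lattice_def forall_2 elim!: Ints_cases)
    then have "k = of_int a *\<^sub>R axis 1 1 + of_int b *\<^sub>R axis 2 1"
      using vec2_decomp[of k] by simp
    then show "k \<in> (\<lambda>(a,b). of_int a *\<^sub>R axis 1 1 + of_int b *\<^sub>R axis 2 1) ` (UNIV :: (int \<times> int) set)"
      by force
  qed
  then show ?thesis by (rule countable_subset) simp
qed

lemma lattice_cell_unique:
  assumes "k \<in> lattice" "l \<in> lattice" "x - k \<in> unit_cell" "x - l \<in> unit_cell"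
  shows "k = l"
proof -
  have "k $ i = l $ i" for i
  proof -
    obtain a b where ab: "k$i = of_int a" "l$i = of_int b"
      using assms(1,2) unfolding lattice_def by (auto elim!: Ints_cases dest!: spec[of _ i])
    have "0 \<le> x$i - k$i \<and> x$i - k$i < 1" "0 \<le> x$i - l$i \<and> x$i - l$i < 1"
      using assms(3,4) by (auto simp: unit_cell_def)
    then have "\<bar>of_int a - of_int b :: real\<bar> < 1" using ab by auto
    then have "a = b" by linarith
    then show ?thesis using ab by simp
  qed
  then show ?thesis by (simp add: vec_eq_iff)
qed

text \<open>The integral over \<open>count_space\<close> counts the indices that satisfy P. It is
  used to count the lattice translates of a point that fall into a given set, both for a tiling
  (exactly one) and for a packing (at most one).\<close>

lemma nn_integral_indicator_unique:
  assumes "\<And>k l. k \<in> I \<Longrightarrow> l \<in> I \<Longrightarrow> P k \<Longrightarrow> P l \<Longrightarrow> k = l"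
  shows "(\<integral>\<^sup>+k. indicator {k. P k} k \<partial>count_space I) = (if \<exists>k\<in>I. P k then 1 else 0)"
proof (cases "\<exists>k\<in>I. P k")
  case True
  then obtain k where k: "k \<in> I" "P k" by auto
  have "(\<integral>\<^sup>+j. indicator {k. P k} j \<partial>count_space I) = (\<integral>\<^sup>+j. indicator {k} j \<partial>count_space I)"
    by (rule nn_integral_cong) (use assms k in \<open>auto split: split_indicator\<close>)
  also have "\<dots> = 1" using k by (subst nn_integral_indicator) auto
  finally show ?thesis using True by simp
next
  case False
  then have "(\<integral>\<^sup>+j. indicator {k. P k} j \<partial>count_space I) = (\<integral>\<^sup>+j. 0 \<partial>count_space I)"
    by (intro nn_integral_cong) (auto split: split_indicator)
  then show ?thesis using False by simp
qed

lemma nn_integral_lborel_shift: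
  fixes k :: "'a::euclidean_space"
  assumes "f \<in> borel_measurable borel"
  shows "(\<integral>\<^sup>+x. f (x + k) \<partial>lborel) = (\<integral>\<^sup>+x. f x \<partial>lborel)"
proof -
  have "(\<integral>\<^sup>+x. f x \<partial>lborel) = (\<integral>\<^sup>+x. f x \<partial>distr lborel borel ((+) k))"
    by (simp add: lborel_distr_plus)
  also have "\<dots> = (\<integral>\<^sup>+x. f (k + x) \<partial>lborel)"
    using assms by (intro nn_integral_distr) auto
  finally show ?thesis by (simp add: add.commute)
qed

text \<open>D meets each lattice orbit at most once, so cutting D along the tiling by
  \<open>unit_cell\<close> and moving the pieces back into the cell produces no overlap; periodicity
  leaves f unchanged under the moves. It serves both for translated cells and for the image of the
  cell under \<open>euler\<close>.\<close>

lemma packing_nn_integral_le: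
  fixes f :: "real^2 \<Rightarrow> ennreal"
  assumes [measurable]: "f \<in> borel_measurable borel" "D \<in> sets borel" and per: "periodic f"
    and D: "\<And>x k. x \<in> D \<Longrightarrow> k \<in> lattice \<Longrightarrow> x + k \<in> D \<Longrightarrow> k = 0"
  shows "(\<integral>\<^sup>+x. f x * indicator D x \<partial>lborel) \<le> (\<integral>\<^sup>+x. f x \<partial>torus)"
proof -
  have 1: "(\<integral>\<^sup>+k. indicator {k. x - k \<in> unit_cell} k \<partial>count_space lattice) = (1::ennreal)" for x :: "real^2"
    by (subst nn_integral_indicator_unique[where P="\<lambda>k. x - k \<in> unit_cell"])
       (use lattice_cell_unique fracv_lattice[of x] fracv_cell[of x] in
         \<open>auto intro!: bexI[of _ "x - fracv x"]\<close>)
  have 2: "(\<integral>\<^sup>+k. indicator {k. x + k \<in> D} k \<partial>count_space lattice) \<le> (1::ennreal)" for x :: "real^2"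
  proof (subst nn_integral_indicator_unique[where P="\<lambda>k. x + k \<in> D"])
    fix k l assume *: "k \<in> lattice" "l \<in> lattice" "x + k \<in> D" "x + l \<in> D"
    then have "l - k = 0" using D[of "x + k" "l - k"] by simp
    then show "k = l" by simp
  qed auto
  have "(\<integral>\<^sup>+x. f x * indicator D x \<partial>lborel)
      = (\<integral>\<^sup>+x. (\<integral>\<^sup>+k. indicator {k. x - k \<in> unit_cell} k * (f x * indicator D x) \<partial>count_space lattice) \<partial>lborel)"
    by (subst nn_integral_multc) (simp_all add: 1)
  also have "\<dots> = (\<integral>\<^sup>+k. (\<integral>\<^sup>+x. indicator {k. x - k \<in> unit_cell} k * (f x * indicator D x) \<partial>lborel) \<partial>count_space lattice)"
    by (rule nn_integral_count_space_nn_integral[OF countable_lattice]) (simp add: indicator_def)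
  also have "\<dots> = (\<integral>\<^sup>+k. (\<integral>\<^sup>+x. indicator unit_cell x * (f x * indicator D (x + k)) \<partial>lborel) \<partial>count_space lattice)"
  proof (rule nn_integral_cong)
    fix k assume k: "k \<in> space (count_space lattice)"
    have "(\<integral>\<^sup>+x. indicator {k. x - k \<in> unit_cell} k * (f x * indicator D x) \<partial>lborel)
       = (\<integral>\<^sup>+x. indicator {j. (x + k) - j \<in> unit_cell} k * (f (x + k) * indicator D (x + k)) \<partial>lborel)"
      by (rule nn_integral_lborel_shift[where k=k and
            f="\<lambda>x. indicator {j. x - j \<in> unit_cell} k * (f x * indicator D x)", symmetric])
         (simp add: indicator_def)
    also have "\<dots> = (\<integral>\<^sup>+x. indicator unit_cell x * (f x * indicator D (x + k)) \<partial>lborel)"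
      using k periodic_lattice[OF per] by (intro nn_integral_cong) (auto simp: indicator_def)
    finally show "(\<integral>\<^sup>+x. indicator {k. x - k \<in> unit_cell} k * (f x * indicator D x) \<partial>lborel) = \<dots>" .
  qed
  also have "\<dots> = (\<integral>\<^sup>+x. (\<integral>\<^sup>+k. indicator unit_cell x * (f x * indicator D (x + k)) \<partial>count_space lattice) \<partial>lborel)"
    by (rule nn_integral_count_space_nn_integral[OF countable_lattice, symmetric]) simp
  also have "\<dots> = (\<integral>\<^sup>+x. indicator unit_cell x * f x * (\<integral>\<^sup>+k. indicator {k. x + k \<in> D} k \<partial>count_space lattice) \<partial>lborel)"
    by (intro nn_integral_cong, subst nn_integral_cmult[symmetric])
       (auto intro!: nn_integral_cong simp: indicator_def)
  also have "\<dots> \<le> (\<integral>\<^sup>+x. indicator unit_cell x * f x * 1 \<partial>lborel)"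
    by (intro nn_integral_mono mult_left_mono 2) auto
  also have "\<dots> \<le> (\<integral>\<^sup>+x. f x * indicator (cbox 0 1) x \<partial>lborel)"
    using unit_cell_subset by (intro nn_integral_mono) (auto simp: indicator_def)
  finally show ?thesis by (simp add: nn_integral_torus)
qed

lemma nn_integral_cell_eq_cbox:
  assumes [measurable]: "f \<in> borel_measurable borel"
  shows "(\<integral>\<^sup>+x. f x * indicator unit_cell x \<partial>lborel) = (\<integral>\<^sup>+x. f x \<partial>torus)"
proof -
  have b: "box 0 1 \<subseteq> unit_cell" by (auto simp: unit_cell_def mem_box_cart less_imp_le)
  have "AE x in lborel. x \<notin> cbox 0 1 - box (0::real^2) 1"
  proof (rule AE_not_in)
    have "emeasure lborel (cbox 0 1 - box (0::real^2) 1) = emeasure lborel (cbox 0 (1::real^2)) - emeasure lborel (box 0 (1::real^2))"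
      by (rule emeasure_Diff) (auto simp: emeasure_lborel_box_eq mem_box_cart less_imp_le)
    then show "cbox 0 1 - box (0::real^2) 1 \<in> null_sets lborel"
      by (auto simp: emeasure_lborel_box_eq emeasure_lborel_cbox_eq)
  qed
  then have "(\<integral>\<^sup>+x. f x * indicator unit_cell x \<partial>lborel) = (\<integral>\<^sup>+x. f x * indicator (cbox 0 1) x \<partial>lborel)"
    by (intro nn_integral_cong_AE, elim eventually_mono)
       (use b unit_cell_subset in \<open>auto simp: indicator_def\<close>)
  then show ?thesis by (simp add: nn_integral_torus)
qed

lemma periodic_shift: "periodic f \<Longrightarrow> periodic (\<lambda>x. f (x + v))"
  unfolding periodic_def by (metis add.commute add.left_commute)

lemma cell_packing:
  assumes "x - v \<in> unit_cell" "k \<in> lattice" "x + k - v \<in> unit_cell" shows "k = 0"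
  using lattice_cell_unique[of 0 "-k" "x - v"] assms by (simp add: algebra_simps)

text \<open>A translated cell meets each orbit at most once, so packing gives one inequality; the
  same inequality for the shift by -v is the converse.\<close>

lemma nn_integral_torus_shift:
  fixes f :: "real^2 \<Rightarrow> ennreal"
  assumes [measurable]: "f \<in> borel_measurable borel" and per: "periodic f"
  shows "(\<integral>\<^sup>+x. f (x + v) \<partial>torus) = (\<integral>\<^sup>+x. f x \<partial>torus)"
proof -
  have le: "(\<integral>\<^sup>+x. f (x + v) \<partial>torus) \<le> (\<integral>\<^sup>+x. f x \<partial>torus)"
    if [measurable]: "f \<in> borel_measurable borel" and per: "periodic f" for f :: "real^2 \<Rightarrow> ennreal" and v
  proof -
    have "(\<integral>\<^sup>+x. f (x + v) \<partial>torus) = (\<integral>\<^sup>+x. f (x + v) * indicator {x. x - v \<in> unit_cell} (x + v) \<partial>lborel)"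
      by (subst nn_integral_cell_eq_cbox[symmetric]) (auto simp: indicator_def)
    also have "\<dots> = (\<integral>\<^sup>+x. f x * indicator {x. x - v \<in> unit_cell} x \<partial>lborel)"
      by (rule nn_integral_lborel_shift[where f="\<lambda>x. f x * indicator {x. x - v \<in> unit_cell} x"]) simp
    also have "\<dots> \<le> (\<integral>\<^sup>+x. f x \<partial>torus)"
      by (rule packing_nn_integral_le) (use per cell_packing in \<open>auto simp: that\<close>)
    finally show ?thesis .
  qed
  show ?thesis
  proof (rule antisym)
    show "(\<integral>\<^sup>+x. f (x + v) \<partial>torus) \<le> (\<integral>\<^sup>+x. f x \<partial>torus)" by (rule le) (use per in auto)
    show "(\<integral>\<^sup>+x. f x \<partial>torus) \<le> (\<integral>\<^sup>+x. f (x + v) \<partial>torus)"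
      using le[of "\<lambda>x. f (x + v)" "-v"] periodic_shift[OF per] by simp
  qed
qed

lemma periodic_bounded:
  fixes f :: "real^2 \<Rightarrow> 'b::euclidean_space"
  assumes "periodic f" "continuous_on UNIV f"
  obtains S where "S \<ge> 0" "\<And>x. norm (f x) \<le> S"
proof -
  have "compact (f ` cbox 0 1)"
    using assms(2) by (intro compact_continuous_image) (auto intro: continuous_on_subset)
  then obtain S where S: "\<And>y. y \<in> f ` cbox 0 1 \<Longrightarrow> norm y \<le> S"
    using compact_imp_bounded bounded_iff by metis
  have "norm (f x) \<le> S" for x
  proof -
    have "fracv x \<in> cbox 0 1" using fracv_cell unit_cell_subset by blast
    then show ?thesis using S periodic_fracv[OF assms(1), of x] by (metis imageI)
  qed
  moreover from this[of 0] have "S \<ge> 0" using norm_ge_zero order_trans by blast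
  ultimately show ?thesis using that by blast
qed

lemma integrable_torus_bounded:
  fixes f :: "real^2 \<Rightarrow> 'b::euclidean_space"
  assumes "f \<in> borel_measurable torus" "\<And>x. norm (f x) \<le> S"
  shows "integrable torus f"
  by (rule torus.integrable_const_bound[where B=S]) (use assms in auto)

lemma integrable_torus_continuous:
  fixes f :: "real^2 \<Rightarrow> 'b::euclidean_space"
  assumes "continuous_on UNIV f"
  shows "integrable torus f"
proof -
  have "compact (f ` cbox 0 1)"
    using assms by (intro compact_continuous_image) (auto intro: continuous_on_subset)
  then obtain S where S: "\<And>y. y \<in> f ` cbox 0 1 \<Longrightarrow> norm y \<le> S"
    using compact_imp_bounded bounded_iff by metis
  show ?thesis
    by (rule torus.integrable_const_bound[where B=S]) (use assms S continuous_torus_measurable in auto)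
qed

lemma integral_torus_shift:
  fixes f :: "real^2 \<Rightarrow> real"
  assumes f: "continuous_on UNIV f" and per: "periodic f"
  shows "(LINT x|torus. f (x + v)) = (LINT x|torus. f x)"
proof -
  have fv: "continuous_on UNIV (\<lambda>x. f (x + v))"
    by (rule continuous_on_compose2[OF f]) (auto intro: continuous_intros)
  have [measurable]: "f \<in> borel_measurable borel" using f by (rule borel_measurable_continuous_onI)
  have *: "(\<integral>\<^sup>+x. ennreal (f (x + v)) \<partial>torus) = (\<integral>\<^sup>+x. ennreal (f x) \<partial>torus)"
    by (rule nn_integral_torus_shift[where f="\<lambda>x. ennreal (f x)"]) (use per in \<open>auto simp: periodic_def\<close>)
  have **: "(\<integral>\<^sup>+x. ennreal (- f (x + v)) \<partial>torus) = (\<integral>\<^sup>+x. ennreal (- f x) \<partial>torus)"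
    by (rule nn_integral_torus_shift[where f="\<lambda>x. ennreal (- f x)"]) (use per in \<open>auto simp: periodic_def\<close>)
  show ?thesis
    by (subst (1 2) real_lebesgue_integral_def)
       (auto simp: * ** f fv integrable_torus_continuous)
qed

section \<open>First-order Taylor bounds and averages of translates\<close>

lemma abs_integral_le:
  fixes f :: "'a \<Rightarrow> real"
  assumes "integrable M f" "integrable M g" "\<And>x. x \<in> space M \<Longrightarrow> \<bar>f x\<bar> \<le> g x"
  shows "\<bar>LINT x|M. f x\<bar> \<le> (LINT x|M. g x)"
proof -
  have "(LINT x|M. \<bar>f x\<bar>) \<le> (LINT x|M. g x)" using assms by (intro integral_mono) auto
  then show ?thesis using integral_abs_bound[of M f] by linarith
qed

lemma measure_torus [simp]: "measure torus (cbox 0 1) = 1"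
  using prob_torus by simp

text \<open>Differentiability with a uniform quadratic remainder, the working form of second-order
  smoothness. The constant passes explicitly through products, averages and compositions, and no
  second derivative has to exist.\<close>

definition taylor :: "real \<Rightarrow> (real^2 \<Rightarrow> real) \<Rightarrow> (real^2 \<Rightarrow> real^2) \<Rightarrow> bool" where
  "taylor M f G \<longleftrightarrow> (\<forall>x v. \<bar>f (x + v) - f x - G x \<bullet> v\<bar> \<le> M * (norm v)\<^sup>2)"

text \<open>The periodic functions of class C^(1,1), with the gradient G carried as data rather than
  recovered by a derivative operator.\<close>

definition C11 :: "(real^2 \<Rightarrow> real) \<Rightarrow> (real^2 \<Rightarrow> real^2) \<Rightarrow> bool" where
  "C11 f G \<longleftrightarrow> periodic f \<and> periodic G \<and> continuous_on UNIV f \<and> continuous_on UNIV G \<and>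
     (\<exists>M. taylor M f G)"

lemma taylorD: "taylor M f G \<Longrightarrow> \<bar>f (x + v) - f x - G x \<bullet> v\<bar> \<le> M * (norm v)\<^sup>2"
  by (simp add: taylor_def)

lemma taylor_nonneg:
  assumes "taylor M f G" shows "M \<ge> 0"
  using taylorD[OF assms, of 0 "axis 1 1"] by (simp add: norm_axis_1)

lemma taylor_mono: "taylor M f G \<Longrightarrow> M \<le> M' \<Longrightarrow> taylor M' f G"
  unfolding taylor_def by (meson mult_right_mono order_trans zero_le_power2)

lemma taylor_has_derivative:
  assumes "taylor M f G" shows "(f has_derivative (\<lambda>v. G x \<bullet> v)) (at x)"
  unfolding has_derivative_iff_norm
proof (intro conjI bounded_linear_inner_right)
  have M: "M \<ge> 0" by (rule taylor_nonneg[OF assms])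
  show "((\<lambda>y. norm (f y - f x - G x \<bullet> (y - x)) / norm (y - x)) \<longlongrightarrow> 0) (at x)"
  proof (rule Lim_null_comparison)
    show "\<forall>\<^sub>F y in at x. norm (norm (f y - f x - G x \<bullet> (y - x)) / norm (y - x)) \<le> M * norm (y - x)"
      using taylorD[OF assms, of x "_ - x"] M
      by (intro always_eventually allI) (auto simp: divide_simps power2_eq_square mult.assoc)
    show "((\<lambda>y. M * norm (y - x)) \<longlongrightarrow> 0) (at x)"
      by (rule tendsto_eq_intros | simp)+
  qed
qed

lemma C11_has_derivative: "C11 f G \<Longrightarrow> (f has_derivative (\<lambda>v. G x \<bullet> v)) (at x)"
  unfolding C11_def using taylor_has_derivative by blast

lemma gradient_lipschitz:
  fixes f :: "real^2 \<Rightarrow> real"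
  assumes "\<And>x. (f has_derivative (\<lambda>v. G x \<bullet> v)) (at x)" "\<And>x. norm (G x) \<le> S"
  shows "\<bar>f y - f x\<bar> \<le> S * norm (y - x)"
proof -
  have "norm (f y - f x) \<le> S * norm (y - x)"
  proof (rule differentiable_bound[of UNIV f "\<lambda>x v. G x \<bullet> v"])
    show "(f has_derivative (\<bullet>) (G z)) (at z within UNIV)" for z using assms(1) by simp
    show "onorm ((\<bullet>) (G z)) \<le> S" for z
      by (rule onorm_le) (metis assms(2) Cauchy_Schwarz_ineq2 mult_right_mono norm_ge_zero order_trans real_norm_def)
  qed auto
  then show ?thesis by simp
qed

lemma taylor_lipschitz:
  assumes "taylor M f G" "\<And>x. norm (G x) \<le> S"
  shows "\<bar>f y - f x\<bar> \<le> S * norm (y - x)"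
  using gradient_lipschitz[OF taylor_has_derivative[OF assms(1)] assms(2)] .

lemma C11_mult:
  assumes f: "C11 f F" and g: "C11 g G"
  shows "C11 (\<lambda>x. f x * g x) (\<lambda>x. f x *\<^sub>R G x + g x *\<^sub>R F x)"
proof -
  obtain M N where MN: "taylor M f F" "taylor N g G" using f g by (auto simp: C11_def)
  obtain Sf where Sf: "Sf \<ge> 0" "\<And>x. norm (f x) \<le> Sf" using periodic_bounded f C11_def by metis
  obtain Sg where Sg: "Sg \<ge> 0" "\<And>x. norm (g x) \<le> Sg" using periodic_bounded g C11_def by metis
  obtain SF where SF: "SF \<ge> 0" "\<And>x. norm (F x) \<le> SF" using periodic_bounded f C11_def by metis
  obtain SG where SG: "SG \<ge> 0" "\<And>x. norm (G x) \<le> SG" using periodic_bounded g C11_def by metis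
  have "taylor (SF * SG + Sf * N + Sg * M) (\<lambda>x. f x * g x) (\<lambda>x. f x *\<^sub>R G x + g x *\<^sub>R F x)"
    unfolding taylor_def
  proof (intro allI)
    fix x v
    \<comment> \<open>The remainder of the product is the product of the increments plus f times the
      remainder of g plus g times the remainder of f; Lipschitz bounds make the first term
      quadratic.\<close>
    let ?a = "(f (x + v) - f x) * (g (x + v) - g x)"
    let ?b = "f x * (g (x + v) - g x - G x \<bullet> v)"
    let ?c = "g x * (f (x + v) - f x - F x \<bullet> v)"
    have "\<bar>?a\<bar> \<le> (SF * norm v) * (SG * norm v)"
      unfolding abs_mult
      using taylor_lipschitz[OF MN(1) SF(2), of "x + v" x] taylor_lipschitz[OF MN(2) SG(2), of "x + v" x]
      by (intro mult_mono) (auto simp: SF SG)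
    moreover have "\<bar>?b\<bar> \<le> Sf * (N * (norm v)\<^sup>2)"
      unfolding abs_mult using taylorD[OF MN(2), of x v] Sf by (intro mult_mono) auto
    moreover have "\<bar>?c\<bar> \<le> Sg * (M * (norm v)\<^sup>2)"
      unfolding abs_mult using taylorD[OF MN(1), of x v] Sg by (intro mult_mono) auto
    moreover have "f (x + v) * g (x + v) - f x * g x - (f x *\<^sub>R G x + g x *\<^sub>R F x) \<bullet> v = ?a + ?b + ?c"
      by (simp add: algebra_simps inner_add_left)
    moreover have "(SF * norm v) * (SG * norm v) + Sf * (N * (norm v)\<^sup>2) + Sg * (M * (norm v)\<^sup>2)
        = (SF * SG + Sf * N + Sg * M) * (norm v)\<^sup>2"
      by (simp add: algebra_simps power2_eq_square)
    ultimately show "\<bar>f (x + v) * g (x + v) - f x * g x - (f x *\<^sub>R G x + g x *\<^sub>R F x) \<bullet> v\<bar>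
        \<le> (SF * SG + Sf * N + Sg * M) * (norm v)\<^sup>2"
      by linarith
  qed
  moreover have "periodic (\<lambda>x. f x * g x)" "periodic (\<lambda>x. f x *\<^sub>R G x + g x *\<^sub>R F x)"
    using f g by (auto simp: C11_def periodic_def)
  moreover have "continuous_on UNIV (\<lambda>x. f x * g x)" "continuous_on UNIV (\<lambda>x. f x *\<^sub>R G x + g x *\<^sub>R F x)"
    using f g by (auto simp: C11_def intro!: continuous_intros)
  ultimately show ?thesis unfolding C11_def by blast
qed

lemma taylor_lincomb:
  assumes "taylor M f F" "taylor N g G"
  shows "taylor (\<bar>a\<bar> * M + \<bar>b\<bar> * N) (\<lambda>x. a * f x + b * g x) (\<lambda>x. a *\<^sub>R F x + b *\<^sub>R G x)"
  unfolding taylor_def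
proof (intro allI)
  fix x v
  have "\<bar>a * (f (x + v) - f x - F x \<bullet> v)\<bar> \<le> \<bar>a\<bar> * (M * (norm v)\<^sup>2)"
    unfolding abs_mult using taylorD[OF assms(1)] by (intro mult_left_mono) auto
  moreover have "\<bar>b * (g (x + v) - g x - G x \<bullet> v)\<bar> \<le> \<bar>b\<bar> * (N * (norm v)\<^sup>2)"
    unfolding abs_mult using taylorD[OF assms(2)] by (intro mult_left_mono) auto
  moreover have "a * f (x + v) + b * g (x + v) - (a * f x + b * g x) - (a *\<^sub>R F x + b *\<^sub>R G x) \<bullet> v
      = a * (f (x + v) - f x - F x \<bullet> v) + b * (g (x + v) - g x - G x \<bullet> v)"
    by (simp add: algebra_simps inner_add_left)
  ultimately show "\<bar>a * f (x + v) + b * g (x + v) - (a * f x + b * g x) - (a *\<^sub>R F x + b *\<^sub>R G x) \<bullet> v\<bar>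
      \<le> (\<bar>a\<bar> * M + \<bar>b\<bar> * N) * (norm v)\<^sup>2"
    by (simp add: distrib_right mult.assoc)
qed

lemma C11_lincomb:
  assumes "C11 f F" "C11 g G"
  shows "C11 (\<lambda>x. a * f x + b * g x) (\<lambda>x. a *\<^sub>R F x + b *\<^sub>R G x)"
proof -
  have "\<exists>M. taylor M (\<lambda>x. a * f x + b * g x) (\<lambda>x. a *\<^sub>R F x + b *\<^sub>R G x)"
    using assms taylor_lincomb unfolding C11_def by blast
  then show ?thesis using assms unfolding C11_def
    by (auto simp: periodic_def intro!: continuous_intros)
qed

text \<open>When the Taylor bound at v = h e_i is integrated, translation invariance cancels the two
  values of f and leaves M h as a bound for the integral of G_i, for every h > 0.\<close>

lemma C11_integral_gradient:
  assumes "C11 f G" shows "(LINT x|torus. G x $ i) = 0"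
proof -
  obtain M where M: "taylor M f G" using assms by (auto simp: C11_def)
  have per: "periodic f" "continuous_on UNIV f" "continuous_on UNIV G" using assms by (auto simp: C11_def)
  have int: "integrable torus f" "integrable torus (\<lambda>x. G x $ i)"
    using per by (auto intro!: integrable_torus_continuous continuous_intros)
  have le: "\<bar>LINT x|torus. G x $ i\<bar> \<le> M * h" if h: "h > 0" for h
  proof -
    have sh: "integrable torus (\<lambda>x. f (x + h *\<^sub>R axis i 1))"
      by (intro integrable_torus_continuous continuous_on_compose2[OF per(2)] continuous_intros) auto
    have "\<bar>LINT x|torus. f (x + h *\<^sub>R axis i 1) - f x - h * G x $ i\<bar> \<le> (LINT x|torus. M * h\<^sup>2)"
    proof (rule abs_integral_le)
      show "\<bar>f (x + h *\<^sub>R axis i 1) - f x - h * G x $ i\<bar> \<le> M * h\<^sup>2" for x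
        using taylorD[OF M, of x "h *\<^sub>R axis i 1"] by (simp add: inner_axis norm_axis_1)
    qed (use int sh in auto)
    moreover have "(LINT x|torus. f (x + h *\<^sub>R axis i 1) - f x - h * G x $ i) = - h * (LINT x|torus. G x $ i)"
      using int sh integral_torus_shift[OF per(2,1)] by simp
    ultimately have "h * \<bar>LINT x|torus. G x $ i\<bar> \<le> h * (M * h)"
      using h by (simp add: abs_mult power2_eq_square ac_simps)
    then show ?thesis using h by simp
  qed
  have "((\<lambda>h. M * h) \<longlongrightarrow> 0) (at_right 0)" by (rule tendsto_eq_intros | simp)+
  moreover have "\<forall>\<^sub>F h in at_right 0. \<bar>LINT x|torus. G x $ i\<bar> \<le> M * h"
    using eventually_at_right_less by (rule eventually_mono) (rule le)
  ultimately have "\<bar>LINT x|torus. G x $ i\<bar> \<le> 0"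
    by (rule tendsto_lowerbound) simp
  then show ?thesis by simp
qed

lemma torus_by_parts:
  assumes f: "C11 f F" and g: "C11 g G"
  shows "(LINT x|torus. f x * G x $ i) = - (LINT x|torus. F x $ i * g x)"
proof -
  have "(LINT x|torus. f x * G x $ i + F x $ i * g x) = 0"
    using C11_integral_gradient[OF C11_mult[OF f g], of i] by (simp add: ac_simps)
  moreover have "integrable torus (\<lambda>x. f x * G x $ i)" "integrable torus (\<lambda>x. F x $ i * g x)"
    using f g by (auto simp: C11_def intro!: integrable_torus_continuous continuous_intros)
  ultimately show ?thesis by (simp add: eq_neg_iff_add_eq_0)
qed

section \<open>Jensen's inequality for the fourth power\<close>

lemma power4_convex:
  fixes a b :: real
  shows "4 * b^3 * a - 3 * b^4 \<le> a^4"
proof -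
  have "a^4 - 4 * b^3 * a + 3 * b^4 = (a - b)\<^sup>2 * ((a + b)\<^sup>2 + 2 * b\<^sup>2)"
    by algebra
  moreover have "\<dots> \<ge> 0" by (intro mult_nonneg_nonneg) auto
  ultimately show ?thesis by linarith
qed

lemma power4_jensen2:
  fixes a b x y :: real
  assumes "a \<ge> 0" "b \<ge> 0" "a + b = 1"
  shows "(a * x + b * y)^4 \<le> a * x^4 + b * y^4"
proof -
  let ?m = "a * x + b * y"
  have "a * (4 * ?m^3 * x - 3 * ?m^4) \<le> a * x^4" "b * (4 * ?m^3 * y - 3 * ?m^4) \<le> b * y^4"
    using assms power4_convex by (auto intro: mult_left_mono)
  moreover have "a * (4 * ?m^3 * x - 3 * ?m^4) + b * (4 * ?m^3 * y - 3 * ?m^4)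
      = 4 * ?m^3 * ?m - 3 * ?m^4 * (a + b)" by algebra
  moreover have "\<dots> = ?m^4" using assms by algebra
  ultimately show ?thesis by linarith
qed

text \<open>The tangent inequality at the weighted mean of |F|, integrated against |w|, gives the
  bound. The weight may change sign and need not have mass one, which costs the cube of its
  mass.\<close>

lemma power4_jensen:
  fixes w F :: "'a \<Rightarrow> real"
  assumes w: "integrable M w" "integrable M (\<lambda>x. w x * F x)" "integrable M (\<lambda>x. \<bar>w x\<bar> * F x ^ 4)"
    and le: "(LINT x|M. \<bar>w x\<bar>) \<le> W"
  shows "(LINT x|M. w x * F x)^4 \<le> W^3 * (LINT x|M. \<bar>w x\<bar> * F x ^ 4)"
proof -
  define V where "V = (LINT x|M. \<bar>w x\<bar>)"
  define I where "I = (LINT x|M. \<bar>w x * F x\<bar>)"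
  define J where "J = (LINT x|M. \<bar>w x\<bar> * F x ^ 4)"
  have V0: "V \<ge> 0" and I0: "I \<ge> 0" and J0: "J \<ge> 0" by (auto simp: V_def I_def J_def)
  have "I^4 \<le> V^3 * J"
  proof (cases "V = 0")
    case True
    then have "AE x in M. w x = 0"
      using integral_nonneg_eq_0_iff_AE[of M "\<lambda>x. \<bar>w x\<bar>"] w(1) by (auto simp: V_def)
    then have "I = 0" unfolding I_def by (intro integral_eq_zero_AE) (auto elim: eventually_mono)
    then show ?thesis using J0 V0 by simp
  next
    case False
    then have V: "V > 0" using V0 by simp
    define b where "b = I / V"
    have iw: "integrable M (\<lambda>x. \<bar>w x * F x\<bar>)" using w(2) by (rule integrable_abs)
    have "(LINT x|M. 4 * b^3 * \<bar>w x * F x\<bar> - 3 * b^4 * \<bar>w x\<bar>) \<le> J"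
      unfolding J_def
    proof (rule integral_mono)
      show "integrable M (\<lambda>x. 4 * b^3 * \<bar>w x * F x\<bar> - 3 * b^4 * \<bar>w x\<bar>)"
        using iw w(1) by auto
      fix x
      have "\<bar>w x\<bar> * (4 * b^3 * \<bar>F x\<bar> - 3 * b^4) \<le> \<bar>w x\<bar> * \<bar>F x\<bar>^4"
        by (intro mult_left_mono power4_convex) auto
      then show "4 * b^3 * \<bar>w x * F x\<bar> - 3 * b^4 * \<bar>w x\<bar> \<le> \<bar>w x\<bar> * F x ^ 4"
        by (simp add: abs_mult algebra_simps power_even_abs)
    qed (use w in auto)
    then have "4 * b^3 * I - 3 * b^4 * V \<le> J"
      using iw w(1) by (simp add: I_def V_def)
    moreover have "4 * b^3 * I - 3 * b^4 * V = I^4 / V^3"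
      using V by (simp add: b_def power_divide field_simps power4_eq_xxxx power3_eq_cube)
    ultimately show ?thesis using V by (simp add: pos_divide_le_eq mult.commute)
  qed
  moreover have "(LINT x|M. w x * F x)^4 \<le> I^4"
  proof -
    have "\<bar>LINT x|M. w x * F x\<bar> \<le> I" unfolding I_def by (rule integral_abs_bound)
    then have "\<bar>LINT x|M. w x * F x\<bar>^4 \<le> I^4" by (rule power_mono) simp
    then show ?thesis by (simp add: power_even_abs)
  qed
  moreover have "V^3 * J \<le> W^3 * J"
    using le V0 J0 unfolding V_def by (intro mult_right_mono power_mono) auto
  ultimately show ?thesis by (simp add: J_def)
qed

section \<open>Weighted averages of translates\<close>

locale averaging = sigma_finite_measure M for M :: "'a measure" +
  fixes t :: "'a \<Rightarrow> real^2" and w :: "'a \<Rightarrow> real"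
  assumes t_meas [measurable]: "t \<in> borel_measurable M" and w_int: "integrable M w"
begin

text \<open>Mollification, means over the disc and averages against the singular kernel all have
  this form, so continuity, Taylor bounds and L^4 bounds are proved once for an integrable, possibly
  signed, weight.\<close>

definition av :: "(real^2 \<Rightarrow> real) \<Rightarrow> real^2 \<Rightarrow> real" where
  "av f x = (LINT \<omega>|M. w \<omega> * f (x + t \<omega>))"

definition avv :: "(real^2 \<Rightarrow> real^2) \<Rightarrow> real^2 \<Rightarrow> real^2" where
  "avv G x = (\<chi> i. av (\<lambda>y. G y $ i) x)"

definition mass :: real where "mass = (LINT \<omega>|M. \<bar>w \<omega>\<bar>)"

lemma mass_nonneg: "mass \<ge> 0" by (simp add: mass_def)

lemma w_meas [measurable]: "w \<in> borel_measurable M"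
  using w_int by auto

lemma av_integrable:
  assumes "continuous_on UNIV f" "periodic f"
  shows "integrable M (\<lambda>\<omega>. w \<omega> * f (x + t \<omega>))"
proof -
  have [measurable]: "f \<in> borel_measurable borel" using assms(1) by (rule borel_measurable_continuous_onI)
  obtain S where S: "S \<ge> 0" "\<And>x. norm (f x) \<le> S" using periodic_bounded[OF assms(2,1)] by blast
  have "integrable M (\<lambda>\<omega>. S * w \<omega>)" using w_int by simp
  then show ?thesis
    by (rule Bochner_Integration.integrable_bound)
       (use S in \<open>auto simp: abs_mult mult.commute[of S] intro!: mult_left_mono AE_I2\<close>)
qed

lemma av_bound:
  assumes "continuous_on UNIV f" "periodic f" "\<And>x. \<bar>f x\<bar> \<le> S"
  shows "\<bar>av f x\<bar> \<le> mass * S"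
proof -
  have "\<bar>av f x\<bar> \<le> (LINT \<omega>|M. \<bar>w \<omega>\<bar> * S)"
    unfolding av_def
    by (rule abs_integral_le)
       (use assms w_int av_integrable in \<open>auto simp: abs_mult intro: mult_left_mono\<close>)
  then show ?thesis by (simp add: mass_def)
qed

lemma av_periodic: "periodic f \<Longrightarrow> periodic (av f)"
proof -
  assume per: "periodic f"
  have "f (x + axis i 1 + t \<omega>) = f (x + t \<omega>)" for x i \<omega>
    using periodic_shift[OF per, of "t \<omega>"] unfolding periodic_def by blast
  then show ?thesis unfolding periodic_def av_def by simp
qed

lemma av_continuous:
  assumes "continuous_on UNIV f" "periodic f"
  shows "continuous_on UNIV (av f)"
proof -
  have [measurable]: "f \<in> borel_measurable borel" using assms(1) by (rule borel_measurable_continuous_onI)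
  obtain S where S: "S \<ge> 0" "\<And>x. norm (f x) \<le> S" using periodic_bounded[OF assms(2,1)] by blast
  have f: "isCont f x" for x using assms(1) by (simp add: continuous_on_eq_continuous_at)
  have "(\<lambda>n. av f (X n)) \<longlonglongrightarrow> av f x" if X: "X \<longlonglongrightarrow> x" for X x
    unfolding av_def
  proof (rule integral_dominated_convergence[where w="\<lambda>\<omega>. S * \<bar>w \<omega>\<bar>"])
    show "AE \<omega> in M. (\<lambda>n. w \<omega> * f (X n + t \<omega>)) \<longlonglongrightarrow> w \<omega> * f (x + t \<omega>)"
      by (intro AE_I2 tendsto_intros isCont_tendsto_compose[OF f] X)
    show "AE \<omega> in M. norm (w \<omega> * f (X n + t \<omega>)) \<le> S * \<bar>w \<omega>\<bar>" for n
      using S by (auto simp: abs_mult mult.commute[of S] intro!: mult_left_mono AE_I2)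
  qed (use w_int in auto)
  then show ?thesis
    unfolding continuous_on_eq_continuous_at[OF open_UNIV]
    by (auto simp: continuous_at_sequentially o_def)
qed

lemma av_lincomb:
  assumes "continuous_on UNIV f" "periodic f" "continuous_on UNIV g" "periodic g"
  shows "av (\<lambda>x. a * f x + b * g x) x = a * av f x + b * av g x"

proof -
  have "av (\<lambda>x. a * f x + b * g x) x = (LINT \<omega>|M. a * (w \<omega> * f (x + t \<omega>)) + b * (w \<omega> * g (x + t \<omega>)))"
    unfolding av_def by (rule Bochner_Integration.integral_cong) (auto simp: algebra_simps)
  then show ?thesis
    using av_integrable[OF assms(1,2), of x] av_integrable[OF assms(3,4), of x] by (simp add: av_def)
qed

lemma av_taylor:
  assumes "taylor K f G" "continuous_on UNIV f" "periodic f" "continuous_on UNIV G" "periodic G"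
  shows "taylor (mass * K) (av f) (avv G)"
  unfolding taylor_def
proof (intro allI)
  fix x v
  have G: "continuous_on UNIV (\<lambda>y. G y $ i)" "periodic (\<lambda>y. G y $ i)" for i
    using assms by (auto intro!: continuous_intros simp: periodic_def)
  have gi: "integrable M (\<lambda>\<omega>. w \<omega> * G (x + t \<omega>) $ i)" for i by (rule av_integrable[OF G])
  have fi: "integrable M (\<lambda>\<omega>. w \<omega> * f (y + t \<omega>))" for y using assms av_integrable by blast
  have in_eq: "avv G x \<bullet> v = (LINT \<omega>|M. w \<omega> * (G (x + t \<omega>) \<bullet> v))"
    using gi by (simp add: inner_vec_def avv_def av_def sum_2 distrib_left flip: mult.assoc)
  have ig: "integrable M (\<lambda>\<omega>. w \<omega> * (G (x + t \<omega>) \<bullet> v))"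
    using gi by (simp add: inner_vec_def sum_2 distrib_left flip: mult.assoc)
  have "av f (x + v) - av f x - avv G x \<bullet> v
     = (LINT \<omega>|M. w \<omega> * f (x + v + t \<omega>) - w \<omega> * f (x + t \<omega>) - w \<omega> * (G (x + t \<omega>) \<bullet> v))"
    unfolding in_eq av_def using fi ig by simp
  moreover have "\<bar>\<dots>\<bar> \<le> (LINT \<omega>|M. \<bar>w \<omega>\<bar> * (K * (norm v)\<^sup>2))"
  proof (rule abs_integral_le)
    fix \<omega>
    have "\<bar>w \<omega>\<bar> * \<bar>f (x + t \<omega> + v) - f (x + t \<omega>) - G (x + t \<omega>) \<bullet> v\<bar> \<le> \<bar>w \<omega>\<bar> * (K * (norm v)\<^sup>2)"
      using taylorD[OF assms(1)] by (intro mult_left_mono) auto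
    moreover have "w \<omega> * f (x + v + t \<omega>) - w \<omega> * f (x + t \<omega>) - w \<omega> * (G (x + t \<omega>) \<bullet> v)
      = w \<omega> * (f (x + t \<omega> + v) - f (x + t \<omega>) - G (x + t \<omega>) \<bullet> v)"
      by (simp add: algebra_simps)
    ultimately show "\<bar>w \<omega> * f (x + v + t \<omega>) - w \<omega> * f (x + t \<omega>) - w \<omega> * (G (x + t \<omega>) \<bullet> v)\<bar> \<le> \<bar>w \<omega>\<bar> * (K * (norm v)\<^sup>2)"
      by (simp add: abs_mult)
  qed (use fi ig w_int in auto)
  ultimately show "\<bar>av f (x + v) - av f x - avv G x \<bullet> v\<bar> \<le> mass * K * (norm v)\<^sup>2"
    by (simp add: mass_def mult.assoc)
qed

lemma av_C11: assumes "C11 f G" shows "C11 (av f) (avv G)"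
proof -
  have G: "continuous_on UNIV (\<lambda>y. G y $ i)" "periodic (\<lambda>y. G y $ i)" for i
    using assms by (auto intro!: continuous_intros simp: periodic_def C11_def)
  have "continuous_on UNIV (avv G)" "periodic (avv G)"
    using av_continuous[OF G] av_periodic[OF G(2)]
    by (auto simp: avv_def[abs_def] periodic_def vec_eq_iff intro!: continuous_on_vec_lambda)
  then show ?thesis
    using assms av_taylor av_continuous av_periodic unfolding C11_def by blast
qed

lemma av_pair_integrable:
  assumes "continuous_on UNIV f" "periodic f"
  shows "integrable (torus \<Otimes>\<^sub>M M) (\<lambda>(x,\<omega>). w \<omega> * f (x + t \<omega>))"
proof -
  interpret pair_sigma_finite torus M
    by (intro pair_sigma_finite.intro torus.sigma_finite_measure_axioms sigma_finite_measure_axioms)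
  have [measurable]: "f \<in> borel_measurable borel" using assms(1) by (rule borel_measurable_continuous_onI)
  have [measurable]: "(\<lambda>x. x) \<in> borel_measurable torus" by (rule borel_measurable_torus) simp
  obtain S where S: "S \<ge> 0" "\<And>x. norm (f x) \<le> S" using periodic_bounded[OF assms(2,1)] by blast
  have "integrable (torus \<Otimes>\<^sub>M M) (\<lambda>z. S * w (snd z))"
  proof -
    have "integrable (torus \<Otimes>\<^sub>M M) (\<lambda>z. w (snd z))"
    proof (rule Fubini_integrable)
      show "integrable torus (\<lambda>x. LINT y|M. norm (w (snd (x, y))))" by simp
    qed (use w_int in auto)
    then show ?thesis by simp
  qed
  then show ?thesis
    by (rule Bochner_Integration.integrable_bound)
       (use S in \<open>auto simp: abs_mult mult.commute[of S] intro!: mult_left_mono AE_I2\<close>)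
qed

lemma av_integral:
  assumes "continuous_on UNIV f" "periodic f"
  shows "(LINT x|torus. av f x) = (LINT \<omega>|M. w \<omega>) * (LINT x|torus. f x)"
proof -
  interpret pair_sigma_finite torus M
    by (intro pair_sigma_finite.intro torus.sigma_finite_measure_axioms sigma_finite_measure_axioms)
  have "(LINT x|torus. av f x) = (LINT \<omega>|M. (LINT x|torus. w \<omega> * f (x + t \<omega>)))"
    unfolding av_def by (rule Fubini_integral[symmetric]) (rule av_pair_integrable[OF assms])
  also have "\<dots> = (LINT \<omega>|M. w \<omega> * (LINT x|torus. f x))"
    by (simp add: integral_torus_shift[OF assms])
  finally show ?thesis by simp
qed

lemma averaging_abs: "averaging M t (\<lambda>\<omega>. \<bar>w \<omega>\<bar>)"
  by unfold_locales (use w_int in auto)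

text \<open>Young's inequality for convolutions: Jensen in \<omega> costs three powers of the mass,
  and integration over the torus, where every translate of f^4 has the same integral, costs the
  fourth.\<close>

lemma av_L4:
  assumes "continuous_on UNIV f" "periodic f" "mass \<le> W"
  shows "(LINT x|torus. av f x ^ 4) \<le> W^4 * (LINT x|torus. f x ^ 4)"
proof -
  have W: "W \<ge> 0" using assms(3) mass_nonneg by simp
  interpret abs: averaging M t "\<lambda>\<omega>. \<bar>w \<omega>\<bar>" by (rule averaging_abs)
  have f4: "continuous_on UNIV (\<lambda>x. f x ^ 4)" "periodic (\<lambda>x. f x ^ 4)"
    using assms by (auto intro!: continuous_intros simp: periodic_def)
  have "(LINT x|torus. av f x ^ 4) \<le> (LINT x|torus. W^3 * abs.av (\<lambda>x. f x ^ 4) x)"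
  proof (rule integral_mono)
    show "av f x ^ 4 \<le> W^3 * abs.av (\<lambda>x. f x ^ 4) x" for x
      unfolding av_def abs.av_def
      by (rule power4_jensen) (use w_int av_integrable[OF assms(1,2)] abs.av_integrable[OF f4] assms(3) mass_def in auto)
    show "integrable torus (\<lambda>x. av f x ^ 4)" "integrable torus (\<lambda>x. W^3 * abs.av (\<lambda>x. f x ^ 4) x)"
      using av_continuous[OF assms(1,2)] abs.av_continuous[OF f4]
      by (auto intro!: integrable_torus_continuous continuous_intros)
  qed
  also have "\<dots> = W^3 * (mass * (LINT x|torus. f x ^ 4))"
    using abs.av_integral[OF f4] by (simp add: mass_def)
  also have "\<dots> \<le> W^3 * (W * (LINT x|torus. f x ^ 4))"
    using assms(3) W by (intro mult_left_mono mult_right_mono) auto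
  finally show ?thesis by (simp add: power4_eq_xxxx power3_eq_cube mult.assoc)
qed

end

section \<open>Test functions and convolution\<close>

abbreviation grad :: "(real^2 \<Rightarrow> real) \<Rightarrow> real^2 \<Rightarrow> real^2" where
  "grad \<phi> x \<equiv> \<chi> i. partial i \<phi> x"

lemma partial_eq: "(f has_derivative D) (at x) \<Longrightarrow> partial i f x = D (axis i 1)"
  unfolding partial_def by (metis frechet_derivative_at)

lemma Ck_SucD: "Ck (Suc k) f \<Longrightarrow> Ck k f"
proof (induction k arbitrary: f)
  case 0
  then show ?case by (auto simp: continuous_on_eq_continuous_within differentiable_imp_continuous_within)
next
  case (Suc k)
  then show ?case by (metis Ck.simps(2))
qed

lemma differentiable_derivE:
  fixes f :: "real^2 \<Rightarrow> real"
  assumes "f differentiable (at x)"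
  shows "(f has_derivative (\<lambda>v. (\<chi> i. partial i f x) \<bullet> v)) (at x)"
proof -
  have d: "(f has_derivative frechet_derivative f (at x)) (at x)"
    using assms frechet_derivative_works by blast
  interpret bounded_linear "frechet_derivative f (at x)" using d by (rule has_derivative_bounded_linear)
  have "frechet_derivative f (at x) v = (\<chi> i. partial i f x) \<bullet> v" for v
    by (subst (1) vec2_decomp[of v]) (simp add: add scaleR partial_def inner_vec_def sum_2)
  then have "frechet_derivative f (at x) = (\<lambda>v. (\<chi> i. partial i f x) \<bullet> v)" by (rule ext)
  then show ?thesis using d by simp
qed

lemma Ck_const: "Ck k (\<lambda>_. c)"
proof (induction k arbitrary: c)
  case (Suc k)
  have "partial i (\<lambda>_. c) = (\<lambda>_. 0)" for i
    by (rule ext, subst partial_eq[OF has_derivative_const]) simp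
  then show ?case using Suc by simp
qed simp

lemma partial_add:
  assumes "f differentiable (at x)" "g differentiable (at x)"
  shows "partial i (\<lambda>x. f x + g x) x = partial i f x + partial i g x"
  by (subst partial_eq[OF has_derivative_add[OF differentiable_derivE[OF assms(1)] differentiable_derivE[OF assms(2)]]])
     (simp add: inner_axis)

lemma partial_mult:
  assumes "f differentiable (at x)" "g differentiable (at x)"
  shows "partial i (\<lambda>x. f x * g x) x = f x * partial i g x + partial i f x * g x"
  by (subst partial_eq[OF has_derivative_mult[OF differentiable_derivE[OF assms(1)] differentiable_derivE[OF assms(2)]]])
     (simp add: inner_axis)

lemma Ck_add: "Ck k f \<Longrightarrow> Ck k g \<Longrightarrow> Ck k (\<lambda>x. f x + g x)"
proof (induction k arbitrary: f g)
  case (Suc k)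
  then have "partial i (\<lambda>x. f x + g x) = (\<lambda>x. partial i f x + partial i g x)" for i
    by (auto intro!: ext partial_add)
  then show ?case using Suc by (auto intro: differentiable_add)
qed (auto intro: continuous_intros)

lemma Ck_mult: "Ck k f \<Longrightarrow> Ck k g \<Longrightarrow> Ck k (\<lambda>x. f x * g x)"
proof (induction k arbitrary: f g)
  case (Suc k)
  then have eq: "partial i (\<lambda>x. f x * g x) = (\<lambda>x. f x * partial i g x + partial i f x * g x)" for i
    by (auto intro!: ext partial_mult)
  have "Ck k f" "Ck k g" using Suc.prems by (auto dest: Ck_SucD simp del: Ck.simps)
  then show ?case using Suc by (auto simp: eq intro!: Ck_add differentiable_mult)
qed (auto intro: continuous_intros)

text \<open>Amplitude and phase make the family closed under differentiation: a derivative
  multiplies the amplitude and advances the phase by pi/2. The induction then needs no separate case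
  for the sine.\<close>

lemma Ck_cos: "Ck k (\<lambda>x::real^2. c * cos (a * x $ j + b))"
proof (induction k arbitrary: b c)
  case (Suc k)
  have d: "((\<lambda>x::real^2. c * cos (a * x $ j + b)) has_derivative (\<lambda>v. c * (- sin (a * x $ j + b) * (a * v $ j)))) (at x)" for x b
    by (auto intro!: derivative_eq_intros bounded_linear.has_derivative[OF bounded_linear_vec_nth] simp: algebra_simps)
  have "partial i (\<lambda>x. c * cos (a * x $ j + b)) = (\<lambda>x. (if i = j then c * a else 0) * cos (a * x $ j + (b + pi/2)))" for i
  proof
    fix x :: "real^2"
    show "partial i (\<lambda>x. c * cos (a * x $ j + b)) x = (if i = j then c * a else 0) * cos (a * x $ j + (b + pi/2))"
      using cos_add[of "a * x $ j + b" "pi/2"]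
      by (subst partial_eq[OF d]) (simp add: axis_def add.assoc)
  qed
  moreover have "(\<lambda>x. c * cos (a * x $ j + b)) differentiable (at x)" for x :: "real^2"
    using d unfolding differentiable_def by blast
  ultimately show ?case using Suc by simp
qed (auto intro!: continuous_intros)

text \<open>The factor c absorbs the sign change that each derivative of the reflection brings,
  which closes the induction.\<close>

lemma Ck_reflect: "Ck k f \<Longrightarrow> Ck k (\<lambda>x. c * f (v - x))"
proof (induction k arbitrary: f c)
  case 0
  then show ?case by (auto intro!: continuous_intros continuous_on_compose2[of UNIV f])
next
  case (Suc k)
  have d: "((\<lambda>x. c * f (v - x)) has_derivative (\<lambda>u. c * ((\<chi> i. partial i f (v - x)) \<bullet> (- u)))) (at x)" for x
  proof -
    have "((\<lambda>x. v - x) has_derivative uminus) (at x)"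
      by (auto intro!: derivative_eq_intros)
    moreover have "(f has_derivative (\<lambda>u. (\<chi> i. partial i f (v - x)) \<bullet> u)) (at (v - x))"
      using Suc.prems by (intro differentiable_derivE) simp
    ultimately have "((\<lambda>x. f (v - x)) has_derivative (\<lambda>u. (\<chi> i. partial i f (v - x)) \<bullet> (- u))) (at x)"
      by (rule has_derivative_compose)
    then show ?thesis by (rule has_derivative_mult_right)
  qed
  have "partial i (\<lambda>x. c * f (v - x)) = (\<lambda>x. (- c) * partial i f (v - x))" for i
    by (rule ext, subst partial_eq[OF d]) (simp add: inner_axis)
  then have eq: "partial i (\<lambda>x. c * f (v - x)) = (\<lambda>x. (- c) * partial i f (v - x))" for i .
  have "(\<lambda>x. c * f (v - x)) differentiable (at x)" for x
    using d unfolding differentiable_def by blast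
  moreover have "Ck k (partial i (\<lambda>x. c * f (v - x)))" for i
    unfolding eq using Suc.prems by (intro Suc.IH) simp
  ultimately show ?case by simp
qed

lemma partial_reflect:
  assumes "\<And>x. f differentiable (at x)"
  shows "partial i (\<lambda>x. f (v - x)) x = - partial i f (v - x)"
proof -
  have "((\<lambda>x. v - x) has_derivative uminus) (at x)"
    by (auto intro!: derivative_eq_intros)
  then have "((\<lambda>x. f (v - x)) has_derivative (\<lambda>u. (\<chi> i. partial i f (v - x)) \<bullet> (- u))) (at x)"
    by (rule has_derivative_compose) (rule differentiable_derivE[OF assms])
  from partial_eq[OF this] show ?thesis by (simp add: inner_axis)
qed

lemma periodic_partial:
  fixes f :: "real^2 \<Rightarrow> real"
  assumes "periodic f" "\<And>x. f differentiable (at x)" shows "periodic (partial i f)"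
  unfolding periodic_def
proof (intro allI)
  fix x :: "real^2" and j
  have "((\<lambda>x. x + axis j 1) has_derivative (\<lambda>v. v)) (at x)"
    by (auto intro!: derivative_eq_intros)
  then have "((\<lambda>x. f (x + axis j 1)) has_derivative (\<lambda>u. (\<chi> i. partial i f (x + axis j 1)) \<bullet> u)) (at x)"
    by (rule has_derivative_compose) (rule differentiable_derivE[OF assms(2)])
  moreover have "(\<lambda>x. f (x + axis j 1)) = f" using assms(1) by (auto simp: periodic_def)
  ultimately show "partial i f (x + axis j 1) = partial i f x"
    using partial_eq[of f "\<lambda>u. grad f (x + axis j 1) \<bullet> u" x i] by (simp add: inner_axis)
qed

lemma test_differentiable: "\<phi> \<in> test_functions \<Longrightarrow> \<phi> differentiable (at x)"
  unfolding test_functions_def by (metis (no_types, lifting) Ck.simps(2) mem_Collect_eq)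

lemma test_partial:
  assumes "\<phi> \<in> test_functions" shows "partial i \<phi> \<in> test_functions"
proof -
  have "Ck (Suc k) \<phi>" for k using assms unfolding test_functions_def by blast
  then have "Ck k (partial i \<phi>)" for k by simp
  moreover have "periodic (partial i \<phi>)"
    using assms test_differentiable by (intro periodic_partial) (auto simp: test_functions_def)
  ultimately show ?thesis by (simp add: test_functions_def)
qed

lemma test_continuous: "\<phi> \<in> test_functions \<Longrightarrow> continuous_on UNIV \<phi>"
  unfolding test_functions_def by (metis (no_types, lifting) Ck.simps(1) mem_Collect_eq)

lemma test_periodic: "\<phi> \<in> test_functions \<Longrightarrow> periodic \<phi>"
  by (simp add: test_functions_def)

lemma test_const: "(\<lambda>_. c) \<in> test_functions"
  by (simp add: test_functions_def Ck_const periodic_def)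

lemma test_mult: "\<phi> \<in> test_functions \<Longrightarrow> \<psi> \<in> test_functions \<Longrightarrow> (\<lambda>x. \<phi> x * \<psi> x) \<in> test_functions"
  by (simp add: test_functions_def Ck_mult periodic_def)

lemma test_power: "\<phi> \<in> test_functions \<Longrightarrow> (\<lambda>x. \<phi> x ^ n) \<in> test_functions"
  by (induction n) (auto intro: test_mult test_const)

lemma test_reflect:
  assumes "\<phi> \<in> test_functions" shows "(\<lambda>x. \<phi> (v - x)) \<in> test_functions"
proof -
  have "\<phi> (v - (x + axis i 1)) = \<phi> (v - x)" for x i
    using periodic_lattice[OF test_periodic[OF assms], of "- axis i 1" "v - x"] by (simp add: algebra_simps)
  then show ?thesis using assms Ck_reflect[of _ \<phi> 1 v] by (simp add: test_functions_def periodic_def)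
qed

lemma onorm_inner_le:
  fixes a :: "real^2"
  assumes "norm a \<le> S" shows "onorm (\<lambda>u. a \<bullet> u) \<le> S"
proof (rule onorm_le)
  fix u
  have "norm (a \<bullet> u) \<le> norm a * norm u" using Cauchy_Schwarz_ineq2[of a u] by simp
  also have "\<dots> \<le> S * norm u" using assms by (rule mult_right_mono) simp
  finally show "norm (a \<bullet> u) \<le> S * norm u" .
qed

lemma test_C11:
  assumes t: "\<phi> \<in> test_functions" shows "C11 \<phi> (grad \<phi>)"
proof -
  have p: "partial i \<phi> \<in> test_functions" "partial j (partial i \<phi>) \<in> test_functions" for i j
    using t by (auto intro: test_partial)
  have per: "periodic (grad \<phi>)" using test_periodic[OF p(1)] by (simp add: periodic_def vec_eq_iff)
  have cont: "continuous_on UNIV (grad \<phi>)" using test_continuous[OF p(1)] by (intro continuous_on_vec_lambda)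
  have d: "(\<phi> has_derivative (\<lambda>v. grad \<phi> x \<bullet> v)) (at x)" for x
    by (rule differentiable_derivE[OF test_differentiable[OF t]])
  have "\<exists>S\<ge>0. \<forall>i x. norm (grad (partial i \<phi>) x) \<le> S"
  proof -
    have "\<exists>S\<ge>0. \<forall>x. norm (grad (partial i \<phi>) x) \<le> S" for i
    proof -
      have "periodic (grad (partial i \<phi>))" "continuous_on UNIV (grad (partial i \<phi>))"
        using test_periodic[OF p(2)] test_continuous[OF p(2)]
        by (auto simp: periodic_def vec_eq_iff intro!: continuous_on_vec_lambda)
      then show ?thesis by (meson periodic_bounded)
    qed
    then obtain S where "\<And>i. S i \<ge> 0" "\<And>i x. norm (grad (partial i \<phi>) x) \<le> S i" by metis
    then show ?thesis
      by (intro exI[of _ "S 1 + S 2"]) (auto simp: forall_2 intro: add_increasing add_increasing2)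
  qed
  then obtain S where S: "S \<ge> 0" "\<And>i x. norm (grad (partial i \<phi>) x) \<le> S" by blast
  have lip: "norm (grad \<phi> y - grad \<phi> x) \<le> 2 * S * norm (y - x)" for x y
  proof -
    have "\<bar>partial i \<phi> y - partial i \<phi> x\<bar> \<le> S * norm (y - x)" for i
      by (rule gradient_lipschitz[OF differentiable_derivE[OF test_differentiable[OF p(1)]] S(2)])
    then have "(\<Sum>i\<in>UNIV. \<bar>(grad \<phi> y - grad \<phi> x) $ i\<bar>) \<le> (\<Sum>i\<in>(UNIV::2 set). S * norm (y - x))"
      by (intro sum_mono) simp
    then show ?thesis using norm_le_l1_cart[of "grad \<phi> y - grad \<phi> x"] by simp
  qed
  have "taylor (2 * S) \<phi> (grad \<phi>)"
    unfolding taylor_def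
  proof (intro allI)
    fix x v
    \<comment> \<open>After subtraction of the linear part, the derivative on the ball of radius |v|
      is at most 2 S |v|, because the gradient is Lipschitz; the mean value inequality then yields a
      quadratic remainder.\<close>
    let ?g = "\<lambda>y. \<phi> y - grad \<phi> x \<bullet> y"
    have "norm (?g (x + v) - ?g x) \<le> (2 * S * norm v) * norm (x + v - x)"
    proof (rule differentiable_bound[of "cball x (norm v)" ?g "\<lambda>y u. grad \<phi> y \<bullet> u - grad \<phi> x \<bullet> u"])
      fix y assume y: "y \<in> cball x (norm v)"
      show "(?g has_derivative (\<lambda>u. grad \<phi> y \<bullet> u - grad \<phi> x \<bullet> u)) (at y within cball x (norm v))"
        by (intro has_derivative_diff has_derivative_at_withinI[OF d] bounded_linear_imp_has_derivative
              bounded_linear_inner_right)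
      have "norm (grad \<phi> y - grad \<phi> x) \<le> 2 * S * norm v"
        by (rule order_trans[OF lip]) (use y S in \<open>auto simp: dist_norm norm_minus_commute intro: mult_left_mono\<close>)
      then show "onorm (\<lambda>u. grad \<phi> y \<bullet> u - grad \<phi> x \<bullet> u) \<le> 2 * S * norm v"
        unfolding inner_diff_left[symmetric]
        by (rule onorm_inner_le)
    qed (auto simp: dist_norm)
    then show "\<bar>\<phi> (x + v) - \<phi> x - grad \<phi> x \<bullet> v\<bar> \<le> 2 * S * (norm v)\<^sup>2"
      by (simp add: inner_add_right power2_eq_square algebra_simps)
  qed
  then show ?thesis using per cont test_periodic[OF t] test_continuous[OF t] unfolding C11_def by blast
qed

section \<open>Convolution on the torus\<close>

definition conv :: "(real^2 \<Rightarrow> real) \<Rightarrow> (real^2 \<Rightarrow> real) \<Rightarrow> real^2 \<Rightarrow> real" where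
  "conv f \<phi> x = (LINT y|torus. f y * \<phi> (x - y))"

text \<open>Convolution read as an average of translates of the test function with weight f:
  smoothness comes from the test function, and f need only be integrable.\<close>

lemma averaging_torus:
  assumes "integrable torus f" shows "averaging torus uminus f"
proof
  have "(uminus :: real^2 \<Rightarrow> real^2) \<in> borel_measurable borel" by simp
  then show "(uminus :: real^2 \<Rightarrow> real^2) \<in> borel_measurable torus" by (rule borel_measurable_torus)
qed (rule assms)

lemma conv_av: "integrable torus f \<Longrightarrow> conv f \<phi> = averaging.av torus uminus f \<phi>"
  by (rule ext) (simp add: conv_def averaging.av_def[OF averaging_torus])

lemma conv_avv: "integrable torus f \<Longrightarrow> averaging.avv torus uminus f (grad \<phi>) x = (\<chi> i. conv f (partial i \<phi>) x)"
  by (simp add: averaging.avv_def[OF averaging_torus] conv_av)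

lemma conv_C11:
  assumes "integrable torus f" "\<phi> \<in> test_functions"
  shows "C11 (conv f \<phi>) (\<lambda>x. \<chi> i. conv f (partial i \<phi>) x)"
  using averaging.av_C11[OF averaging_torus[OF assms(1)] test_C11[OF assms(2)]]
  by (simp add: conv_av[OF assms(1)] conv_avv[OF assms(1), abs_def] averaging.avv_def[OF averaging_torus[OF assms(1)], abs_def])

lemma conv_partial:
  assumes "integrable torus f" "\<phi> \<in> test_functions"
  shows "partial i (conv f \<phi>) x = conv f (partial i \<phi>) x"
  by (subst partial_eq[OF C11_has_derivative[OF conv_C11[OF assms]]]) (simp add: inner_axis)

lemma conv_test:
  assumes f: "integrable torus f" and t: "\<phi> \<in> test_functions"
  shows "conv f \<phi> \<in> test_functions"
proof -
  have "Ck k (conv f \<phi>)" if "\<phi> \<in> test_functions" for k \<phi>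
    using that
  proof (induction k arbitrary: \<phi>)
    case 0
    then show ?case using conv_C11[OF f] by (simp add: C11_def)
  next
    case (Suc k)
    have "partial i (conv f \<phi>) = conv f (partial i \<phi>)" for i
      using conv_partial[OF f Suc.prems] by blast
    moreover have "conv f \<phi> differentiable (at x)" for x
      using C11_has_derivative[OF conv_C11[OF f Suc.prems]] by (auto simp: differentiable_def)
    ultimately show ?case using Suc test_partial by simp
  qed
  then show ?thesis using t conv_C11[OF f t] by (simp add: test_functions_def C11_def)
qed

lemma Lp_integrable:
  fixes f :: "real^2 \<Rightarrow> 'b::euclidean_space"
  assumes "f \<in> Lp_torus p" "p > 0"
  shows "integrable torus f"
proof (rule Bochner_Integration.integrable_bound)
  show "integrable torus (\<lambda>x. 1 + norm (f x) ^ p)" using assms by (simp add: Lp_torus_def)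
  show "f \<in> borel_measurable torus" using assms by (simp add: Lp_torus_def)
  have "norm (f x) \<le> 1 + norm (f x) ^ p" for x
    using self_le_power[of "norm (f x)" p] assms(2) by (cases "norm (f x) \<ge> 1") (auto intro: add_increasing2)
  then show "AE x in torus. norm (f x) \<le> norm (1 + norm (f x) ^ p)"
    by (intro AE_I2) (metis abs_ge_self order_trans real_norm_def)
qed

text \<open>The function y |-> \<phi>(x - y) is again a test function, and the sign from the
  reflection cancels the sign in the definition of the weak derivative. Hence mollification commutes
  with weak differentiation.\<close>

lemma conv_weak_partial:
  assumes "has_weak_partial i f g" "\<phi> \<in> test_functions"
  shows "conv f (partial i \<phi>) x = conv g \<phi> x"
proof -
  have "(LINT y|torus. f y * partial i (\<lambda>y. \<phi> (x - y)) y) = - (LINT y|torus. g y * \<phi> (x - y))"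
    using assms test_reflect unfolding has_weak_partial_def by blast
  then show ?thesis
    by (simp add: partial_reflect[OF test_differentiable[OF assms(2)]] conv_def)
qed

lemma integrable_mult_test:
  fixes f \<phi> :: "real^2 \<Rightarrow> real"
  assumes "integrable torus f" "continuous_on UNIV \<phi>" "periodic \<phi>"
  shows "integrable torus (\<lambda>x. f x * \<phi> x)"
proof -
  obtain S where S: "S \<ge> 0" "\<And>x. norm (\<phi> x) \<le> S" using periodic_bounded[OF assms(3,2)] by blast
  have [measurable]: "f \<in> borel_measurable torus" "\<phi> \<in> borel_measurable torus"
    using assms continuous_torus_measurable by auto
  have "integrable torus (\<lambda>x. S * f x)" using assms(1) by simp
  then show ?thesis
    by (rule Bochner_Integration.integrable_bound)
       (use S in \<open>auto simp: abs_mult mult.commute[of S] intro!: mult_left_mono AE_I2\<close>)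
qed

section \<open>Approximate identity\<close>

text \<open>Equal to cos^2(pi x_1) cos^2(pi x_2), with value 1 exactly on the lattice. Its
  normalised powers concentrate there and are trigonometric polynomials, hence smooth and periodic
  without any gluing.\<close>

definition bump :: "real^2 \<Rightarrow> real" where
  "bump x = ((1 + cos (2 * pi * x $ 1)) / 2) * ((1 + cos (2 * pi * x $ 2)) / 2)"

definition kern :: "nat \<Rightarrow> real^2 \<Rightarrow> real" where
  "kern n x = bump x ^ n / (LINT y|torus. bump y ^ n)"

lemma periodic_cos: "periodic (\<lambda>x::real^2. cos (2 * pi * x $ j))"
proof -
  have "cos (2 * pi * (x $ j + 1)) = cos (2 * pi * x $ j)" for x :: "real^2"
    by (simp add: distrib_left)
  then show ?thesis by (simp add: periodic_def axis_def)
qed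

lemma bump_test: "bump \<in> test_functions"
proof -
  have *: "Ck k (\<lambda>x::real^2. (1 + cos (2 * pi * x $ j)) / 2)" for j k
    using Ck_add[OF Ck_const[of k "1/2"] Ck_cos[of k "1/2" "2 * pi" j 0]] by (simp add: add_divide_distrib)
  have "(\<lambda>x::real^2. (1 + cos (2 * pi * x $ j)) / 2) \<in> test_functions" for j
    using * periodic_cos[of j] by (simp add: test_functions_def periodic_def)
  then show ?thesis unfolding bump_def[abs_def] by (intro test_mult)
qed

lemma bump_continuous: "continuous_on UNIV bump"
  by (rule test_continuous[OF bump_test])

lemma half_cos_bounds: "0 \<le> (1 + cos t) / 2" "(1 + cos t) / 2 \<le> (1::real)"
  using cos_ge_minus_one[of t] cos_le_one[of t] by (simp_all del: cos_ge_minus_one cos_le_one)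

lemma bump_bounds: "0 \<le> bump x" "bump x \<le> 1"
proof -
  show "0 \<le> bump x" unfolding bump_def by (intro mult_nonneg_nonneg half_cos_bounds)
  have "bump x \<le> 1 * 1" unfolding bump_def by (intro mult_mono half_cos_bounds) auto
  then show "bump x \<le> 1" by simp
qed

lemma bump_zero: "bump 0 = 1"
  by (simp add: bump_def)

lemma bump_even: "bump (- x) = bump x"
  by (simp add: bump_def)

lemma bump_eq_1:
  assumes "bump x = 1" "\<And>i. \<bar>x $ i\<bar> \<le> 1/2" shows "x = 0"
proof -
  let ?a = "\<lambda>j. (1 + cos (2 * pi * x $ j)) / 2"
  have ab: "?a 1 * ?a 2 = 1" using assms(1) by (simp add: bump_def)
  have "?a 1 * ?a 2 \<le> ?a 1 * 1" "?a 1 * ?a 2 \<le> 1 * ?a 2"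
    by (intro mult_left_mono mult_right_mono half_cos_bounds)+
  then have "?a j \<ge> 1" for j using ab exhaust_2[of j] by auto
  then have "cos (2 * pi * x $ j) = 1" for j
    using cos_le_one[of "2 * pi * x $ j"] by (intro antisym) (simp_all add: field_simps)
  then have "\<exists>n::int. 2 * pi * x $ j = n * 2 * pi" for j using cos_one_2pi_int by blast
  then have n: "\<exists>n::int. x $ j = n" for j by auto
  have "x $ j = 0" for j
  proof -
    obtain n :: int where "x $ j = n" using n by blast
    moreover from this have "n = 0" using assms(2)[of j] by linarith
    ultimately show ?thesis by simp
  qed
  then show ?thesis by (simp add: vec_eq_iff)
qed

lemma small_box_subset: "s \<le> 1 \<Longrightarrow> cbox 0 (s *\<^sub>R 1) \<subseteq> cbox 0 (1::real^2)"
  unfolding subset_box by simp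

lemma emeasure_torus_small_box:
  assumes "0 < s" "s \<le> 1"
  shows "measure torus (cbox 0 (s *\<^sub>R 1)) = s^2"
proof -
  have sub: "cbox 0 (s *\<^sub>R 1) \<subseteq> cbox 0 (1::real^2)"
    using assms by (intro small_box_subset)
  have "measure torus (cbox 0 (s *\<^sub>R 1)) = measure lebesgue (cbox 0 (s *\<^sub>R (1::real^2)))"
    unfolding torus_def by (rule measure_restrict_space) (use sub in auto)
  also have "\<dots> = (\<Prod>b\<in>(Basis::(real^2) set). s)"
    using assms by (subst measure_completion) (auto simp: measure_lborel_cbox_eq)
  also have "\<dots> = s^2" by simp
  finally show ?thesis .
qed

text \<open>By continuity \<open>bump\<close> is at least 1 - \<delta> on a small square, whose area
  m does not depend on n. So the normalising integrals decay at most geometrically, with a ratio as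
  close to 1 as desired.\<close>

lemma bump_power_integral_ge:
  assumes "0 < \<delta>" "\<delta> < 1"
  obtains m where "m > 0" "\<And>n. (1 - \<delta>)^n * m \<le> (LINT y|torus. bump y ^ n)"
proof -
  have "isCont bump 0" using bump_continuous by (simp add: continuous_on_eq_continuous_at)
  then obtain r where r: "r > 0" "\<And>x. norm x < r \<Longrightarrow> \<bar>bump x - 1\<bar> < \<delta>"
    using assms(1) unfolding continuous_at_eps_delta by (auto simp: bump_zero dist_norm dest!: spec[of _ \<delta>])
  \<comment> \<open>The square with side s lies in the cell, and its points have norm at most 2 s <
    r.\<close>
  define s where "s = min 1 (r/4)"
  have s: "0 < s" "s \<le> 1" using r by (auto simp: s_def)
  let ?B = "cbox 0 (s *\<^sub>R (1::real^2))"
  have near: "bump x \<ge> 1 - \<delta>" if "x \<in> ?B" for x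
  proof -
    have "\<bar>x $ i\<bar> \<le> s" for i using that by (auto simp: mem_box_cart)
    then have "(\<Sum>i\<in>UNIV. \<bar>x $ i\<bar>) \<le> (\<Sum>i\<in>(UNIV::2 set). s)" by (intro sum_mono)
    then have "norm x \<le> 2 * s" using norm_le_l1_cart[of x] by simp
    also have "\<dots> < r" using r(1) by (auto simp: s_def min_def)
    finally show ?thesis using r(2)[of x] by linarith
  qed
  have "(1 - \<delta>)^n * s^2 \<le> (LINT y|torus. bump y ^ n)" for n
  proof -
    have "(LINT y|torus. (1 - \<delta>)^n * indicator ?B y) \<le> (LINT y|torus. bump y ^ n)"
    proof (rule integral_mono)
      show "integrable torus (\<lambda>y. (1 - \<delta>)^n * indicator ?B y)"
        by (intro integrable_torus_bounded[where S="\<bar>1 - \<delta>\<bar>^n"] borel_measurable_torus) (auto simp: indicator_def power_abs)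
      show "integrable torus (\<lambda>y. bump y ^ n)"
        by (intro integrable_torus_continuous continuous_intros bump_continuous)
      show "(1 - \<delta>)^n * indicator ?B y \<le> bump y ^ n" for y
        using near[of y] assms bump_bounds[of y] by (auto simp: indicator_def intro: power_mono)
    qed
    moreover have "?B \<inter> space torus = ?B"
      using small_box_subset[OF s(2)] by auto
    then have "(LINT y|torus. (1 - \<delta>)^n * indicator ?B y) = (1 - \<delta>)^n * s^2"
      by (simp add: emeasure_torus_small_box[OF s])
    ultimately show ?thesis by (simp only:)
  qed
  then show ?thesis using that[of "s^2"] s by auto
qed

lemma bump_power_integral_pos: "(LINT y|torus. bump y ^ n) > 0"
proof -
  obtain m where "m > 0" "\<And>n. (1 - 1/2)^n * m \<le> (LINT y|torus. bump y ^ n)"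
    using bump_power_integral_ge[of "1/2"] by auto
  moreover from this(1) have "(1 - 1/2 :: real)^n * m > 0" by simp
  ultimately show ?thesis by (meson less_le_trans)
qed

lemma kern_test: "kern n \<in> test_functions"
  using test_mult[OF test_power[OF bump_test, of n] test_const[of "inverse (LINT y|torus. bump y ^ n)"]]
  by (simp add: kern_def[abs_def] divide_inverse)

lemma kern_nonneg: "kern n x \<ge> 0"
  using bump_power_integral_pos[of n] bump_bounds by (simp add: kern_def)

lemma kern_even: "kern n (- x) = kern n x"
  by (simp add: kern_def bump_even)

lemma kern_integral: "(LINT x|torus. kern n x) = 1"
  using bump_power_integral_pos[of n] by (simp add: kern_def[abs_def])

lemma kern_continuous: "continuous_on UNIV (kern n)" and kern_periodic: "periodic (kern n)"
  using test_continuous test_periodic kern_test by auto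

lemma kern_integral_shift: "(LINT y|torus. kern n (x - y)) = 1"
proof -
  have "(LINT y|torus. kern n (y + (- x))) = 1"
    by (subst integral_torus_shift[OF kern_continuous kern_periodic]) (rule kern_integral)
  moreover have "kern n (y + (- x)) = kern n (x - y)" for y
    using kern_even[of n "x - y"] by simp
  ultimately show ?thesis by simp
qed

text \<open>The factor 1 - bump measures the distance from the lattice, so one limit takes the place
  of estimates of the kernel outside every neighbourhood.\<close>

lemma kern_concentrates: "(\<lambda>n. LINT x|torus. kern n x * (1 - bump x)) \<longlonglongrightarrow> 0"
proof (rule LIMSEQ_I)
  fix r :: real assume r: "r > 0"
  define \<delta> where "\<delta> = min (1/2) (r/2)"
  have \<delta>: "0 < \<delta>" "\<delta> < 1" "\<delta> \<le> r/2" using r by (auto simp: \<delta>_def)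
  \<comment> \<open>Half of \<delta> is used here: where 1 - bump exceeds \<delta>, the numerator of
    the kernel is at most (1 - \<delta>)^n, while its denominator is at least (1 - \<delta>/2)^n m.
    The gap between the two bases gives q < 1.\<close>
  obtain m where m: "m > 0" "\<And>n. (1 - \<delta>/2)^n * m \<le> (LINT y|torus. bump y ^ n)"
    using bump_power_integral_ge[of "\<delta>/2"] \<delta> by auto
  define q where "q = (1 - \<delta>) / (1 - \<delta>/2)"
  have q: "0 < q" "q < 1" using \<delta> by (auto simp: q_def)
  have bound: "(LINT x|torus. kern n x * (1 - bump x)) \<le> \<delta> + q^n / m" for n
  proof -
    let ?J = "LINT y|torus. bump y ^ n"
    have J: "?J > 0" by (rule bump_power_integral_pos)
    have "(LINT x|torus. kern n x * (1 - bump x)) \<le> (LINT x|torus. \<delta> * kern n x + (1 - \<delta>)^n / ?J)"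
    proof (rule integral_mono)
      fix x
      show "kern n x * (1 - bump x) \<le> \<delta> * kern n x + (1 - \<delta>)^n / ?J"
      proof (cases "1 - bump x \<le> \<delta>")
        case True
        then have "kern n x * (1 - bump x) \<le> kern n x * \<delta>"
          by (intro mult_left_mono kern_nonneg)
        then show ?thesis using J \<delta> by (simp add: mult.commute add_increasing2)
      next
        case False
        then have "bump x ^ n \<le> (1 - \<delta>)^n" by (intro power_mono bump_bounds) auto
        then have "kern n x \<le> (1 - \<delta>)^n / ?J" using J unfolding kern_def by (intro divide_right_mono) auto
        moreover have "kern n x * (1 - bump x) \<le> kern n x * 1"
          using bump_bounds by (intro mult_left_mono kern_nonneg) auto
        ultimately show ?thesis using kern_nonneg[of n x] \<delta> by (simp add: add_increasing)
      qed
    qed (auto intro!: integrable_torus_continuous continuous_intros kern_continuous bump_continuous)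
    also have "\<dots> = \<delta> + (1 - \<delta>)^n / ?J"
      using kern_integral integrable_torus_continuous[OF kern_continuous[of n]] by simp
    also have "(1 - \<delta>)^n / ?J \<le> (1 - \<delta>)^n / ((1 - \<delta>/2)^n * m)"
      using m \<delta> J by (intro divide_left_mono) auto
    also have "\<dots> = q^n / m" by (simp add: q_def power_divide)
    finally show ?thesis by simp
  qed
  have "(\<lambda>n. q^n / m) \<longlonglongrightarrow> 0 / m" using q m(1) by (intro tendsto_intros LIMSEQ_power_zero) auto
  then have "\<forall>\<^sub>F n in sequentially. q^n / m < r/2" using r by (intro order_tendstoD) auto
  then obtain N where N: "\<And>n. n \<ge> N \<Longrightarrow> q^n / m < r/2" by (auto simp: eventually_sequentially)
  have "norm ((LINT x|torus. kern n x * (1 - bump x)) - 0) < r" if "n \<ge> N" for n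
  proof -
    have "(LINT x|torus. kern n x * (1 - bump x)) \<ge> 0"
      by (rule integral_nonneg_AE) (use kern_nonneg bump_bounds in \<open>auto intro!: AE_I2\<close>)
    then show ?thesis using bound[of n] N[OF that] \<delta>(3) unfolding real_norm_def by linarith
  qed
  then show "\<exists>N. \<forall>n\<ge>N. norm ((LINT x|torus. kern n x * (1 - bump x)) - 0) < r" by blast
qed

text \<open>Uniform continuity in a form that can be integrated against the kernel. If x and y are
  close modulo the lattice, e suffices; otherwise 1 - bump is bounded below by compactness and the
  crude bound 2 S is absorbed into C.\<close>

lemma bump_modulus:
  fixes g :: "real^2 \<Rightarrow> real"
  assumes g: "continuous_on UNIV g" "periodic g" and e: "e > 0"
  obtains C where "C \<ge> 0" "\<And>x y. \<bar>g y - g x\<bar> \<le> e + C * (1 - bump (x - y))"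
proof -
  obtain S where S: "S \<ge> 0" "\<And>x. norm (g x) \<le> S" using periodic_bounded[OF g(2,1)] by blast
  \<comment> \<open>Any ball of radius at least 3 would do: it has to contain
    \<open>fracv x\<close>, of norm at most 2, and \<open>fracv x - z\<close> with z of norm at most
    1.\<close>
  have "uniformly_continuous_on (cball 0 10) g"
    using g(1) by (intro compact_uniformly_continuous) (auto intro: continuous_on_subset)
  then obtain d where d: "d > 0" "\<And>x y. x \<in> cball 0 10 \<Longrightarrow> y \<in> cball 0 10 \<Longrightarrow> dist y x < d \<Longrightarrow> dist (g y) (g x) < e"
    using e unfolding uniformly_continuous_on_def by metis
  define K where "K = {z::real^2. (\<forall>i. \<bar>z $ i\<bar> \<le> 1/2) \<and> norm z \<ge> d}"
  have Ksub: "K \<subseteq> cbox (\<chi> i. -(1/2)) (\<chi> i. 1/2)"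
  proof
    fix z assume "z \<in> K"
    then have "\<bar>z $ i\<bar> \<le> 1/2" for i by (auto simp: K_def)
    then have "-(1/2) \<le> z $ i" "z $ i \<le> 1/2" for i by (simp_all only: abs_le_iff minus_le_iff)
    then show "z \<in> cbox (\<chi> i. -(1/2)) (\<chi> i. 1/2)" by (simp add: mem_box_cart)
  qed
  have "closed K" unfolding K_def
    by (intro closed_Collect_conj closed_Collect_all closed_Collect_le continuous_intros)
  then have K: "compact K" using Ksub bounded_subset[OF bounded_cbox] compact_eq_bounded_closed by blast
  have "\<exists>c>0. \<forall>z\<in>K. c \<le> 1 - bump z"
  proof (cases "K = {}")
    case False
    have "continuous_on K (\<lambda>z. 1 - bump z)"
      by (intro continuous_intros continuous_on_subset[OF bump_continuous]) auto
    then obtain z0 where z0: "z0 \<in> K" "\<And>z. z \<in> K \<Longrightarrow> 1 - bump z0 \<le> 1 - bump z"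
      using continuous_attains_inf[OF K False] by blast
    have "bump z0 \<noteq> 1" using bump_eq_1[of z0] z0(1) d(1) by (auto simp: K_def)
    then have "1 - bump z0 > 0" using bump_bounds[of z0] by simp
    then show ?thesis using z0 by blast
  qed (auto intro: exI[of _ 1])
  then obtain c where c: "c > 0" "\<And>z. z \<in> K \<Longrightarrow> c \<le> 1 - bump z" by blast
  have "\<bar>g y - g x\<bar> \<le> e + (2 * S / c) * (1 - bump (x - y))" for x y
  proof -
    \<comment> \<open>The lattice point nearest to x - y, so that z has coordinates in [-1/2, 1/2],
      where 0 is the only zero of 1 - bump.\<close>
    define k :: "real^2" where "k = (\<chi> i. of_int (round ((x - y) $ i)))"
    have k: "k \<in> lattice" by (simp add: k_def lattice_def)
    define z where "z = x - y - k"
    have z: "\<bar>z $ i\<bar> \<le> 1/2" for i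
      using of_int_round_abs_le[of "(x - y) $ i"] by (simp add: z_def k_def abs_minus_commute)
    have bz: "bump z = bump (x - y)"
      using periodic_lattice[OF test_periodic[OF bump_test] k, of z] by (simp add: z_def)
    let ?x = "fracv x"
    have "y = (?x - z) + ((x - fracv x) - k)" by (simp add: z_def)
    then have gy: "g y = g (?x - z)"
      using periodic_lattice[OF g(2), of "(x - fracv x) - k" "?x - z"] fracv_lattice[of x] k by simp
    have gx: "g x = g ?x" using periodic_fracv[OF g(2)] by simp
    show ?thesis
    proof (cases "norm z < d")
      case True
      have "\<bar>?x $ i\<bar> \<le> 1" for i using fracv_cell[of x] by (auto simp: unit_cell_def abs_le_iff less_imp_le)
      then have "(\<Sum>i\<in>UNIV. \<bar>?x $ i\<bar>) \<le> (\<Sum>i\<in>(UNIV::2 set). 1)" by (intro sum_mono)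
      then have nx: "norm ?x \<le> 2" using norm_le_l1_cart[of ?x] by simp
      have "(\<Sum>i\<in>UNIV. \<bar>z $ i\<bar>) \<le> (\<Sum>i\<in>(UNIV::2 set). 1/2)" using z by (intro sum_mono)
      then have nz: "norm z \<le> 1" using norm_le_l1_cart[of z] by simp
      have "dist (g (?x - z)) (g ?x) < e"
        using nx nz True norm_triangle_ineq4[of ?x z]
        by (intro d(2)) (auto simp: dist_norm norm_minus_commute)
      then have "\<bar>g y - g x\<bar> \<le> e" by (simp add: gx gy dist_norm)
      moreover have "(2 * S / c) * (1 - bump (x - y)) \<ge> 0" using S c bump_bounds by simp
      ultimately show ?thesis by simp
    next
      case False
      then have "z \<in> K" using z by (simp add: K_def)
      then have "c \<le> 1 - bump (x - y)" using c(2)[of z] unfolding bz by blast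
      then have "(2 * S / c) * c \<le> (2 * S / c) * (1 - bump (x - y))" using S c by (intro mult_left_mono) auto
      moreover have "\<bar>g y - g x\<bar> \<le> 2 * S" using S(2)[of x] S(2)[of y] by simp
      ultimately show ?thesis using c e by simp
    qed
  qed
  then show ?thesis using that[of "2 * S / c"] S c by simp
qed

lemma conv_integrable: "integrable torus f \<Longrightarrow> \<phi> \<in> test_functions \<Longrightarrow> integrable torus (\<lambda>y. f y * \<phi> (x - y))"
  using test_reflect by (intro integrable_mult_test test_continuous test_periodic) auto

lemma conv_diff:
  assumes "integrable torus f" "integrable torus g" "\<phi> \<in> test_functions"
  shows "conv (\<lambda>x. f x - g x) \<phi> x = conv f \<phi> x - conv g \<phi> x"
  using conv_integrable[OF assms(1,3)] conv_integrable[OF assms(2,3)]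
  by (simp add: conv_def left_diff_distrib)

lemma conv_kern_uniform:
  assumes g: "continuous_on UNIV g" "periodic g" and e: "e > 0"
  shows "\<forall>\<^sub>F n in sequentially. \<forall>x. \<bar>conv g (kern n) x - g x\<bar> \<le> e"
proof -
  obtain C where C: "C \<ge> 0" "\<And>x y. \<bar>g y - g x\<bar> \<le> e/2 + C * (1 - bump (x - y))"
    using bump_modulus[OF g, of "e/2"] e by auto
  have "(\<lambda>n. C * (LINT x|torus. kern n x * (1 - bump x))) \<longlonglongrightarrow> C * 0"
    by (intro tendsto_intros kern_concentrates)
  then have "\<forall>\<^sub>F n in sequentially. C * (LINT x|torus. kern n x * (1 - bump x)) < e/2"
    using e by (intro order_tendstoD) auto
  then show ?thesis
  proof (rule eventually_mono, intro allI)
    fix n x assume n: "C * (LINT x|torus. kern n x * (1 - bump x)) < e/2"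
    have cg: "continuous_on UNIV (\<lambda>y. kern n (x - y))" "continuous_on UNIV (\<lambda>y. bump (x - y))"
      using test_reflect test_continuous kern_test bump_test by auto
    have i: "integrable torus (\<lambda>y. g y * kern n (x - y))" "integrable torus (\<lambda>y. kern n (x - y))"
        "integrable torus (\<lambda>y. kern n (x - y) * (1 - bump (x - y)))"
      using g cg by (auto intro!: integrable_torus_continuous continuous_intros)
    have "conv g (kern n) x - g x = (LINT y|torus. g y * kern n (x - y)) - (LINT y|torus. g x * kern n (x - y))"
      using kern_integral_shift[of n x] i by (simp add: conv_def)
    also have "\<dots> = (LINT y|torus. (g y - g x) * kern n (x - y))"
      using i by (simp add: left_diff_distrib)
    also have "\<bar>\<dots>\<bar> \<le> (LINT y|torus. e/2 * kern n (x - y) + C * (kern n (x - y) * (1 - bump (x - y))))"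
    proof (rule abs_integral_le)
      fix y
      have "\<bar>g y - g x\<bar> * kern n (x - y) \<le> (e/2 + C * (1 - bump (x - y))) * kern n (x - y)"
        by (intro mult_right_mono C kern_nonneg)
      then show "\<bar>(g y - g x) * kern n (x - y)\<bar> \<le> e/2 * kern n (x - y) + C * (kern n (x - y) * (1 - bump (x - y)))"
        using kern_nonneg[of n "x - y"] by (simp add: abs_mult) (simp add: algebra_simps)
    qed (use i in \<open>auto simp: left_diff_distrib\<close>)
    also have "\<dots> = e/2 + C * (LINT y|torus. kern n (x - y) * (1 - bump (x - y)))"
      using i kern_integral_shift[of n x] by simp
    also have "(LINT y|torus. kern n (x - y) * (1 - bump (x - y))) = (LINT y|torus. kern n (y + (-x)) * (1 - bump (y + (-x))))"
      using kern_even[of n "x - _"] bump_even[of "x - _"] by simp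
    also have "\<dots> = (LINT y|torus. kern n y * (1 - bump y))"
      using kern_periodic bump_test
      by (intro integral_torus_shift[where f="\<lambda>y. kern n y * (1 - bump y)"] continuous_intros kern_continuous bump_continuous)
         (auto simp: periodic_def test_functions_def)
    finally show "\<bar>conv g (kern n) x - g x\<bar> \<le> e" using n by simp
  qed
qed

lemma conv_L1:
  assumes "integrable torus f"
  shows "(LINT x|torus. \<bar>conv f (kern n) x\<bar>) \<le> (LINT x|torus. \<bar>f x\<bar>)"
proof -
  have fa: "integrable torus (\<lambda>x. \<bar>f x\<bar>)" using assms by simp
  have "(LINT x|torus. \<bar>conv f (kern n) x\<bar>) \<le> (LINT x|torus. conv (\<lambda>x. \<bar>f x\<bar>) (kern n) x)"
  proof (rule integral_mono)
    show "integrable torus (\<lambda>x. \<bar>conv f (kern n) x\<bar>)"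
      using test_continuous[OF conv_test[OF assms kern_test]] by (intro integrable_torus_continuous continuous_intros)
    show "integrable torus (\<lambda>x. conv (\<lambda>x. \<bar>f x\<bar>) (kern n) x)"
      using test_continuous[OF conv_test[OF fa kern_test]] by (intro integrable_torus_continuous)
    show "\<bar>conv f (kern n) x\<bar> \<le> conv (\<lambda>x. \<bar>f x\<bar>) (kern n) x" for x
      unfolding conv_def
      by (rule abs_integral_le)
         (use conv_integrable[OF assms kern_test] conv_integrable[OF fa kern_test] kern_nonneg in \<open>auto simp: abs_mult\<close>)
  qed
  also have "\<dots> = (LINT x|torus. \<bar>f x\<bar>)"
    by (simp add: conv_av[OF fa] averaging.av_integral[OF averaging_torus[OF fa] kern_continuous kern_periodic] kern_integral)
  finally show ?thesis .
qed

text \<open>\<open>av_L4\<close> would treat f as the weight. Here the kernel is the probability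
  weight in Jensen's inequality, so the bound is uniform in n.\<close>

lemma conv_L4:
  assumes f: "integrable torus f" and f4: "integrable torus (\<lambda>x. f x ^ 4)"
  shows "(LINT x|torus. conv f (kern n) x ^ 4) \<le> (LINT x|torus. f x ^ 4)"
proof -
  have "(LINT x|torus. conv f (kern n) x ^ 4) \<le> (LINT x|torus. conv (\<lambda>x. f x ^ 4) (kern n) x)"
  proof (rule integral_mono)
    show "integrable torus (\<lambda>x. conv f (kern n) x ^ 4)"
      using test_continuous[OF conv_test[OF f kern_test]] by (intro integrable_torus_continuous continuous_intros)
    show "integrable torus (\<lambda>x. conv (\<lambda>x. f x ^ 4) (kern n) x)"
      using test_continuous[OF conv_test[OF f4 kern_test]] by (intro integrable_torus_continuous)
    fix x
    have i: "integrable torus (\<lambda>y. kern n (x - y))"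
      using test_reflect test_continuous kern_test by (intro integrable_torus_continuous) auto
    have "(LINT y|torus. kern n (x - y) * f y)^4 \<le> 1^3 * (LINT y|torus. \<bar>kern n (x - y)\<bar> * f y ^ 4)"
      by (rule power4_jensen)
         (use i conv_integrable[OF f kern_test, of n x] conv_integrable[OF f4 kern_test, of n x] kern_nonneg kern_integral_shift
           in \<open>simp_all add: mult.commute\<close>)
    then show "conv f (kern n) x ^ 4 \<le> conv (\<lambda>x. f x ^ 4) (kern n) x"
      using kern_nonneg by (simp add: conv_def mult.commute)
  qed
  also have "\<dots> = (LINT x|torus. f x ^ 4)"
    by (simp add: conv_av[OF f4] averaging.av_integral[OF averaging_torus[OF f4] kern_continuous kern_periodic] kern_integral)
  finally show ?thesis .
qed

section \<open>Density of continuous periodic functions in L^1\<close>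

definition clamp :: "real \<Rightarrow> real \<Rightarrow> real" where "clamp M t = max (- M) (min M t)"

lemma clamp_bound: "M \<ge> 0 \<Longrightarrow> \<bar>clamp M t\<bar> \<le> M"
  by (auto simp: clamp_def)

lemma clamp_le: "M \<ge> 0 \<Longrightarrow> \<bar>clamp M t\<bar> \<le> \<bar>t\<bar>"
  by (auto simp: clamp_def)

text \<open>The sine product vanishes exactly on the grid lines where some coordinate is an integer,
  that is, where a periodised function may jump.\<close>

definition cutoff :: "nat \<Rightarrow> real^2 \<Rightarrow> real" where
  "cutoff n x = min 1 (real n * \<bar>sin (pi * x $ 1) * sin (pi * x $ 2)\<bar>)"

lemma cutoff_continuous: "continuous_on UNIV (cutoff n)"
  unfolding cutoff_def[abs_def] by (intro continuous_intros)

lemma cutoff_periodic: "periodic (cutoff n)"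
proof -
  have "\<bar>sin (pi * (t + 1))\<bar> = \<bar>sin (pi * t)\<bar>" for t :: real
    by (simp add: distrib_left)
  then show ?thesis
    unfolding periodic_def cutoff_def by (auto simp: axis_def abs_mult forall_2)
qed

lemma cutoff_bounds: "0 \<le> cutoff n x" "cutoff n x \<le> 1"
  by (auto simp: cutoff_def)

lemma sin_pi_zero: "t \<in> \<int> \<Longrightarrow> sin (pi * t) = 0"
  by (auto elim!: Ints_cases simp: sin_zero_iff_int2 mult.commute)

text \<open>Off the grid lines \<open>fracv\<close> is continuous; on them the product is squeezed
  to zero, since g is bounded.\<close>

lemma continuous_cutoff_fracv:
  fixes g :: "real^2 \<Rightarrow> real"
  assumes g: "continuous_on UNIV g" "\<And>x. \<bar>g x\<bar> \<le> M"
  shows "continuous_on UNIV (\<lambda>x. cutoff n x * g (fracv x))"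
  unfolding continuous_on_eq_continuous_at[OF open_UNIV]
proof
  fix x :: "real^2"
  have c: "isCont (cutoff n) x" using cutoff_continuous by (simp add: continuous_on_eq_continuous_at)
  show "isCont (\<lambda>x. cutoff n x * g (fracv x)) x"
  proof (cases "\<exists>i. x $ i \<in> \<int>")
    case False
    have "isCont (\<lambda>x. frac (x $ i)) x" for i
    proof (rule isCont_o2[where g=frac])
      show "isCont (\<lambda>x. x $ i) x" by (intro continuous_intros)
      show "isCont frac (x $ i)" using False continuous_frac by blast
    qed
    then have "isCont fracv x"
      unfolding fracv_def[abs_def] isCont_def by (intro tendsto_vec_lambda) auto
    moreover have "isCont g (fracv x)" using g(1) by (simp add: continuous_on_eq_continuous_at)
    ultimately have "isCont (\<lambda>x. g (fracv x)) x" by (rule isCont_o2)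
    then show ?thesis using c by (rule continuous_mult[rotated])
  next
    case True
    then have "sin (pi * x $ 1) = 0 \<or> sin (pi * x $ 2) = 0" using sin_pi_zero by (metis exhaust_2)
    then have z: "cutoff n x = 0" by (auto simp: cutoff_def)
    have "((\<lambda>y. cutoff n y * g (fracv y)) \<longlongrightarrow> 0) (at x)"
    proof (rule Lim_null_comparison)
      show "\<forall>\<^sub>F y in at x. norm (cutoff n y * g (fracv y)) \<le> cutoff n y * M"
        using g(2) cutoff_bounds by (intro always_eventually) (auto simp: abs_mult intro!: mult_left_mono)
      show "((\<lambda>y. cutoff n y * M) \<longlongrightarrow> 0) (at x)"
        using c z unfolding isCont_def by (metis tendsto_mult_left_zero)
    qed
    then show ?thesis by (simp add: isCont_def z)
  qed
qed

lemma cutoff_tendsto: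
  assumes "x \<in> box 0 1" shows "(\<lambda>n. cutoff n x) \<longlonglongrightarrow> 1"
proof -
  have "sin (pi * x $ i) > 0" for i
    using assms by (intro sin_gt_zero) (auto simp: mem_box_cart)
  then have s: "\<bar>sin (pi * x $ 1) * sin (pi * x $ 2)\<bar> > 0" by (simp add: less_imp_neq[symmetric])
  obtain N :: nat where N: "1 / \<bar>sin (pi * x $ 1) * sin (pi * x $ 2)\<bar> < N" using reals_Archimedean2 by blast
  have "cutoff n x = 1" if "n \<ge> N" for n
  proof -
    have "1 < real N * \<bar>sin (pi * x $ 1) * sin (pi * x $ 2)\<bar>" using N s by (simp add: divide_less_eq)
    also have "\<dots> \<le> real n * \<bar>sin (pi * x $ 1) * sin (pi * x $ 2)\<bar>"
      using that by (intro mult_right_mono) auto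
    finally show ?thesis by (simp add: cutoff_def)
  qed
  then have "\<forall>\<^sub>F n in sequentially. cutoff n x = 1" by (auto simp: eventually_sequentially)
  then show ?thesis by (rule tendsto_eventually)
qed

lemma AE_torus_box: "AE x in torus. x \<in> box 0 1"
proof -
  have "negligible (cbox 0 1 - box 0 (1::real^2))" by (rule negligible_frontier_interval)
  then have "cbox 0 1 - box 0 (1::real^2) \<in> null_sets lebesgue" by (simp add: negligible_iff_null_sets)
  then have "AE x in lebesgue. x \<notin> cbox 0 1 - box 0 (1::real^2)" by (rule AE_not_in)
  then have "AE x in lebesgue. x \<in> cbox 0 1 \<longrightarrow> x \<in> box 0 (1::real^2)" by (rule eventually_mono) auto
  then show ?thesis unfolding torus_def by (subst AE_restrict_space_iff) auto
qed

lemma fracv_box: "x \<in> box 0 1 \<Longrightarrow> fracv x = x"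
  by (auto simp: fracv_def vec_eq_iff mem_box_cart frac_eq less_imp_le)

text \<open>Measurability already gives pointwise limits of continuous functions. Truncation of f
  makes dominated convergence available, and the cutoff turns the approximants into continuous
  periodic functions without changing their limit inside the cell.\<close>

lemma L1_continuous_approx:
  assumes f: "integrable torus f" and e: "e > 0"
  obtains g where "continuous_on UNIV g" "periodic g" "(LINT x|torus. \<bar>f x - g x\<bar>) < (e::real)"
proof -
  have [measurable]: "f \<in> borel_measurable torus" using f by auto
  have [measurable]: "(\<lambda>x. clamp M (f x)) \<in> borel_measurable torus" for M unfolding clamp_def by measurable
  have "(\<lambda>n. LINT x|torus. \<bar>f x - clamp (real n) (f x)\<bar>) \<longlonglongrightarrow> (LINT x|torus. 0)"
  proof (rule integral_dominated_convergence[where w="\<lambda>x. 2 * \<bar>f x\<bar>"])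
    show "AE x in torus. (\<lambda>n. \<bar>f x - clamp (real n) (f x)\<bar>) \<longlonglongrightarrow> 0"
    proof (rule AE_I2)
      fix x
      obtain N :: nat where N: "\<bar>f x\<bar> < N" using reals_Archimedean2 by blast
      then have "\<forall>n\<ge>N. \<bar>f x - clamp (real n) (f x)\<bar> = 0" by (auto simp: clamp_def)
      then show "(\<lambda>n. \<bar>f x - clamp (real n) (f x)\<bar>) \<longlonglongrightarrow> 0"
        by (intro tendsto_eventually) (auto simp: eventually_sequentially)
    qed
    show "AE x in torus. norm \<bar>f x - clamp (real n) (f x)\<bar> \<le> 2 * \<bar>f x\<bar>" for n
    proof (rule AE_I2)
      show "norm \<bar>f x - clamp (real n) (f x)\<bar> \<le> 2 * \<bar>f x\<bar>" for x
        using clamp_le[of "real n" "f x"] by simp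
    qed
  qed (use f in auto)
  then have "\<forall>\<^sub>F n in sequentially. (LINT x|torus. \<bar>f x - clamp (real n) (f x)\<bar>) < e/2"
    using e by (intro order_tendstoD) auto
  then obtain M :: nat where M: "(LINT x|torus. \<bar>f x - clamp (real M) (f x)\<bar>) < e/2"
    by (auto simp: eventually_sequentially)
  \<comment> \<open>Extended by zero, since \<open>measurable_on UNIV\<close> refers to the whole
    plane while f is known to be measurable on the cell.\<close>
  define f' where "f' x = (if x \<in> cbox 0 1 then f x else 0)" for x :: "real^2"
  have "f' \<in> borel_measurable lebesgue"
    unfolding f'_def using borel_measurable_if[of "cbox 0 1" f] \<open>f \<in> borel_measurable torus\<close>
    by (simp add: torus_def)
  then have "f' measurable_on UNIV" by (rule lebesgue_measurable_imp_measurable_on_real) simp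
  then obtain N g where N: "negligible N" and g: "\<And>n. continuous_on UNIV (g n)"
      and lim: "\<And>x. x \<notin> N \<Longrightarrow> (\<lambda>n. g n x) \<longlonglongrightarrow> f' x"
    unfolding measurable_on_def by auto
  define h where "h n x = cutoff n x * clamp (real M) (g n (fracv x))" for n x
  have hc: "continuous_on UNIV (h n)" for n
    unfolding h_def
  proof (rule continuous_cutoff_fracv[where M="real M"])
    show "continuous_on UNIV (\<lambda>x. clamp (real M) (g n x))"
      unfolding clamp_def by (intro continuous_intros g)
  qed (simp add: clamp_bound)
  have hp: "periodic (h n)" for n
  proof -
    have "fracv (x + axis i 1) = fracv x" for x i
      by (auto simp: fracv_def vec_eq_iff axis_def frac_1_eq)
    then show ?thesis using cutoff_periodic[of n] by (simp add: periodic_def h_def)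
  qed
  have hb: "\<bar>h n x\<bar> \<le> M" for n x
    unfolding h_def abs_mult using cutoff_bounds[of n x] clamp_bound[of "real M" "g n (fracv x)"]
    by (metis abs_ge_zero abs_of_nonneg mult_left_le_one_le of_nat_0_le_iff order_trans)
  have [measurable]: "h n \<in> borel_measurable torus" for n by (rule continuous_torus_measurable[OF hc])
  have "AE x in lebesgue. x \<notin> N" using N by (intro AE_not_in) (simp add: negligible_iff_null_sets)
  then have AEN: "AE x in torus. x \<notin> N" unfolding torus_def by (subst AE_restrict_space_iff) auto
  have "(\<lambda>n. LINT x|torus. \<bar>clamp (real M) (f x) - h n x\<bar>) \<longlonglongrightarrow> (LINT x|torus. 0)"
  proof (rule integral_dominated_convergence[where w="\<lambda>x. 2 * real M"])
    show "AE x in torus. (\<lambda>n. \<bar>clamp (real M) (f x) - h n x\<bar>) \<longlonglongrightarrow> 0"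
      using AEN AE_torus_box
    proof eventually_elim
      case (elim x)
      have "x \<in> cbox 0 1" using elim(2) box_subset_cbox by blast
      then have "(\<lambda>n. g n (fracv x)) \<longlonglongrightarrow> f x" using lim[OF elim(1)] fracv_box[OF elim(2)] by (simp add: f'_def)
      then have "(\<lambda>n. clamp (real M) (g n (fracv x))) \<longlonglongrightarrow> clamp (real M) (f x)"
        unfolding clamp_def by (intro tendsto_intros)
      then have "(\<lambda>n. h n x) \<longlonglongrightarrow> 1 * clamp (real M) (f x)"
        unfolding h_def by (intro tendsto_mult cutoff_tendsto elim(2))
      then have "(\<lambda>n. \<bar>clamp (real M) (f x) - h n x\<bar>) \<longlonglongrightarrow> \<bar>clamp (real M) (f x) - 1 * clamp (real M) (f x)\<bar>"
        by (intro tendsto_intros)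
      then show ?case by simp
    qed
    show "AE x in torus. norm \<bar>clamp (real M) (f x) - h n x\<bar> \<le> 2 * real M" for n
    proof (rule AE_I2)
      show "norm \<bar>clamp (real M) (f x) - h n x\<bar> \<le> 2 * real M" for x
        using clamp_bound[of "real M" "f x"] hb[of n x] by simp
    qed
  qed auto
  then have "\<forall>\<^sub>F n in sequentially. (LINT x|torus. \<bar>clamp (real M) (f x) - h n x\<bar>) < e/2"
    using e by (intro order_tendstoD) auto
  then obtain n where n: "(LINT x|torus. \<bar>clamp (real M) (f x) - h n x\<bar>) < e/2"
    by (auto simp: eventually_sequentially)
  have ic: "integrable torus (\<lambda>x. clamp (real M) (f x))"
    by (rule integrable_torus_bounded[where S="real M"]) (auto simp: clamp_bound)
  have ih: "integrable torus (h n)" by (rule integrable_torus_continuous[OF hc])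
  have "(LINT x|torus. \<bar>f x - h n x\<bar>) \<le> (LINT x|torus. \<bar>f x - clamp (real M) (f x)\<bar> + \<bar>clamp (real M) (f x) - h n x\<bar>)"
    using f ic ih by (intro integral_mono) auto
  also have "\<dots> = (LINT x|torus. \<bar>f x - clamp (real M) (f x)\<bar>) + (LINT x|torus. \<bar>clamp (real M) (f x) - h n x\<bar>)"
    using f ic ih by simp
  also have "\<dots> < e" using M n by simp
  finally show ?thesis using that[OF hc hp] by blast
qed

lemma conv_kern_tendsto_L1:
  assumes f: "integrable torus f"
  shows "(\<lambda>n. LINT x|torus. \<bar>conv f (kern n) x - f x\<bar>) \<longlonglongrightarrow> 0"
proof (rule LIMSEQ_I)
  fix r :: real assume r: "r > 0"
  obtain g where g: "continuous_on UNIV g" "periodic g" "(LINT x|torus. \<bar>f x - g x\<bar>) < r/4"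
    using L1_continuous_approx[OF f, of "r/4"] r by auto
  obtain N where N: "\<And>n x. n \<ge> N \<Longrightarrow> \<bar>conv g (kern n) x - g x\<bar> \<le> r/4"
    using conv_kern_uniform[OF g(1,2), of "r/4"] r by (auto simp: eventually_sequentially)
  have ig: "integrable torus g" by (rule integrable_torus_continuous[OF g(1)])
  have ifg: "integrable torus (\<lambda>x. f x - g x)" using f ig by simp
  have "norm ((LINT x|torus. \<bar>conv f (kern n) x - f x\<bar>) - 0) < r" if n: "n \<ge> N" for n
  proof -
    have ic: "integrable torus (conv h (kern n))" if "integrable torus h" for h
      by (rule integrable_torus_continuous[OF test_continuous[OF conv_test[OF that kern_test]]])
    have "(LINT x|torus. \<bar>conv f (kern n) x - f x\<bar>)
      \<le> (LINT x|torus. \<bar>conv (\<lambda>x. f x - g x) (kern n) x\<bar> + r/4 + \<bar>f x - g x\<bar>)"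
    proof (rule integral_mono)
      show "\<bar>conv f (kern n) x - f x\<bar> \<le> \<bar>conv (\<lambda>x. f x - g x) (kern n) x\<bar> + r/4 + \<bar>f x - g x\<bar>" for x
        using N[OF n, of x] conv_diff[OF f ig kern_test, of n x] by linarith
    qed (use f ig ic[OF f] ic[OF ifg] in auto)
    also have "\<dots> = (LINT x|torus. \<bar>conv (\<lambda>x. f x - g x) (kern n) x\<bar>) + r/4 + (LINT x|torus. \<bar>f x - g x\<bar>)"
      using f ig ic[OF f] ic[OF ifg] by simp
    also have "\<dots> < r" using conv_L1[OF ifg, of n] g(3) r by simp
    finally show ?thesis by (simp add: abs_of_nonneg)
  qed
  then show "\<exists>N. \<forall>n\<ge>N. norm ((LINT x|torus. \<bar>conv f (kern n) x - f x\<bar>) - 0) < r" by blast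
qed

lemma AE_zero_of_conv:
  assumes f: "integrable torus f" and z: "\<And>n x. conv f (kern n) x = 0"
  shows "AE x in torus. f x = 0"
proof -
  have "(\<lambda>n. LINT x|torus. \<bar>f x\<bar>) \<longlonglongrightarrow> 0"
    using conv_kern_tendsto_L1[OF f] by (simp add: z)
  then have "(LINT x|torus. \<bar>f x\<bar>) = 0" by (simp add: LIMSEQ_const_iff)
  then show ?thesis
    using integral_nonneg_eq_0_iff_AE[of torus "\<lambda>x. \<bar>f x\<bar>"] f by auto
qed

lemma AE_zero_of_test:
  assumes f: "integrable torus f" and z: "\<And>\<phi>. \<phi> \<in> test_functions \<Longrightarrow> (LINT x|torus. f x * \<phi> x) = 0"
  shows "AE x in torus. f x = 0"
  using z[OF test_reflect[OF kern_test]] by (intro AE_zero_of_conv[OF f]) (simp add: conv_def)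

lemma weak_partial_unique:
  assumes "has_weak_partial i f g" "has_weak_partial i f h"
  shows "AE x in torus. g x = h x"
proof -
  have i: "integrable torus g" "integrable torus h"
    using assms Lp_integrable[where p=1] by (auto simp: has_weak_partial_def)
  have "AE x in torus. g x - h x = 0"
  proof (rule AE_zero_of_test)
    fix \<phi> assume p: "\<phi> \<in> test_functions"
    have "(LINT x|torus. g x * \<phi> x) = (LINT x|torus. h x * \<phi> x)"
      using assms p unfolding has_weak_partial_def by (metis add.inverse_inverse)
    then show "(LINT x|torus. (g x - h x) * \<phi> x) = 0"
      using integrable_mult_test[OF i(1) test_continuous[OF p] test_periodic[OF p]]
            integrable_mult_test[OF i(2) test_continuous[OF p] test_periodic[OF p]]
      by (simp add: left_diff_distrib)
  qed (use i in simp)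
  then show ?thesis by simp
qed

text \<open>Elementary interpolation of L^2 between L^1 and L^4: values with e a^2 \<ge> 1 are
  charged to the fourth power, the others to |a|. It upgrades L^1 convergence with bounded L^4 norms
  to L^2 convergence.\<close>

lemma square_le_L1_L4:
  fixes a e :: real
  assumes "e > 0" shows "a^2 \<le> e * a^4 + (1 / e + 1) * \<bar>a\<bar>"
proof (cases "1 \<le> e * a^2")
  case True
  then have "a^2 * 1 \<le> a^2 * (e * a^2)" by (intro mult_left_mono) auto
  then have "a^2 \<le> e * a^4" by (simp add: power2_eq_square power4_eq_xxxx algebra_simps)
  then show ?thesis using assms by (simp add: add_increasing2)
next
  case False
  then have "a^2 < 1 / e" using assms by (simp add: field_simps)
  also have "\<dots> \<le> (1 / e)^2 + 1 + 2 * (1 / e)"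
    using zero_le_power2[of "1 / e"] assms by (smt (verit) divide_pos_pos)
  also have "\<dots> = (1 / e + 1)^2" by (simp add: power2_sum)
  finally have "\<bar>a\<bar>^2 < (1 / e + 1)^2" by simp
  then have "\<bar>a\<bar> < 1 / e + 1" by (rule power_less_imp_less_base) (use assms in auto)
  then have "\<bar>a\<bar> * \<bar>a\<bar> \<le> (1 / e + 1) * \<bar>a\<bar>" by (intro mult_right_mono) auto
  moreover have "e * a^4 \<ge> 0" using assms by simp
  ultimately show ?thesis by (simp add: power2_eq_square)
qed

lemma power4_add_le: "(a + b)^4 \<le> 8 * (a^4 + b^4)" for a b :: real
  using power4_jensen2[of "1/2" "1/2" "2*a" "2*b"] by (simp add: power_mult_distrib)

lemma integrable_square_of_power4:
  fixes f :: "real^2 \<Rightarrow> real"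
  assumes "f \<in> borel_measurable torus" "integrable torus (\<lambda>x. f x ^ 4)"
  shows "integrable torus (\<lambda>x. f x ^ 2)"
proof (rule Bochner_Integration.integrable_bound)
  show "integrable torus (\<lambda>x. 1 + f x ^ 4)" using assms(2) by simp
  have "f x ^ 2 \<le> 1 + f x ^ 4" for x
  proof -
    have "0 \<le> (f x ^ 2 - 1)^2 + f x ^ 2 * 1" by simp
    also have "\<dots> = f x ^ 4 + 1 - f x ^ 2" by algebra
    finally show ?thesis by simp
  qed
  then show "AE x in torus. norm (f x ^ 2) \<le> norm (1 + f x ^ 4)"
    by (intro AE_I2) simp
qed (use assms in measurable)

lemma conv_kern_tendsto_L2:
  assumes f: "integrable torus f" "integrable torus (\<lambda>x. f x ^ 4)"
  shows "(\<lambda>n. LINT x|torus. (conv f (kern n) x - f x)^2) \<longlonglongrightarrow> 0"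
proof (rule LIMSEQ_I)
  fix r :: real assume r: "r > 0"
  define I where "I = (LINT x|torus. f x ^ 4)"
  have I: "I \<ge> 0" by (simp add: I_def)
  \<comment> \<open>Chosen so that e times the uniform bound 16 I on the fourth-power integrals
    stays below r/2; the added 1 covers I = 0.\<close>
  define e where "e = r / (2 * (16 * I + 1))"
  have e: "e > 0" "e * (16 * I) < r/2" using r I by (auto simp: e_def field_simps)
  have "(\<lambda>n. (1 / e + 1) * (LINT x|torus. \<bar>conv f (kern n) x - f x\<bar>)) \<longlonglongrightarrow> (1 / e + 1) * 0"
    by (intro tendsto_intros conv_kern_tendsto_L1 f)
  then have "\<forall>\<^sub>F n in sequentially. (1 / e + 1) * (LINT x|torus. \<bar>conv f (kern n) x - f x\<bar>) < r/2"
    using r by (intro order_tendstoD) auto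
  then obtain N where N: "\<And>n. n \<ge> N \<Longrightarrow> (1 / e + 1) * (LINT x|torus. \<bar>conv f (kern n) x - f x\<bar>) < r/2"
    by (auto simp: eventually_sequentially)
  have "norm ((LINT x|torus. (conv f (kern n) x - f x)^2) - 0) < r" if n: "n \<ge> N" for n
  proof -
    let ?c = "conv f (kern n)"
    have c: "continuous_on UNIV ?c" by (rule test_continuous[OF conv_test[OF f(1) kern_test]])
    have [measurable]: "f \<in> borel_measurable torus" "?c \<in> borel_measurable torus"
      using f c continuous_torus_measurable by auto
    have ci: "integrable torus ?c" "integrable torus (\<lambda>x. ?c x ^ 4)"
      by (intro integrable_torus_continuous continuous_intros c)+
    have i4: "integrable torus (\<lambda>x. (?c x - f x)^4)"
    proof (rule Bochner_Integration.integrable_bound)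
      show "integrable torus (\<lambda>x. 8 * (?c x ^ 4 + f x ^ 4))" using ci f by simp
      show "AE x in torus. norm ((?c x - f x)^4) \<le> norm (8 * (?c x ^ 4 + f x ^ 4))"
      proof (rule AE_I2)
        show "norm ((?c x - f x)^4) \<le> norm (8 * (?c x ^ 4 + f x ^ 4))" for x
          using power4_add_le[of "?c x" "- f x"] by simp
      qed
    qed simp
    have "(LINT x|torus. (?c x - f x)^4) \<le> (LINT x|torus. 8 * (?c x ^ 4 + f x ^ 4))"
    proof (rule integral_mono[OF i4])
      show "(?c x - f x)^4 \<le> 8 * (?c x ^ 4 + f x ^ 4)" for x
        using power4_add_le[of "?c x" "- f x"] by simp
    qed (use ci f in simp)
    also have "\<dots> = 8 * (LINT x|torus. ?c x ^ 4) + 8 * I" using ci f by (simp add: I_def)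
    also have "\<dots> \<le> 16 * I" using conv_L4[OF f, of n] by (simp add: I_def)
    finally have b4: "(LINT x|torus. (?c x - f x)^4) \<le> 16 * I" .
    have "(LINT x|torus. (?c x - f x)^2) \<le> (LINT x|torus. e * (?c x - f x)^4 + (1 / e + 1) * \<bar>?c x - f x\<bar>)"
      by (rule integral_mono)
         (use i4 ci f square_le_L1_L4[OF e(1)] in \<open>auto intro!: integrable_square_of_power4\<close>)
    also have "\<dots> = e * (LINT x|torus. (?c x - f x)^4) + (1 / e + 1) * (LINT x|torus. \<bar>?c x - f x\<bar>)"
      using i4 ci f by simp
    also have "\<dots> \<le> e * (16 * I) + (1 / e + 1) * (LINT x|torus. \<bar>?c x - f x\<bar>)"
      using b4 e by (intro add_right_mono mult_left_mono) auto
    also have "\<dots> < r" using e(2) N[OF n] by linarith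
    finally show ?thesis by simp
  qed
  then show "\<exists>N. \<forall>n\<ge>N. norm ((LINT x|torus. (conv f (kern n) x - f x)^2) - 0) < r" by blast
qed

section \<open>The mean over the unit disc\<close>

text \<open>The real function is lifted to \<open>real^1\<close>, where the change of variables for
  vector values applies, and the single component is read off.\<close>

lemma change_of_variables_real:
  fixes f :: "real^2 \<Rightarrow> real" and g :: "real^2 \<Rightarrow> real^2"
  assumes S: "S \<in> sets lebesgue"
    and der: "\<And>x. x \<in> S \<Longrightarrow> (g has_derivative g' x) (at x within S)"
    and inj: "inj_on g S" and f: "f absolutely_integrable_on (g ` S)"
  shows "(\<lambda>x. \<bar>det (matrix (g' x))\<bar> * f (g x)) absolutely_integrable_on S"
    and "integral S (\<lambda>x. \<bar>det (matrix (g' x))\<bar> * f (g x)) = integral (g ` S) f"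
proof -
  let ?F = "\<lambda>x. vec (f x) :: real^1"
  have bl: "bounded_linear (vec :: real \<Rightarrow> real^1)"
    unfolding linear_conv_bounded_linear[symmetric] by (intro linearI) (auto simp: vec_eq_iff)
  have F: "?F absolutely_integrable_on (g ` S)"
    using absolutely_integrable_linear[OF f bl] by (simp add: o_def)
  have *: "(\<lambda>x. \<bar>det (matrix (g' x))\<bar> *\<^sub>R ?F (g x)) absolutely_integrable_on S \<and>
    integral S (\<lambda>x. \<bar>det (matrix (g' x))\<bar> *\<^sub>R ?F (g x)) = integral (g ` S) ?F"
    by (subst has_absolute_integral_change_of_variables[OF S der inj]) (use F in auto)
  have bl1: "bounded_linear (\<lambda>v::real^1. v $ 1)" by (rule bounded_linear_vec_nth)
  show "(\<lambda>x. \<bar>det (matrix (g' x))\<bar> * f (g x)) absolutely_integrable_on S"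
    using absolutely_integrable_linear[OF conjunct1[OF *] bl1] by (simp add: o_def)
  have "integral S (\<lambda>x. \<bar>det (matrix (g' x))\<bar> * f (g x)) = integral S ((\<lambda>v::real^1. v $ 1) \<circ> (\<lambda>x. \<bar>det (matrix (g' x))\<bar> *\<^sub>R ?F (g x)))"
    by (simp add: o_def)
  also have "\<dots> = integral S (\<lambda>x. \<bar>det (matrix (g' x))\<bar> *\<^sub>R ?F (g x)) $ 1"
    using * by (intro integral_linear bl1) (auto simp: absolutely_integrable_on_def)
  also have "\<dots> = integral (g ` S) ?F $ 1" using * by simp
  also have "\<dots> = integral (g ` S) ((\<lambda>v::real^1. v $ 1) \<circ> ?F)"
    using F by (intro integral_linear[symmetric] bl1) (auto simp: absolutely_integrable_on_def)
  also have "\<dots> = integral (g ` S) f" by (simp add: o_def)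
  finally show "integral S (\<lambda>x. \<bar>det (matrix (g' x))\<bar> * f (g x)) = integral (g ` S) f" .
qed

lemma borel_set_integrable_continuous:
  fixes f :: "'a::euclidean_space \<Rightarrow> real"
  assumes "compact S" "continuous_on UNIV f"
  shows "integrable lborel (\<lambda>x. indicator S x * f x)"
  using borel_integrable_compact[of S f] assms continuous_on_subset by fastforce

lemma lborel_integral_indicator:
  fixes f :: "'a::euclidean_space \<Rightarrow> real"
  assumes "compact S" "continuous_on UNIV f"
  shows "(LINT x|lborel. indicator S x * f x) = integral S f"
proof -
  have "set_integrable lborel S f"
    using borel_set_integrable_continuous[OF assms] by (simp add: set_integrable_def)
  from set_borel_integral_eq_integral(2)[OF this] show ?thesis by (simp add: set_lebesgue_integral_def)
qed

lemma torus_lborel: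
  fixes f :: "real^2 \<Rightarrow> real"
  assumes [measurable]: "f \<in> borel_measurable borel"
  shows "(LINT x|torus. f x) = (LINT x|lborel. indicator (cbox 0 1) x * f x)"
  unfolding torus_def by (subst integral_restrict_space) (auto simp: integral_completion)

lemma lborel_integral_shift:
  fixes f :: "'a::euclidean_space \<Rightarrow> real"
  assumes [measurable]: "f \<in> borel_measurable borel"
  shows "(LINT x|lborel. f (x + k)) = (LINT x|lborel. f x)"
proof -
  have "(LINT x|lborel. f x) = (LINT x|distr lborel borel ((+) k). f x)" by (simp add: lborel_distr_plus)
  also have "\<dots> = (LINT x|lborel. f (k + x))" by (intro integral_distr) auto
  finally show ?thesis by (simp add: add.commute)
qed

lemma lborel_cell_integral:
  fixes f :: "real^2 \<Rightarrow> real"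
  assumes f: "continuous_on UNIV f" "periodic f"
  shows "(LINT z|lborel. indicator (cbox 0 1) (z - c) * f (x + z)) = (LINT x|torus. f x)"
proof -
  have [measurable]: "f \<in> borel_measurable borel" using f(1) by (rule borel_measurable_continuous_onI)
  have "(LINT z|lborel. indicator (cbox 0 1) (z - c) * f (x + z))
      = (LINT z|lborel. indicator (cbox 0 1) z * f (z + (x + c)))"
    using lborel_integral_shift[of "\<lambda>z. indicator (cbox 0 1) (z - c) * f (x + z)" c]
    by (simp add: algebra_simps)
  also have "\<dots> = (LINT z|torus. f (z + (x + c)))" by (subst torus_lborel) auto
  also have "\<dots> = (LINT x|torus. f x)" by (rule integral_torus_shift[OF f])
  finally show ?thesis .
qed

definition disc :: "(real^2) set" where "disc = cball 0 1"

definition disc_area :: real where "disc_area = measure lborel disc"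

lemma disc_measure [simp]: "measure lborel disc = disc_area" by (simp add: disc_area_def)

text \<open>The closed unit square centred at the origin. It fits inside the unit disc, and a
  periodic function of mean zero has integral zero over every translate of it.\<close>

definition mid_cell :: "(real^2) set" where "mid_cell = {z. z - (\<chi> i. -(1/2)) \<in> cbox 0 1}"

lemma disc_sets [measurable]: "disc \<in> sets borel" by (simp add: disc_def)

lemma compact_disc: "compact disc" by (simp add: disc_def)

lemma mid_cell_sets [measurable]: "mid_cell \<in> sets borel"
  unfolding mid_cell_def by measurable

lemma mid_cell_disc: "mid_cell \<subseteq> disc"
proof
  fix z assume "z \<in> mid_cell"
  then have "0 \<le> z $ i + 1/2 \<and> z $ i + 1/2 \<le> 1" for i by (auto simp: mid_cell_def mem_box_cart)
  then have "\<bar>z $ i\<bar> \<le> 1/2" for i by (smt (verit) field_sum_of_halves)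
  then have "(\<Sum>i\<in>UNIV. \<bar>z $ i\<bar>) \<le> (\<Sum>i\<in>(UNIV::2 set). 1/2)" by (intro sum_mono)
  then show "z \<in> disc" using norm_le_l1_cart[of z] by (simp add: disc_def)
qed

lemma disc_integrable: "integrable lborel (indicator disc :: real^2 \<Rightarrow> real)"
  using borel_set_integrable_continuous[OF compact_disc, of "\<lambda>_. 1"] by simp

lemma disc_integral: "(LINT z|lborel. indicator disc z) = disc_area"
  by simp

lemma mid_cell_integral: "(LINT z|lborel. indicator mid_cell z) = (1::real)"
proof -
  have "(LINT z|lborel. indicator (cbox 0 1) (z - (\<chi> i. -(1/2)) :: real^2) * (1::real)) = (LINT x|torus. 1)"
    by (rule lborel_cell_integral[where f="\<lambda>_. 1" and x=0]) (auto simp: periodic_def)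
  moreover have "indicator (cbox 0 1) (z - (\<chi> i. -(1/2))) = (indicator mid_cell z :: real)" for z :: "real^2"
    by (auto simp: mid_cell_def indicator_def)
  ultimately show ?thesis by (simp only: integral_torus_const mult_1_right)
qed

lemma mid_cell_measure [simp]: "measure lborel mid_cell = 1"
  using mid_cell_integral by simp

lemma mid_cell_integrable: "integrable lborel (indicator mid_cell :: real^2 \<Rightarrow> real)"
  by (rule Bochner_Integration.integrable_bound[OF disc_integrable])
     (use mid_cell_disc in \<open>auto simp: indicator_def\<close>)

lemma disc_area_ge: "disc_area \<ge> 1"
proof -
  have "(LINT z|lborel. indicator mid_cell z) \<le> (LINT z|lborel. indicator disc z :: real)"
    using mid_cell_disc by (intro integral_mono mid_cell_integrable disc_integrable) (auto simp: indicator_def)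
  then show ?thesis by (simp only: mid_cell_integral disc_integral)
qed

interpretation disc_mean: averaging lborel "\<lambda>z::real^2. z" "\<lambda>z. indicator disc z / disc_area"
  by unfold_locales (use disc_integrable in auto)

text \<open>For functions of mean zero the square \<open>mid_cell\<close> contributes nothing, so it
  may be cut out of the disc. The remaining weight has mass 1 - 1 / \<open>disc_area\<close> < 1;
  this is where the contraction comes from.\<close>

interpretation reduced_mean: averaging lborel "\<lambda>z::real^2. z" "\<lambda>z. (indicator disc z - indicator mid_cell z) / disc_area"
  by unfold_locales (use disc_integrable mid_cell_integrable in auto)

lemma reduced_mean_mass: "reduced_mean.mass = 1 - 1 / disc_area"
proof -
  have "reduced_mean.mass = (LINT z|lborel. (indicator disc z - indicator mid_cell z) / disc_area)"
    unfolding reduced_mean.mass_def using mid_cell_disc disc_area_ge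
    by (intro Bochner_Integration.integral_cong) (auto simp: indicator_def)
  also have "\<dots> = (disc_area - 1) / disc_area"
    using disc_integrable mid_cell_integrable by (simp add: disc_integral mid_cell_integral)
  also have "\<dots> = 1 - 1 / disc_area" using disc_area_ge by (simp add: diff_divide_distrib)
  finally show ?thesis .
qed

text \<open>Any number strictly between \<open>1 - 1 / disc_area\<close> and 1 would do; it must not vanish.\<close>

definition contr :: real where "contr = 1 - 1 / (2 * disc_area)"

lemma contr: "0 < contr" "contr < 1" "reduced_mean.mass \<le> contr"
  using disc_area_ge by (auto simp: contr_def reduced_mean_mass divide_simps)

lemma disc_mean_eq_reduced_mean:
  assumes f: "continuous_on UNIV f" "periodic f" and z: "(LINT x|torus. f x) = 0"
  shows "disc_mean.av f x = reduced_mean.av f x"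
proof -
  have "(LINT z|lborel. indicator mid_cell z * f (x + z)) = (LINT z|lborel. indicator (cbox 0 1) (z - (\<chi> i. -(1/2))) * f (x + z))"
    by (rule Bochner_Integration.integral_cong) (auto simp: indicator_def mid_cell_def)
  then have 0: "(LINT z|lborel. indicator mid_cell z * f (x + z)) = 0"
    using lborel_cell_integral[OF f] z by simp
  have i: "integrable lborel (\<lambda>z. indicator mid_cell z * f (x + z))"
  proof -
    interpret m: averaging lborel "\<lambda>z::real^2. z" "indicator mid_cell"
      by unfold_locales (use mid_cell_integrable in auto)
    show ?thesis by (rule m.av_integrable[OF f])
  qed
  have "reduced_mean.av f x = (LINT z|lborel. indicator disc z / disc_area * f (x + z) - indicator mid_cell z * f (x + z) / disc_area)"
    unfolding reduced_mean.av_def by (rule Bochner_Integration.integral_cong) (auto simp: diff_divide_distrib left_diff_distrib)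
  also have "\<dots> = disc_mean.av f x - 0 / disc_area"
    using disc_mean.av_integrable[OF f, of x] i 0 by (simp add: disc_mean.av_def)
  finally show ?thesis by simp
qed

lemma disc_mean_integral: "continuous_on UNIV f \<Longrightarrow> periodic f \<Longrightarrow> (LINT x|torus. disc_mean.av f x) = (LINT x|torus. f x)"
  using disc_area_ge by (simp add: disc_mean.av_integral disc_integral)

section \<open>Averages against the singular kernel: divergence and curl\<close>

definition flux_weight :: "2 \<Rightarrow> (real^2) \<times> real \<Rightarrow> real" where
  "flux_weight j p = indicator disc (fst p) * indicator {0..1} (snd p) * (2 * snd p * fst p $ j) / disc_area"

lemma flux_weight_bound: "\<bar>flux_weight j p\<bar> \<le> 2 * (indicator disc (fst p) * indicator {0..1} (snd p)) / disc_area"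
proof -
  have "\<bar>snd p * fst p $ j\<bar> \<le> 1" if "fst p \<in> disc" "snd p \<in> {0..1}"
  proof -
    have "\<bar>fst p $ j\<bar> \<le> 1" using component_le_norm_cart[of "fst p" j] that by (simp add: disc_def)
    then show ?thesis using that unfolding abs_mult by (intro mult_le_one) auto
  qed
  then show ?thesis using disc_area_ge
    by (auto simp: flux_weight_def indicator_def abs_mult mult.assoc intro!: divide_right_mono)
qed

lemma disc_unit_integrable:
  "integrable (lborel \<Otimes>\<^sub>M lborel) (\<lambda>p. indicator disc (fst p) * indicator {0..1::real} (snd p) :: real)"
proof -
  have "integrable lborel (\<lambda>p::(real^2)\<times>real. indicator (disc \<times> {0..1}) p * (1::real))"
    by (rule borel_set_integrable_continuous) (auto intro: compact_Times compact_disc)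
  then show ?thesis by (simp add: lborel_prod indicator_times mult.commute)
qed

text \<open>For p = (z, t) this averages f(x + t^2 z) with weight 2 t z_j. Putting s = t^2, y = s z
  and integrating y_j / s^3 over s from |y| to 1 gives (1/|y|^2 - 1) y_j / 2, which after division
  by the area of the disc is the kernel k. The additional variable keeps the weight bounded.\<close>

interpretation flux: averaging "lborel \<Otimes>\<^sub>M lborel" "\<lambda>p::(real^2)\<times>real. (snd p)\<^sup>2 *\<^sub>R fst p" "flux_weight j" for j
proof -
  have "integrable (lborel \<Otimes>\<^sub>M lborel) (flux_weight j)"
  proof (rule Bochner_Integration.integrable_bound)
    show "integrable (lborel \<Otimes>\<^sub>M lborel) (\<lambda>p. 2 * (indicator disc (fst p) * indicator {0..1::real} (snd p)) / disc_area :: real)"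
      using disc_unit_integrable by simp
    have [measurable]: "(\<lambda>p::(real^2)\<times>real. fst p $ j) \<in> borel_measurable (lborel \<Otimes>\<^sub>M lborel)"
      unfolding lborel_prod by (simp, intro borel_measurable_continuous_onI continuous_intros)
    show "flux_weight j \<in> borel_measurable (lborel \<Otimes>\<^sub>M lborel)"
      unfolding flux_weight_def[abs_def] by measurable
    show "AE p in lborel \<Otimes>\<^sub>M lborel. norm (flux_weight j p) \<le> norm (2 * (indicator disc (fst p) * indicator {0..1} (snd p)) / disc_area)"
      using flux_weight_bound[of j] disc_area_ge by (intro AE_I2) (auto intro: order_trans)
  qed
  then show "averaging (lborel \<Otimes>\<^sub>M lborel) (\<lambda>p::(real^2)\<times>real. (snd p)\<^sup>2 *\<^sub>R fst p) (flux_weight j)"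
    by unfold_locales measurable
qed

lemma FTC_indicator:
  fixes F f :: "real \<Rightarrow> real"
  assumes "a \<le> b" "\<And>t. (F has_real_derivative f t) (at t)" "continuous_on UNIV f"
  shows "(LINT t|lborel. indicator {a..b} t * f t) = F b - F a"
proof -
  have "(LINT t|lborel. indicator {a..b} t * f t) = integral {a..b} f"
    by (rule lborel_integral_indicator) (use assms in auto)
  also have "\<dots> = F b - F a"
    using assms(1,2) by (intro integral_unique fundamental_theorem_of_calculus)
      (auto simp: has_real_derivative_iff_has_vector_derivative[symmetric] intro: has_field_derivative_at_within)
  finally show ?thesis .
qed

text \<open>Summed over j, the integrand is 2 t times the inner product of z and G(x + t^2 z), which
  is the derivative of t |-> f(x + t^2 z). Integration over t gives f(x + z) - f(x), and averaging
  over the disc gives A f - f.\<close>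

lemma flux_divergence:
  assumes f: "C11 f G"
  shows "flux.av 1 (\<lambda>y. G y $ 1) x + flux.av 2 (\<lambda>y. G y $ 2) x = disc_mean.av f x - f x"
proof -
  have cf: "continuous_on UNIV f" "periodic f" and cG: "continuous_on UNIV G" and
    G: "continuous_on UNIV (\<lambda>y. G y $ i)" "periodic (\<lambda>y. G y $ i)" for i
    using f by (auto simp: C11_def periodic_def intro!: continuous_intros)
  define h where "h z t = indicator disc z / disc_area * (indicator {0..1} t * (2 * t * (G (x + t\<^sup>2 *\<^sub>R z) \<bullet> z)))"
    for z :: "real^2" and t :: real
  have i: "integrable (lborel \<Otimes>\<^sub>M lborel) (\<lambda>p. flux_weight j p * G (x + (snd p)\<^sup>2 *\<^sub>R fst p) $ j)" for j
    by (rule flux.av_integrable[OF G])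
  have eq: "flux_weight 1 p * G (x + (snd p)\<^sup>2 *\<^sub>R fst p) $ 1 + flux_weight 2 p * G (x + (snd p)\<^sup>2 *\<^sub>R fst p) $ 2
      = (case p of (z, t) \<Rightarrow> h z t)" for p
    by (cases p) (simp add: flux_weight_def h_def inner_vec_def sum_2 algebra_simps add_divide_distrib)
  have ih: "integrable (lborel \<Otimes>\<^sub>M lborel) (\<lambda>(z, t). h z t)"
    using Bochner_Integration.integrable_add[OF i[of 1] i[of 2]] by (simp add: eq)
  have "flux.av 1 (\<lambda>y. G y $ 1) x + flux.av 2 (\<lambda>y. G y $ 2) x
      = (LINT p|(lborel \<Otimes>\<^sub>M lborel). (case p of (z, t) \<Rightarrow> h z t))"
    unfolding flux.av_def by (subst Bochner_Integration.integral_add[OF i i, symmetric]) (simp only: eq)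
  also have "\<dots> = (LINT z|lborel. LINT t|lborel. h z t)"
    using lborel_pair.integral_fst'[OF ih] by simp
  also have "\<dots> = (LINT z|lborel. indicator disc z / disc_area * f (x + z) - indicator disc z / disc_area * f x)"
  proof (rule Bochner_Integration.integral_cong[OF refl])
    fix z :: "real^2"
    have "(LINT t|lborel. indicator {0..1} t * (2 * t * (G (x + t\<^sup>2 *\<^sub>R z) \<bullet> z)))
        = f (x + 1\<^sup>2 *\<^sub>R z) - f (x + 0\<^sup>2 *\<^sub>R z)"
    proof (rule FTC_indicator)
      fix t :: real
      have "((\<lambda>t. x + t\<^sup>2 *\<^sub>R z) has_derivative (\<lambda>s. (2 * t * s) *\<^sub>R z)) (at t)"
        by (auto intro!: derivative_eq_intros simp: algebra_simps)
      from has_derivative_compose[OF this C11_has_derivative[OF f]]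
      show "((\<lambda>t. f (x + t\<^sup>2 *\<^sub>R z)) has_real_derivative (2 * t * (G (x + t\<^sup>2 *\<^sub>R z) \<bullet> z))) (at t)"
        unfolding has_field_derivative_def
        by (rule has_derivative_eq_rhs) (auto intro!: ext)
    next
      show "continuous_on UNIV (\<lambda>t. 2 * t * (G (x + t\<^sup>2 *\<^sub>R z) \<bullet> z))"
        by (intro continuous_intros continuous_on_compose2[OF cG]) auto
    qed simp
    then show "(LINT t|lborel. h z t) = indicator disc z / disc_area * f (x + z) - indicator disc z / disc_area * f x"
      unfolding h_def by (subst integral_mult_right_zero) (simp add: right_diff_distrib)
  qed
  also have "\<dots> = disc_mean.av f x - f x"
    using disc_mean.av_integrable[OF cf, of x] disc_integrable disc_area_ge by (simp add: disc_mean.av_def disc_integral)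
  finally show ?thesis .
qed

definition perp :: "real^2 \<Rightarrow> real^2" where
  "perp z = (\<chi> i. if i = 1 then - z $ 2 else z $ 1)"

definition rot :: "real \<Rightarrow> real^2 \<Rightarrow> real^2" where
  "rot a z = cos a *\<^sub>R z + sin a *\<^sub>R perp z"

lemma perp_nth [simp]: "perp z $ 1 = - z $ 2" "perp z $ 2 = z $ 1"
  by (simp_all add: perp_def)

lemma rot_nth [simp]: "rot a z $ 1 = cos a * z $ 1 - sin a * z $ 2" "rot a z $ 2 = sin a * z $ 1 + cos a * z $ 2"
  by (simp_all add: rot_def)

lemma continuous_perp:
  fixes f :: "'a::t2_space \<Rightarrow> real^2"
  shows "continuous_on S f \<Longrightarrow> continuous_on S (\<lambda>x. perp (f x))"
proof -
  assume f: "continuous_on S f"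
  have "continuous_on S (\<lambda>x. if i = 1 then - f x $ 2 else f x $ 1)" for i :: 2
    by (cases "i = 1") (auto intro!: continuous_intros f)
  then show ?thesis unfolding perp_def by (rule continuous_on_vec_lambda)
qed

lemma rot_linear: "linear (rot a)"
  by (rule linearI) (auto simp: vec_eq_iff forall_2 algebra_simps)

lemma rot_norm: "norm (rot a z) = norm z"
proof -
  have "(rot a z $ 1)\<^sup>2 + (rot a z $ 2)\<^sup>2 = ((cos a)\<^sup>2 + (sin a)\<^sup>2) * ((z $ 1)\<^sup>2 + (z $ 2)\<^sup>2)"
    by (simp only: rot_nth) algebra
  then show ?thesis by (simp add: norm_vec_def L2_set_def sum_2)
qed

lemma rot_inverse: "rot a (rot (- a) z) = z"
proof -
  have 1: "(cos a)\<^sup>2 + (sin a)\<^sup>2 = 1" by simp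
  have "rot a (rot (- a) z) $ 1 = ((cos a)\<^sup>2 + (sin a)\<^sup>2) * z $ 1"
       "rot a (rot (- a) z) $ 2 = ((cos a)\<^sup>2 + (sin a)\<^sup>2) * z $ 2"
    by (simp_all only: rot_nth cos_minus sin_minus) algebra+
  then show ?thesis unfolding 1 by (simp add: vec_eq_iff forall_2)
qed

lemma rot_disc: "rot a ` disc = disc"
proof
  show "rot a ` disc \<subseteq> disc" by (auto simp: disc_def rot_norm)
  show "disc \<subseteq> rot a ` disc"
    using rot_inverse[of a] by (force simp: disc_def rot_norm image_iff intro: bexI[of _ "rot (- a) _"])
qed

lemma rot_det: "det (matrix (rot a)) = 1"
  by (simp add: det_2 matrix_def axis_def power2_eq_square[symmetric])

lemma disc_rot_integral:
  fixes F :: "real^2 \<Rightarrow> real"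
  assumes F: "continuous_on UNIV F"
  shows "(LINT z|lborel. indicator disc z * F (rot a z)) = (LINT z|lborel. indicator disc z * F z)"
proof -
  have c: "continuous_on UNIV (rot a)" using rot_linear linear_continuous_on linear_conv_bounded_linear by blast
  have Fa: "F absolutely_integrable_on (rot a ` disc)"
    unfolding rot_disc
    using borel_set_integrable_continuous[OF compact_disc F]
    by (simp add: set_integrable_def integrable_completion)
  have "integral disc (\<lambda>x. \<bar>det (matrix (rot a))\<bar> * F (rot a x)) = integral (rot a ` disc) F"
  proof (rule change_of_variables_real(2)[OF _ _ _ Fa])
    show "(rot a has_derivative rot a) (at x within disc)" for x
      using rot_linear by (intro bounded_linear_imp_has_derivative) (simp add: linear_conv_bounded_linear)
    show "inj_on (rot a) disc"
      by (rule inj_on_inverseI[of _ "rot (- a)"]) (use rot_inverse[of "- a"] in simp)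
  qed (simp add: disc_def)
  then have "integral disc (\<lambda>x. F (rot a x)) = integral disc F" by (simp add: rot_det rot_disc)
  moreover have "continuous_on UNIV (\<lambda>x. F (rot a x))" by (rule continuous_on_compose2[OF F c]) auto
  ultimately show ?thesis using lborel_integral_indicator[OF compact_disc] F by metis
qed

text \<open>The disc integral of F does not change when F is rotated, so it equals its average over
  all angles; exchanging the integrals leaves the angular integral, which vanishes.\<close>

lemma disc_integral_zero_of_rot:
  fixes F :: "real^2 \<Rightarrow> real"
  assumes F: "continuous_on UNIV F"
    and z: "\<And>z. (LINT a|lborel. indicator {0..2*pi} a * F (rot a z)) = 0"
  shows "(LINT z|lborel. indicator disc z * F z) = 0"
proof -
  define h where "h z a = indicator disc z * (indicator {0..2*pi} a * F (rot a z))" for z a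
  have cF: "continuous_on UNIV (\<lambda>p::(real^2)\<times>real. F (rot (snd p) (fst p)))"
    unfolding rot_def by (rule continuous_on_compose2[OF F]) (auto intro!: continuous_intros continuous_perp)
  have "integrable lborel (\<lambda>p::(real^2)\<times>real. indicator (disc \<times> {0..2*pi}) p * F (rot (snd p) (fst p)))"
    by (rule borel_set_integrable_continuous[OF _ cF]) (auto intro: compact_Times compact_disc)
  moreover have "indicator (disc \<times> {0..2*pi}) p * F (rot (snd p) (fst p)) = (case p of (z, a) \<Rightarrow> h z a)" for p
    by (cases p) (auto simp: h_def indicator_def)
  ultimately have ih: "integrable (lborel \<Otimes>\<^sub>M lborel) (\<lambda>(z, a). h z a)" by (simp add: lborel_prod)
  have "0 = (LINT z|lborel. LINT a|lborel. h z a)" by (simp add: h_def z)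
  also have "\<dots> = (LINT a|lborel. LINT z|lborel. h z a)" by (rule lborel_pair.Fubini_integral[OF ih, symmetric])
  also have "\<dots> = (LINT a|lborel. indicator {0..2*pi} a * (LINT z|lborel. indicator disc z * F z))"
  proof (rule Bochner_Integration.integral_cong[OF refl])
    fix a :: real
    have "(LINT z|lborel. h z a) = (LINT z|lborel. indicator {0..2*pi} a * (indicator disc z * F (rot a z)))"
      unfolding h_def by (rule Bochner_Integration.integral_cong) auto
    then show "(LINT z|lborel. h z a) = indicator {0..2*pi} a * (LINT z|lborel. indicator disc z * F z)"
      by (simp add: disc_rot_integral[OF F])
  qed
  also have "\<dots> = 2 * pi * (LINT z|lborel. indicator disc z * F z)" by simp
  finally show ?thesis by simp
qed

text \<open>The integrand z_1 G_2 - z_2 G_1 at x + t^2 z is, up to the factor t^2, the derivative of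
  f along a circle about x, and it integrates to zero over a full turn.\<close>

lemma flux_curl:
  assumes f: "C11 f G"
  shows "flux.av 1 (\<lambda>y. G y $ 2) x = flux.av 2 (\<lambda>y. G y $ 1) x"
proof -
  have cG: "continuous_on UNIV G" and
    G: "continuous_on UNIV (\<lambda>y. G y $ i)" "periodic (\<lambda>y. G y $ i)" for i
    using f by (auto simp: C11_def periodic_def intro!: continuous_intros)
  define F where "F t z = z $ 1 * G (x + t\<^sup>2 *\<^sub>R z) $ 2 - z $ 2 * G (x + t\<^sup>2 *\<^sub>R z) $ 1" for z :: "real^2" and t :: real
  define h where "h z t = indicator {0..1} t * (2 * t / disc_area) * (indicator disc z * F t z)" for z t
  have Fc: "continuous_on UNIV (F t)" for t
    unfolding F_def by (intro continuous_intros continuous_on_compose2[OF cG]) auto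
  have zero: "(LINT z|lborel. indicator disc z * F t z) = 0" if t: "t \<noteq> 0" for t
  proof (rule disc_integral_zero_of_rot[OF Fc])
    fix z
    let ?g = "\<lambda>a. f (x + t\<^sup>2 *\<^sub>R rot a z)"
    have "(LINT a|lborel. indicator {0..2*pi} a * (t\<^sup>2 * F t (rot a z))) = ?g (2*pi) - ?g 0"
    proof (rule FTC_indicator)
      fix a
      have "perp (rot a z) = cos a *\<^sub>R perp z - sin a *\<^sub>R z"
        by (simp add: vec_eq_iff forall_2)
      moreover have "((\<lambda>a. rot a z) has_derivative (\<lambda>s. s *\<^sub>R (cos a *\<^sub>R perp z - sin a *\<^sub>R z))) (at a)"
        unfolding rot_def by (auto intro!: derivative_eq_intros simp: algebra_simps)
      ultimately have "((\<lambda>a. rot a z) has_derivative (\<lambda>s. s *\<^sub>R perp (rot a z))) (at a)" by simp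
      then have "((\<lambda>a. x + t\<^sup>2 *\<^sub>R rot a z) has_derivative (\<lambda>s. t\<^sup>2 *\<^sub>R (s *\<^sub>R perp (rot a z)))) (at a)"
        by (auto intro!: derivative_eq_intros)
      from has_derivative_compose[OF this C11_has_derivative[OF f]]
      have "(?g has_derivative (\<lambda>s. G (x + t\<^sup>2 *\<^sub>R rot a z) \<bullet> (t\<^sup>2 *\<^sub>R (s *\<^sub>R perp (rot a z))))) (at a)" .
      moreover have "G y \<bullet> (t\<^sup>2 *\<^sub>R (s *\<^sub>R perp w)) = t\<^sup>2 * (w $ 1 * G y $ 2 - w $ 2 * G y $ 1) * s" for w y :: "real^2" and s
        by (simp add: inner_vec_def sum_2 algebra_simps)
      ultimately show "(?g has_real_derivative (t\<^sup>2 * F t (rot a z))) (at a)"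
        by (simp only: has_field_derivative_def F_def)
    next
      have "continuous_on UNIV (\<lambda>a. rot a z)"
        unfolding rot_def by (intro continuous_intros)
      then show "continuous_on UNIV (\<lambda>a. t\<^sup>2 * F t (rot a z))"
        by (intro continuous_intros continuous_on_compose2[OF Fc]) auto
    qed simp
    moreover have "rot (2*pi) z = rot 0 z" by (simp add: rot_def)
    ultimately have "t\<^sup>2 * (LINT a|lborel. indicator {0..2*pi} a * F t (rot a z)) = 0"
      by (simp add: mult.left_commute)
    then show "(LINT a|lborel. indicator {0..2*pi} a * F t (rot a z)) = 0" using t by simp
  qed
  have i: "integrable (lborel \<Otimes>\<^sub>M lborel) (\<lambda>p. flux_weight j p * G (x + (snd p)\<^sup>2 *\<^sub>R fst p) $ k)" for j k
    by (rule flux.av_integrable[OF G])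
  have eq: "flux_weight 1 p * G (x + (snd p)\<^sup>2 *\<^sub>R fst p) $ 2 - flux_weight 2 p * G (x + (snd p)\<^sup>2 *\<^sub>R fst p) $ 1
      = (case p of (z, t) \<Rightarrow> h z t)" for p
    by (cases p) (simp add: flux_weight_def h_def F_def algebra_simps diff_divide_distrib)
  have ih: "integrable (lborel \<Otimes>\<^sub>M lborel) (\<lambda>(z, t). h z t)"
    using Bochner_Integration.integrable_diff[OF i[of 1 2] i[of 2 1]] by (simp add: eq)
  have "flux.av 1 (\<lambda>y. G y $ 2) x - flux.av 2 (\<lambda>y. G y $ 1) x
      = (LINT p|(lborel \<Otimes>\<^sub>M lborel). (case p of (z, t) \<Rightarrow> h z t))"
    unfolding flux.av_def by (subst Bochner_Integration.integral_diff[OF i i, symmetric]) (simp only: eq)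
  also have "\<dots> = (LINT t|lborel. LINT z|lborel. h z t)"
    using lborel_pair.integral_snd[OF ih] by simp
  also have "\<dots> = (LINT t|(lborel :: real measure). 0)"
  proof (rule Bochner_Integration.integral_cong[OF refl])
    fix t :: real
    \<comment> \<open>Division by t^2 excludes t = 0 from \<open>zero\<close>, but there the factor
      2 t of the weight vanishes.\<close>
    show "(LINT z|lborel. h z t) = 0" unfolding h_def using zero[of t] by (cases "t = 0") auto
  qed
  finally show ?thesis by simp
qed

section \<open>Boundedness of the singular averages on L^4\<close>

lemma nn_integral_lborel_scale:
  fixes f :: "real^2 \<Rightarrow> ennreal"
  assumes [measurable]: "f \<in> borel_measurable borel" and c: "c > 0"
  shows "(\<integral>\<^sup>+x. f x \<partial>lborel) = ennreal (c\<^sup>2) * (\<integral>\<^sup>+x. f (c *\<^sub>R x) \<partial>lborel)"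
proof -
  have "(\<integral>\<^sup>+x. f x \<partial>lborel) = (\<integral>\<^sup>+x. f x \<partial>density (distr lborel borel (\<lambda>x. 0 + c *\<^sub>R x)) (\<lambda>_. ennreal (\<bar>c\<bar>^DIM(real^2))))"
    using lborel_affine[of c "0::real^2"] c by simp
  also have "\<dots> = ennreal (c\<^sup>2) * (\<integral>\<^sup>+x. f (c *\<^sub>R x) \<partial>lborel)"
    using c by (simp add: nn_integral_density nn_integral_distr nn_integral_cmult)
  finally show ?thesis .
qed

lemma disc_cover:
  assumes "z \<in> disc"
  shows "\<exists>k\<in>{vector [0, 0], vector [-1, 0], vector [0, -1], vector [-1, -1]}. z - k \<in> cbox 0 (1::real^2)"
proof -
  have "\<bar>z $ i\<bar> \<le> 1" for i
    using component_le_norm_cart[of z i] assms by (simp add: disc_def)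
  then have "\<bar>z $ 1\<bar> \<le> 1" "\<bar>z $ 2\<bar> \<le> 1" by auto
  then show ?thesis by (auto simp: mem_box_cart forall_2)
qed

text \<open>The disc lies in [-1, 1]^2, which is covered by the four unit squares of
  \<open>disc_cover\<close>; each of them carries one full period.\<close>

lemma disc_nn_integral_le:
  fixes f :: "real^2 \<Rightarrow> ennreal"
  assumes [measurable]: "f \<in> borel_measurable borel" and per: "periodic f"
  shows "(\<integral>\<^sup>+z. indicator disc z * f (x + z) \<partial>lborel) \<le> 4 * (\<integral>\<^sup>+x. f x \<partial>torus)"
proof -
  let ?K = "{vector [0, 0], vector [-1, 0], vector [0, -1], vector [-1, -1]} :: (real^2) set"
  have cell: "(\<integral>\<^sup>+z. indicator (cbox 0 1) (z - k) * f (x + z) \<partial>lborel) = (\<integral>\<^sup>+x. f x \<partial>torus)" for k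
  proof -
    have "(\<integral>\<^sup>+z. indicator (cbox 0 1) (z - k) * f (x + z) \<partial>lborel)
        = (\<integral>\<^sup>+z. indicator (cbox 0 1) z * f (z + (x + k)) \<partial>lborel)"
      using nn_integral_lborel_shift[of "\<lambda>z. indicator (cbox 0 1) (z - k) * f (x + z)" k]
      by (simp add: algebra_simps)
    also have "\<dots> = (\<integral>\<^sup>+z. f (z + (x + k)) \<partial>torus)" by (subst nn_integral_torus) (auto simp: mult.commute)
    also have "\<dots> = (\<integral>\<^sup>+x. f x \<partial>torus)" by (rule nn_integral_torus_shift) (use per in auto)
    finally show ?thesis .
  qed
  have "(\<integral>\<^sup>+z. indicator disc z * f (x + z) \<partial>lborel) \<le> (\<integral>\<^sup>+z. (\<Sum>k\<in>?K. indicator (cbox 0 1) (z - k) * f (x + z)) \<partial>lborel)"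
  proof (rule nn_integral_mono)
    fix z
    show "indicator disc z * f (x + z) \<le> (\<Sum>k\<in>?K. indicator (cbox 0 1) (z - k) * f (x + z))"
    proof (cases "z \<in> disc")
      case True
      then obtain k where k: "k \<in> ?K" "z - k \<in> cbox 0 1" using disc_cover by blast
      have "indicator (cbox 0 1) (z - k) * f (x + z) \<le> (\<Sum>k\<in>?K. indicator (cbox 0 1) (z - k) * f (x + z))"
        by (rule member_le_sum[OF k(1)]) auto
      then show ?thesis using True k by simp
    qed simp
  qed
  also have "\<dots> = (\<Sum>k\<in>?K. (\<integral>\<^sup>+x. f x \<partial>torus))"
    by (subst nn_integral_sum) (simp_all only: cell, auto)
  also have "\<dots> = of_nat (card ?K) * (\<integral>\<^sup>+x. f x \<partial>torus)" by (rule sum_constant)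
  also have "\<dots> \<le> of_nat 4 * (\<integral>\<^sup>+x. f x \<partial>torus)"
    by (intro mult_right_mono of_nat_mono card_insert_le_m1 card.insert_remove[THEN eq_refl, THEN order_trans])
       (auto intro!: card_insert_le_m1 order_trans[OF card_insert_le_m1])
  finally show ?thesis by simp
qed

text \<open>t^4 is the Jacobian of z |-> t^2 z in the plane. The substitution leads to the disc of
  radius t^2, which lies in the unit disc, so the bound does not degenerate as t tends to 0.\<close>

lemma scaled_disc_integral_le:
  assumes h: "continuous_on UNIV h" "periodic h" "\<And>x. h x \<ge> 0" and t: "0 \<le> t" "t \<le> 1"
  shows "(LINT z|lborel. indicator disc z * (t^4 * h (x + t\<^sup>2 *\<^sub>R z))) \<le> 4 * (LINT x|torus. h x)"
proof (cases "t = 0")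
  case True
  then show ?thesis using h(3) by simp
next
  case False
  then have t0: "t > 0" using t by simp
  have [measurable]: "h \<in> borel_measurable borel" using h(1) by (rule borel_measurable_continuous_onI)
  have c: "continuous_on UNIV (\<lambda>z. t^4 * h (x + t\<^sup>2 *\<^sub>R z))"
    by (intro continuous_intros continuous_on_compose2[OF h(1)]) auto
  have "ennreal (LINT z|lborel. indicator disc z * (t^4 * h (x + t\<^sup>2 *\<^sub>R z)))
      = (\<integral>\<^sup>+z. ennreal (indicator disc z * (t^4 * h (x + t\<^sup>2 *\<^sub>R z))) \<partial>lborel)"
    by (rule nn_integral_eq_integral[symmetric])
       (use borel_set_integrable_continuous[OF compact_disc c] h t in auto)
  also have "\<dots> = (\<integral>\<^sup>+z. ennreal ((t\<^sup>2)\<^sup>2) * (indicator disc z * ennreal (h (x + t\<^sup>2 *\<^sub>R z))) \<partial>lborel)"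
    using h t by (intro nn_integral_cong) (auto simp: indicator_def ennreal_mult)
  also have "\<dots> \<le> (\<integral>\<^sup>+z. ennreal ((t\<^sup>2)\<^sup>2) * (indicator disc (t\<^sup>2 *\<^sub>R z) * ennreal (h (x + t\<^sup>2 *\<^sub>R z))) \<partial>lborel)"
  proof (intro nn_integral_mono mult_left_mono mult_right_mono)
    fix z :: "real^2"
    have "norm (t\<^sup>2 *\<^sub>R z) \<le> 1" if "norm z \<le> 1"
      using that t by (auto simp: power_le_one intro!: mult_le_one)
    then show "indicator disc z \<le> (indicator disc (t\<^sup>2 *\<^sub>R z) :: ennreal)"
      by (auto simp: indicator_def disc_def)
  qed auto
  also have "\<dots> = (\<integral>\<^sup>+z. indicator disc z * ennreal (h (x + z)) \<partial>lborel)"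
    using nn_integral_lborel_scale[of "\<lambda>z. indicator disc z * ennreal (h (x + z))" "t\<^sup>2"] t0
    by (simp add: nn_integral_cmult)
  also have "\<dots> \<le> 4 * (\<integral>\<^sup>+x. ennreal (h x) \<partial>torus)"
    by (rule disc_nn_integral_le) (use h(2) in \<open>auto simp: periodic_def\<close>)
  also have "(\<integral>\<^sup>+x. ennreal (h x) \<partial>torus) = ennreal (LINT x|torus. h x)"
    by (rule nn_integral_eq_integral) (use h integrable_torus_continuous in auto)
  also have "4 * \<dots> = ennreal (4 * (LINT x|torus. h x))"
    using h(3) by (subst ennreal_mult) (auto intro!: integral_nonneg_AE)
  finally show ?thesis using h(3) by (subst (asm) ennreal_le_iff) auto
qed

lemma le_one_plus_power4: "a \<le> 1 + a^4" for a :: real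
proof -
  have "0 \<le> (a\<^sup>2 - 1/2)\<^sup>2 + (a - 1/2)\<^sup>2" by simp
  also have "\<dots> = a^4 - a + 1/2" by algebra
  finally show ?thesis by simp
qed

text \<open>Along the reparametrised segment \<open>t\<^sup>2 z\<close> the singular kernel \<open>1/\<bar>y\<bar>\<close> becomes
  the bounded weight \<open>2 t z\<close>; the \<open>L\<^sup>4\<close> norm enters because \<open>1/\<bar>y\<bar>\<close> is in \<open>L\<^bsup>4/3\<^esup>\<close>.\<close>

lemma flux_bound:
  assumes g: "continuous_on UNIV g" "periodic g"
  shows "\<bar>flux.av j g x\<bar> \<le> 2 + 8 * (LINT x|torus. g x ^ 4)"
proof -
  define I where "I = (LINT x|torus. g x ^ 4)"
  have I: "I \<ge> 0" by (simp add: I_def)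
  have g4: "continuous_on UNIV (\<lambda>x. g x ^ 4)" "periodic (\<lambda>x. g x ^ 4)" "\<And>x. g x ^ 4 \<ge> 0"
    using g by (auto intro!: continuous_intros simp: periodic_def)
  define h where "h z t = 2 / disc_area * indicator {0..1} t * (indicator disc z * 1 + indicator disc z * (t^4 * g (x + t\<^sup>2 *\<^sub>R z) ^ 4))"
    for z :: "real^2" and t :: real
  have cg: "continuous_on UNIV (\<lambda>p::(real^2)\<times>real. 2 / disc_area * (1 + (snd p)^4 * g (x + (snd p)\<^sup>2 *\<^sub>R fst p) ^ 4))"
    by (intro continuous_intros continuous_on_compose2[OF g(1)]) auto
  have "integrable lborel (\<lambda>p. indicator (disc \<times> {0..1}) p * (2 / disc_area * (1 + (snd p)^4 * g (x + (snd p)\<^sup>2 *\<^sub>R fst p) ^ 4)))"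
    by (rule borel_set_integrable_continuous[OF _ cg]) (auto intro: compact_Times compact_disc)
  moreover have "indicator (disc \<times> {0..1}) p * (2 / disc_area * (1 + (snd p)^4 * g (x + (snd p)\<^sup>2 *\<^sub>R fst p) ^ 4)) = (case p of (z, t) \<Rightarrow> h z t)" for p
    by (cases p) (auto simp: h_def indicator_def)
  ultimately have ih: "integrable (lborel \<Otimes>\<^sub>M lborel) (\<lambda>(z, t). h z t)" by (simp add: lborel_prod)
  have "\<bar>flux.av j g x\<bar> \<le> (LINT p|(lborel \<Otimes>\<^sub>M lborel). (case p of (z, t) \<Rightarrow> h z t))"
    unfolding flux.av_def
  proof (rule abs_integral_le[OF flux.av_integrable[OF g] ih])
    fix p :: "(real^2) \<times> real"
    obtain z t where p: "p = (z, t)" by (cases p)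
    let ?g = "g (x + t\<^sup>2 *\<^sub>R z)"
    \<comment> \<open>The factor t of the weight is kept together with g, because its fourth power
      is the Jacobian that \<open>scaled_disc_integral_le\<close> requires.\<close>
    have "\<bar>t * z $ j * ?g\<bar> \<le> 1 + t^4 * ?g^4" if "z \<in> disc" "t \<in> {0..1}"
    proof -
      have "\<bar>z $ j\<bar> \<le> 1" using component_le_norm_cart[of z j] that by (simp add: disc_def)
      then have "\<bar>z $ j\<bar> * \<bar>t * ?g\<bar> \<le> 1 * \<bar>t * ?g\<bar>" by (intro mult_right_mono) auto
      then have "\<bar>t * z $ j * ?g\<bar> \<le> \<bar>t * ?g\<bar>" by (simp add: abs_mult ac_simps)
      also have "\<dots> \<le> 1 + \<bar>t * ?g\<bar>^4" by (rule le_one_plus_power4)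
      finally show ?thesis by (simp add: power_even_abs power_mult_distrib)
    qed
    then show "\<bar>flux_weight j p * g (x + (snd p)\<^sup>2 *\<^sub>R fst p)\<bar> \<le> (case p of (z, t) \<Rightarrow> h z t)"
      using disc_area_ge by (auto simp: p flux_weight_def h_def indicator_def abs_mult mult.assoc field_simps)
  qed
  also have "\<dots> = (LINT t|lborel. LINT z|lborel. h z t)"
    using lborel_pair.integral_snd[OF ih] by simp
  also have "\<dots> \<le> (LINT t|lborel. indicator {0..1::real} t * (2 + 8 * I))"
  proof (rule integral_mono)
    show "integrable lborel (\<lambda>t. LINT z|lborel. h z t)" using lborel_pair.integrable_snd[OF ih] by simp
    show "integrable lborel (\<lambda>t::real. indicator {0..1} t * (2 + 8 * I))"
      by (rule borel_set_integrable_continuous) auto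
    fix t :: real
    show "(LINT z|lborel. h z t) \<le> indicator {0..1} t * (2 + 8 * I)"
    proof (cases "t \<in> {0..1}")
      case True
      have c: "continuous_on UNIV (\<lambda>z. t^4 * g (x + t\<^sup>2 *\<^sub>R z) ^ 4)"
        by (intro continuous_intros continuous_on_compose2[OF g(1)]) auto
      have "(LINT z|lborel. h z t) = 2 / disc_area * (disc_area + (LINT z|lborel. indicator disc z * (t^4 * g (x + t\<^sup>2 *\<^sub>R z) ^ 4)))"
        unfolding h_def using True disc_integrable borel_set_integrable_continuous[OF compact_disc c]
        by (simp add: disc_integral)
      also have "\<dots> \<le> 2 / disc_area * (disc_area + 4 * I)"
        using scaled_disc_integral_le[OF g4, of t x] True disc_area_ge unfolding I_def
        by (intro mult_left_mono add_left_mono) auto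
      also have "\<dots> = 2 + 8 * I / disc_area" using disc_area_ge by (simp add: field_simps)
      also have "\<dots> \<le> 2 + 8 * I" using disc_area_ge I mult_left_mono[of 1 disc_area "8 * I"] by (simp add: divide_le_eq)
      finally show ?thesis using True by simp
    qed (simp add: h_def)
  qed
  also have "\<dots> = 2 + 8 * I" by simp
  finally show ?thesis by (simp add: I_def)
qed

section \<open>Lipschitz regularity of the Biot-Savart field\<close>

lemma C11_components:
  assumes "C11 f G"
  shows "continuous_on UNIV f" "periodic f" "continuous_on UNIV (\<lambda>y. G y $ i)" "periodic (\<lambda>y. G y $ i)"
  using assms by (auto intro!: continuous_intros simp: periodic_def C11_def)

lemma disc_mean_contracts:
  assumes f: "continuous_on UNIV f" "periodic f" "(LINT x|torus. f x) = 0" and S: "\<And>x. \<bar>f x\<bar> \<le> S"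
  shows "\<bar>disc_mean.av f x\<bar> \<le> contr * S"
proof -
  have "S \<ge> 0" using S[of 0] by linarith
  then have "reduced_mean.mass * S \<le> contr * S" using contr by (intro mult_right_mono) auto
  then show ?thesis using reduced_mean.av_bound[OF f(1,2) S, of x] disc_mean_eq_reduced_mean[OF f, of x] by linarith
qed

lemma zero_of_power_bound:
  fixes a S :: real
  assumes "\<And>n. \<bar>a\<bar> \<le> contr ^ n * S" shows "a = 0"
proof -
  have "(\<lambda>n. contr ^ n * S) \<longlonglongrightarrow> 0 * S" using contr by (intro tendsto_intros LIMSEQ_power_zero) auto
  then have "\<bar>a\<bar> \<le> 0 * S" by (rule LIMSEQ_le_const) (use assms in auto)
  then show ?thesis by simp
qed

lemma disc_mean_fixed_zero:
  assumes f: "continuous_on UNIV f" "periodic f" "(LINT x|torus. f x) = 0" and fx: "\<And>x. disc_mean.av f x = f x"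
  shows "f x = 0"
proof -
  obtain S where S: "\<And>x. norm (f x) \<le> S" using periodic_bounded[OF f(2,1)] by blast
  have "\<bar>f x\<bar> \<le> contr ^ n * S" for n x
  proof (induction n arbitrary: x)
    case (Suc n)
    then show ?case using disc_mean_contracts[OF f, of "contr ^ n * S" x] fx by simp
  qed (use S in simp)
  then show ?thesis by (rule zero_of_power_bound)
qed

lemma av_uminus: "averaging M t w \<Longrightarrow> averaging.av M t w (\<lambda>y. - f y) x = - averaging.av M t w f x"
  by (simp add: averaging.av_def)

text \<open>After mollification both equations hold pointwise. In the divergence formula for v_1 the
  derivatives are exchanged for those of v_2, by d_1 v_1 = - d_2 v_2 and d_2 v_1 = d_1 v_2; what
  results is the curl expression for v_2, hence zero. So v_1 is a fixed point of A with mean zero,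
  and likewise v_2.\<close>

lemma biot_savart_unique:
  fixes v :: "real^2 \<Rightarrow> real^2"
  assumes i: "\<And>j. integrable torus (\<lambda>x. v x $ j)" and mean: "\<And>j. (LINT x|torus. v x $ j) = 0"
    and div: "weak_div_free v" and curl: "has_weak_curl v (\<lambda>_. 0)"
  shows "AE x in torus. v x = 0"
proof -
  have "conv (\<lambda>x. v x $ j) (kern n) x = 0" for n j x
  proof -
    let ?k = "kern n" and ?d = "\<lambda>i. partial i (kern n)"
    let ?f = "\<lambda>j. conv (\<lambda>x. v x $ j) ?k" and ?G = "\<lambda>j x. \<chi> i. conv (\<lambda>x. v x $ j) (?d i) x"
    have p: "?d i \<in> test_functions" for i by (intro test_partial kern_test)
    have C: "C11 (?f j) (?G j)" for j by (rule conv_C11[OF i kern_test])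
    have ci: "integrable torus (\<lambda>y. v y $ j * ?d i (x - y))" for i j x by (rule conv_integrable[OF i p])
    have d: "conv (\<lambda>x. v x $ 1) (?d 1) x = - conv (\<lambda>x. v x $ 2) (?d 2) x" for x
    proof -
      have "(LINT y|torus. v y $ 1 * partial 1 (\<lambda>y. ?k (x - y)) y + v y $ 2 * partial 2 (\<lambda>y. ?k (x - y)) y) = 0"
        using div test_reflect[OF kern_test] unfolding weak_div_free_def by blast
      then have "- conv (\<lambda>x. v x $ 1) (?d 1) x = conv (\<lambda>x. v x $ 2) (?d 2) x"
        using ci by (simp add: partial_reflect[OF test_differentiable[OF kern_test]] conv_def)
      then show ?thesis by linarith
    qed
    have "(LINT y|torus. v y $ 2 * partial 1 (\<lambda>y. ?k (x - y)) y - v y $ 1 * partial 2 (\<lambda>y. ?k (x - y)) y) = 0" for x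
      using curl test_reflect[OF kern_test] unfolding has_weak_curl_def by force
    then have c: "conv (\<lambda>x. v x $ 1) (?d 2) x = conv (\<lambda>x. v x $ 2) (?d 1) x" for x
      using ci by (simp add: partial_reflect[OF test_differentiable[OF kern_test]] conv_def)
    have m: "(LINT x|torus. ?f j x) = 0" for j
      by (simp add: conv_av[OF i] averaging.av_integral[OF averaging_torus[OF i] kern_continuous kern_periodic] mean)
    have A1: "disc_mean.av (?f 1) x - ?f 1 x = flux.av 1 (\<lambda>y. - ?G 2 y $ 2) x + flux.av 2 (\<lambda>y. ?G 2 y $ 1) x" for x
      using flux_divergence[OF C[of 1], of x] by (simp add: d c)
    have 1: "disc_mean.av (?f 1) x = ?f 1 x" for x
      using A1[of x] flux_curl[OF C[of 2], of x] by (simp add: av_uminus[OF flux.averaging_axioms])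
    have d': "conv (\<lambda>x. v x $ 2) (?d 2) x = - conv (\<lambda>x. v x $ 1) (?d 1) x" for x using d[of x] by simp
    have A2: "disc_mean.av (?f 2) x - ?f 2 x = flux.av 1 (\<lambda>y. ?G 1 y $ 2) x + flux.av 2 (\<lambda>y. - ?G 1 y $ 1) x" for x
      using flux_divergence[OF C[of 2], of x] by (simp add: d' c)
    have 2: "disc_mean.av (?f 2) x = ?f 2 x" for x
      using A2[of x] flux_curl[OF C[of 1], of x] by (simp add: av_uminus[OF flux.averaging_axioms])
    have "disc_mean.av (?f j) x = ?f j x" for x using 1 2 exhaust_2[of j] by auto
    then show ?thesis by (rule disc_mean_fixed_zero[OF C11_components(1,2)[OF C] m])
  qed
  then have "AE x in torus. v x $ j = 0" for j by (rule AE_zero_of_conv[OF i])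
  then have "AE x in torus. v x $ 1 = 0 \<and> v x $ 2 = 0" by (intro AE_conjI)
  then show ?thesis by (rule eventually_mono) (auto simp: vec_eq_iff forall_2)
qed

section \<open>The Neumann series for f - A f = \<xi>\<close>

primrec neumann :: "(real^2 \<Rightarrow> real) \<Rightarrow> nat \<Rightarrow> real^2 \<Rightarrow> real" where
  "neumann \<xi> 0 = (\<lambda>_. 0)"
| "neumann \<xi> (Suc m) = (\<lambda>x. \<xi> x + disc_mean.av (neumann \<xi> m) x)"

primrec neumann_grad :: "(real^2 \<Rightarrow> real^2) \<Rightarrow> nat \<Rightarrow> real^2 \<Rightarrow> real^2" where
  "neumann_grad X 0 = (\<lambda>_. 0)"
| "neumann_grad X (Suc m) = (\<lambda>x. X x + disc_mean.avv (neumann_grad X m) x)"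

lemma C11_zero: "C11 (\<lambda>_. 0) (\<lambda>_. 0)"
  unfolding C11_def taylor_def periodic_def by (auto intro: exI[of _ 0])

lemma C11_add: "C11 f F \<Longrightarrow> C11 g G \<Longrightarrow> C11 (\<lambda>x. f x + g x) (\<lambda>x. F x + G x)"
  using C11_lincomb[of f F g G 1 1] by simp

lemma C11_uminus: "C11 f F \<Longrightarrow> C11 (\<lambda>x. - f x) (\<lambda>x. - F x)"
  using C11_lincomb[of f F f F "-1" 0] by simp

lemma neumann_C11: "C11 \<xi> X \<Longrightarrow> C11 (neumann \<xi> m) (neumann_grad X m)"
  by (induction m) (auto intro: C11_zero C11_add disc_mean.av_C11)

lemma neumann_mean:
  assumes X: "C11 \<xi> X" and z: "(LINT x|torus. \<xi> x) = 0"
  shows "(LINT x|torus. neumann \<xi> m x) = 0"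
proof (induction m)
  case (Suc m)
  have c: "C11 (neumann \<xi> m) (neumann_grad X m)" by (rule neumann_C11[OF X])
  have "integrable torus \<xi>" "integrable torus (disc_mean.av (neumann \<xi> m))"
    using X disc_mean.av_C11[OF c] by (auto intro!: integrable_torus_continuous simp: C11_def)
  then show ?case using z Suc disc_mean_integral[OF C11_components(1,2)[OF c]] by simp
qed simp

text \<open>Consecutive differences are images under A of functions with mean zero, which gives one
  factor \<open>contr\<close> each time. The difference is also the residual \<xi> + A f - f of the
  truncated series f, and it is used in that role.\<close>

lemma neumann_step:
  assumes X: "C11 \<xi> X" and z: "(LINT x|torus. \<xi> x) = 0" and S: "\<And>x. \<bar>\<xi> x\<bar> \<le> S"
  shows "\<bar>neumann \<xi> (Suc m) x - neumann \<xi> m x\<bar> \<le> contr ^ m * S"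
proof (induction m arbitrary: x)
  case 0
  then show ?case using S by (simp add: disc_mean.av_def)
next
  case (Suc m)
  let ?d = "\<lambda>x. neumann \<xi> (Suc m) x - neumann \<xi> m x"
  have c: "C11 (neumann \<xi> m) (neumann_grad X m)" for m by (rule neumann_C11[OF X])
  note c1 = C11_components(1)[OF c] and c2 = C11_components(2)[OF c]
  have "\<bar>disc_mean.av ?d x\<bar> \<le> contr * (contr ^ m * S)"
  proof (rule disc_mean_contracts[OF _ _ _ Suc])
    show "continuous_on UNIV ?d" using c1[of "Suc m"] c1[of m] by (rule continuous_on_diff)
    show "periodic ?d" using c2[of "Suc m"] c2[of m] by (simp add: periodic_def del: neumann.simps)
    show "(LINT x|torus. ?d x) = 0"
      using integrable_torus_continuous[OF c1[of "Suc m"]] integrable_torus_continuous[OF c1[of m]]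
        neumann_mean[OF X z, of m] neumann_mean[OF X z, of "Suc m"]
      by (simp del: neumann.simps)
  qed
  moreover have "disc_mean.av ?d x = disc_mean.av (neumann \<xi> (Suc m)) x - disc_mean.av (neumann \<xi> m) x"
    using disc_mean.av_lincomb[OF c1[of "Suc m"] c2[of "Suc m"] c1[of m] c2[of m], of 1 "-1" x] by (simp del: neumann.simps)
  moreover have "neumann \<xi> (Suc (Suc m)) x - neumann \<xi> (Suc m) x = disc_mean.av (neumann \<xi> (Suc m)) x - disc_mean.av (neumann \<xi> m) x"
    by (subst (1 2) neumann.simps(2)) simp
  ultimately show ?case by (simp add: mult.assoc del: neumann.simps)
qed

text \<open>Gradient components of periodic functions have mean zero, so A acts on them as the
  reduced mean, with mass at most \<open>contr\<close>. The bound B = I / (1 - contr)^4 reproduces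
  itself, since (1 - contr) B + contr B = B.\<close>

lemma neumann_grad_L4:
  assumes X: "C11 \<xi> X"
  shows "(LINT x|torus. neumann_grad X m x $ i ^ 4) \<le> (LINT x|torus. X x $ i ^ 4) / (1 - contr)^4"
proof (induction m)
  case 0
  show ?case using contr by (simp add: divide_nonneg_nonneg)
next
  case (Suc m)
  define c where "c = 1 - contr"
  have c: "c > 0" "c + contr = 1" using contr by (auto simp: c_def)
  let ?Z = "\<lambda>x. neumann_grad X m x $ i"
  let ?I = "LINT x|torus. X x $ i ^ 4"
  have C: "C11 (neumann \<xi> m) (neumann_grad X m)" by (rule neumann_C11[OF X])
  have Zc: "continuous_on UNIV ?Z" "periodic ?Z" by (rule C11_components[OF C])+
  have eq: "disc_mean.av ?Z x = reduced_mean.av ?Z x" for x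
    by (rule disc_mean_eq_reduced_mean[OF Zc C11_integral_gradient[OF C]])
  have Ac: "continuous_on UNIV (reduced_mean.av ?Z)" by (rule reduced_mean.av_continuous[OF Zc])
  have Xc: "continuous_on UNIV (\<lambda>x. X x $ i)" by (rule C11_components[OF X])
  have i: "integrable torus (\<lambda>x. X x $ i ^ 4 / c^3)" "integrable torus (\<lambda>x. reduced_mean.av ?Z x ^ 4 / contr^3)"
    using c contr by (auto intro!: integrable_torus_continuous continuous_intros Xc Ac)
  have "(LINT x|torus. neumann_grad X (Suc m) x $ i ^ 4) \<le> (LINT x|torus. X x $ i ^ 4 / c^3 + reduced_mean.av ?Z x ^ 4 / contr^3)"
  proof (rule integral_mono)
    show "integrable torus (\<lambda>x. neumann_grad X (Suc m) x $ i ^ 4)"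
      by (intro integrable_torus_continuous continuous_on_power C11_components(3)[OF neumann_C11[OF X]])
    show "integrable torus (\<lambda>x. X x $ i ^ 4 / c^3 + reduced_mean.av ?Z x ^ 4 / contr^3)" using i by simp
    fix x
    \<comment> \<open>The sum of X and the average of Z is written as a convex combination of X / c
      and that average divided by \<open>contr\<close>, so that convexity of the fourth power takes
      the place of Minkowski's inequality.\<close>
    have "(c * (X x $ i / c) + contr * (reduced_mean.av ?Z x / contr))^4 \<le> c * (X x $ i / c)^4 + contr * (reduced_mean.av ?Z x / contr)^4"
      using c contr by (intro power4_jensen2) auto
    moreover have "c * (X x $ i / c)^4 = X x $ i ^ 4 / c^3" "contr * (reduced_mean.av ?Z x / contr)^4 = reduced_mean.av ?Z x ^ 4 / contr^3"
      using c contr by (simp_all add: power_divide power4_eq_xxxx power3_eq_cube)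
    ultimately show "neumann_grad X (Suc m) x $ i ^ 4 \<le> X x $ i ^ 4 / c^3 + reduced_mean.av ?Z x ^ 4 / contr^3"
      using c contr by (simp add: disc_mean.avv_def eq)
  qed
  also have "\<dots> = ?I / c^3 + (LINT x|torus. reduced_mean.av ?Z x ^ 4) / contr^3" using i by simp
  also have "\<dots> \<le> ?I / c^3 + (contr^4 * (?I / (1 - contr)^4)) / contr^3"
  proof (intro add_left_mono divide_right_mono)
    have "(LINT x|torus. reduced_mean.av ?Z x ^ 4) \<le> contr^4 * (LINT x|torus. ?Z x ^ 4)"
      by (rule reduced_mean.av_L4[OF Zc contr(3)])
    also have "\<dots> \<le> contr^4 * (?I / (1 - contr)^4)" using Suc contr by (intro mult_left_mono) auto
    finally show "(LINT x|torus. reduced_mean.av ?Z x ^ 4) \<le> contr^4 * (?I / (1 - contr)^4)" .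
  qed (use contr in auto)
  also have "\<dots> = c * (?I / c^4) + contr * (?I / c^4)"
    using c contr by (simp add: c_def[symmetric] power4_eq_xxxx power3_eq_cube)
  also have "\<dots> = ?I / (1 - contr)^4"
    unfolding distrib_right[symmetric] c(2) by (simp add: c_def)
  finally show ?case .
qed

text \<open>The Neumann series is cut off after finitely many terms, so the curl is right only up to
  e; in return everything stays C11, and the gradient bound involves nothing but I.\<close>

lemma smooth_biot_savart:
  assumes X: "C11 \<xi> X" and z: "(LINT x|torus. \<xi> x) = 0" and e: "e > 0"
    and I: "\<And>i. (LINT x|torus. X x $ i ^ 4) \<le> I"
  obtains u :: "real^2 \<Rightarrow> real^2" and D where
    "\<And>j. C11 (\<lambda>x. u x $ j) (D j)"
    "\<And>i j x. \<bar>D j x $ i\<bar> \<le> 2 + 8 * (I / (1 - contr)^4)"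
    "\<And>j. (LINT x|torus. u x $ j) = 0"
    "\<And>x. D 1 x $ 1 + D 2 x $ 2 = 0"
    "\<And>x. \<bar>D 2 x $ 1 - D 1 x $ 2 - \<xi> x\<bar> \<le> e"
proof -
  obtain S where S: "S \<ge> 0" "\<And>x. norm (\<xi> x) \<le> S" using periodic_bounded X C11_def by metis
  have "(\<lambda>m. contr ^ m * S) \<longlonglongrightarrow> 0 * S" using contr by (intro tendsto_intros LIMSEQ_power_zero) auto
  then have "\<forall>\<^sub>F m in sequentially. contr ^ m * S < e" using e by (intro order_tendstoD) auto
  then obtain m where m: "contr ^ m * S < e" by (auto simp: eventually_sequentially)
  define \<zeta> where "\<zeta> = neumann \<xi> m"
  define Z where "Z = neumann_grad X m"
  have C: "C11 \<zeta> Z" unfolding \<zeta>_def Z_def by (rule neumann_C11[OF X])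
  note cz = C11_components[OF C]
  have res: "\<bar>\<zeta> x - disc_mean.av \<zeta> x - \<xi> x\<bar> \<le> e" for x
    using neumann_step[OF X z, of S m x] S(2) m by (simp add: \<zeta>_def)
  have Zb: "\<bar>flux.av j (\<lambda>y. Z y $ i) x\<bar> \<le> 2 + 8 * (I / (1 - contr)^4)" for i j x
  proof -
    have "(LINT x|torus. Z x $ i ^ 4) \<le> (LINT x|torus. X x $ i ^ 4) / (1 - contr)^4"
      unfolding Z_def by (rule neumann_grad_L4[OF X])
    also have "\<dots> \<le> I / (1 - contr)^4" using I by (intro divide_right_mono) auto
    finally show ?thesis using flux_bound[OF cz(3,4), of j i x] by linarith
  qed
  \<comment> \<open>The flux vector of \<zeta> turned by a right angle. This exchanges the two
    identities: the divergence of u is the vanishing curl of the flux, and the curl of u is minus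
    its divergence, that is \<zeta> - A \<zeta>.\<close>
  define u :: "real^2 \<Rightarrow> real^2" where "u x = (\<chi> j. if j = 1 then flux.av 2 \<zeta> x else - flux.av 1 \<zeta> x)" for x
  define D :: "2 \<Rightarrow> real^2 \<Rightarrow> real^2" where "D j x = (if j = 1 then flux.avv 2 Z x else - flux.avv 1 Z x)" for j x
  have mean: "(LINT x|torus. flux.av j \<zeta> x) = 0" for j
  proof -
    have "(LINT x|torus. \<zeta> x) = 0" unfolding \<zeta>_def by (rule neumann_mean[OF X z])
    then show ?thesis by (simp add: flux.av_integral[OF cz(1,2)])
  qed
  show ?thesis
  proof (rule that[of u D])
    fix j
    show "C11 (\<lambda>x. u x $ j) (D j)"
      using flux.av_C11[OF C, of 2] C11_uminus[OF flux.av_C11[OF C, of 1]] exhaust_2[of j]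
      unfolding u_def D_def[abs_def] by auto
    show "(LINT x|torus. u x $ j) = 0"
      using mean exhaust_2[of j] unfolding u_def by auto
    show "\<bar>D j x $ i\<bar> \<le> 2 + 8 * (I / (1 - contr)^4)" for i x
      using Zb[of 2 i x] Zb[of 1 i x] by (simp add: D_def flux.avv_def)
  next
    fix x
    show "D 1 x $ 1 + D 2 x $ 2 = 0"
      using flux_curl[OF C, of x] by (simp add: D_def flux.avv_def)
    show "\<bar>D 2 x $ 1 - D 1 x $ 2 - \<xi> x\<bar> \<le> e"
      using flux_divergence[OF C, of x] res[of x] by (simp add: D_def flux.avv_def)
  qed
qed

section \<open>The velocity field as a uniform limit\<close>

lemma L1_weak_limit:
  fixes f :: "nat \<Rightarrow> real^2 \<Rightarrow> real"
  assumes i: "\<And>n. integrable torus (f n)" "integrable torus g"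
    and lim: "(\<lambda>n. LINT x|torus. \<bar>f n x - g x\<bar>) \<longlonglongrightarrow> 0"
    and p: "continuous_on UNIV \<phi>" "periodic \<phi>"
  shows "(\<lambda>n. LINT x|torus. f n x * \<phi> x) \<longlonglongrightarrow> (LINT x|torus. g x * \<phi> x)"
proof -
  obtain S where S: "S \<ge> 0" "\<And>x. norm (\<phi> x) \<le> S" using periodic_bounded[OF p(2,1)] by blast
  have "(\<lambda>n. (LINT x|torus. f n x * \<phi> x) - (LINT x|torus. g x * \<phi> x)) \<longlonglongrightarrow> 0"
  proof (rule Lim_null_comparison)
    show "\<forall>\<^sub>F n in sequentially. norm ((LINT x|torus. f n x * \<phi> x) - (LINT x|torus. g x * \<phi> x)) \<le> S * (LINT x|torus. \<bar>f n x - g x\<bar>)"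
    proof (rule always_eventually, intro allI)
      fix n
      have ip: "integrable torus (\<lambda>x. f n x * \<phi> x)" "integrable torus (\<lambda>x. g x * \<phi> x)"
        using i p by (auto intro: integrable_mult_test)
      have "(LINT x|torus. f n x * \<phi> x) - (LINT x|torus. g x * \<phi> x) = (LINT x|torus. (f n x - g x) * \<phi> x)"
        using ip by (simp add: left_diff_distrib)
      also have "\<bar>\<dots>\<bar> \<le> (LINT x|torus. S * \<bar>f n x - g x\<bar>)"
        by (rule abs_integral_le)
           (use ip i S in \<open>auto simp: left_diff_distrib[symmetric] abs_mult mult.commute[of S] intro!: mult_left_mono integrable_mult_test p\<close>)
      finally show "norm ((LINT x|torus. f n x * \<phi> x) - (LINT x|torus. g x * \<phi> x)) \<le> S * (LINT x|torus. \<bar>f n x - g x\<bar>)"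
        by simp
    qed
    show "(\<lambda>n. S * (LINT x|torus. \<bar>f n x - g x\<bar>)) \<longlonglongrightarrow> 0"
      using tendsto_mult_left[OF lim, of S] by simp
  qed
  then show ?thesis by (simp add: LIM_zero_iff)
qed

lemma uniform_L1_limit:
  fixes f :: "nat \<Rightarrow> real^2 \<Rightarrow> real"
  assumes c: "\<And>n. continuous_on UNIV (f n)" "continuous_on UNIV g"
    and lim: "\<And>e. e > 0 \<Longrightarrow> \<forall>\<^sub>F n in sequentially. \<forall>x. \<bar>f n x - g x\<bar> < e"
  shows "(\<lambda>n. LINT x|torus. \<bar>f n x - g x\<bar>) \<longlonglongrightarrow> 0"
proof (rule tendstoI)
  fix e :: real assume e: "e > 0"
  have "e/2 > 0" using e by simp
  from lim[OF this] show "\<forall>\<^sub>F n in sequentially. dist (LINT x|torus. \<bar>f n x - g x\<bar>) 0 < e"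
  proof (eventually_elim)
    case (elim n)
    have "(LINT x|torus. \<bar>f n x - g x\<bar>) \<le> (LINT x|torus. e/2)"
      by (rule integral_mono) (use c elim less_imp_le in \<open>auto intro!: integrable_torus_continuous continuous_intros\<close>)
    moreover have "(LINT x|torus. \<bar>f n x - g x\<bar>) \<ge> 0" by simp
    ultimately show ?case using e by (simp add: dist_norm)
  qed
qed

text \<open>f(x) is the mean over y of f(x) - f(y), and the cell has diameter at most 2. Together
  with a common Lipschitz constant this gives the uniform bound for Arzela-Ascoli.\<close>

lemma mean_zero_lipschitz_bound:
  assumes f: "continuous_on UNIV f" "periodic f" "(LINT x|torus. f x) = 0"
    and lip: "\<And>x y. \<bar>f y - f x\<bar> \<le> L * norm (y - x)" and L: "L \<ge> 0"
  shows "\<bar>f x\<bar> \<le> 2 * L"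
proof -
  have *: "\<bar>f x\<bar> \<le> 2 * L" if x: "x \<in> cbox 0 1" for x
  proof -
    have i: "integrable torus f" by (rule integrable_torus_continuous[OF f(1)])
    have "f x = (LINT y|torus. f x - f y)" using i f(3) by simp
    also have "\<bar>\<dots>\<bar> \<le> (LINT y|torus. 2 * L)"
    proof (rule abs_integral_le)
      fix y assume "y \<in> space torus"
      then have "\<bar>(x - y) $ i\<bar> \<le> 1" for i using x by (auto simp: mem_box_cart abs_le_iff) (smt (verit))+
      then have "(\<Sum>i\<in>UNIV. \<bar>(x - y) $ i\<bar>) \<le> (\<Sum>i\<in>(UNIV::2 set). 1)" by (intro sum_mono)
      then have "norm (x - y) \<le> 2" using norm_le_l1_cart[of "x - y"] by simp
      then have "L * norm (x - y) \<le> L * 2" using L by (intro mult_left_mono)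
      then show "\<bar>f x - f y\<bar> \<le> 2 * L" using lip[of x y] by simp
    qed (use i in auto)
    finally show ?thesis by simp
  qed
  show ?thesis using *[of "fracv x"] fracv_cell[of x] unit_cell_subset periodic_fracv[OF f(2), of x] by auto
qed

lemma norm_vec2_le: "(\<And>i. \<bar>v $ i\<bar> \<le> c) \<Longrightarrow> norm (v::real^2) \<le> 2 * c"
proof -
  assume "\<And>i. \<bar>v $ i\<bar> \<le> c"
  then have "(\<Sum>i\<in>UNIV. \<bar>v $ i\<bar>) \<le> (\<Sum>i\<in>(UNIV::2 set). c)" by (intro sum_mono)
  then show ?thesis using norm_le_l1_cart[of v] by simp
qed

lemma vec_integral_component:
  fixes u :: "real^2 \<Rightarrow> real^2"
  assumes "integrable torus u" shows "(LINT x|torus. u x) $ j = (LINT x|torus. u x $ j)"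
  by (rule integral_bounded_linear[OF bounded_linear_vec_nth assms, symmetric])

lemma vec_integrable_component:
  fixes u :: "real^2 \<Rightarrow> real^2"
  assumes "integrable torus u" shows "integrable torus (\<lambda>x. u x $ j)"
  by (rule integrable_bounded_linear[OF bounded_linear_vec_nth assms])

text \<open>The form in which Lipschitz continuity of u is passed on. The scheme needs velocities
  with Taylor bounds; these may depend on e, whereas L may not.\<close>

definition approximable :: "(real^2 \<Rightarrow> real^2) \<Rightarrow> real \<Rightarrow> bool" where
  "approximable u L \<longleftrightarrow> (\<forall>e>0. \<exists>v D. (\<forall>j. C11 (\<lambda>x. v x $ j) (D j)) \<and> (\<forall>j x. norm (D j x) \<le> L) \<and>
     (\<forall>x. norm (v x - u x) < e))"

text \<open>The gradients of the mollified data are mollified weak gradients, with L^4 norms bounded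
  independently of n. Hence the fields from \<open>smooth_biot_savart\<close> are equi-Lipschitz, a
  subsequence converges uniformly, and the equations pass to the limit in weak form.\<close>

lemma biot_savart_exists:
  assumes xi: "\<xi> \<in> W1p_torus 4 \<inter> E_space"
  obtains u L where "continuous_on UNIV u" "periodic u" "mean_zero u" "weak_div_free u" "has_weak_curl u \<xi>"
    "L > 0" "approximable u L"
proof -
  have i\<xi>: "integrable torus \<xi>" using xi by (auto simp: W1p_torus_def intro: Lp_integrable)
  have z\<xi>: "(LINT x|torus. \<xi> x) = 0" using xi by (simp add: E_space_def mean_zero_def)
  have "\<exists>g\<in>Lp_torus 4. has_weak_partial i \<xi> g" for i using xi by (simp add: W1p_torus_def)
  then obtain g where g: "\<And>i. g i \<in> Lp_torus 4" "\<And>i. has_weak_partial i \<xi> (g i)" by metis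
  have ig: "integrable torus (g i)" "integrable torus (\<lambda>x. g i x ^ 4)" for i
    using g(1)[of i] by (auto simp: Lp_torus_def power_even_abs intro: Lp_integrable[of _ 4])
  define I where "I = (LINT x|torus. g 1 x ^ 4) + (LINT x|torus. g 2 x ^ 4)"
  have I: "(LINT x|torus. g i x ^ 4) \<le> I" for i using exhaust_2[of i] by (auto simp: I_def)
  have I0: "I \<ge> 0" by (simp add: I_def)
  define \<xi>n where "\<xi>n n = conv \<xi> (kern n)" for n
  define Xn where "Xn n x = (\<chi> i. conv \<xi> (partial i (kern n)) x)" for n x
  have C: "C11 (\<xi>n n) (Xn n)" for n unfolding \<xi>n_def Xn_def[abs_def] by (rule conv_C11[OF i\<xi> kern_test])
  have z: "(LINT x|torus. \<xi>n n x) = 0" for n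
    by (simp add: \<xi>n_def conv_av[OF i\<xi>] averaging.av_integral[OF averaging_torus[OF i\<xi>] kern_continuous kern_periodic] z\<xi>)
  have XI: "(LINT x|torus. Xn n x $ i ^ 4) \<le> I" for n i
    using conv_L4[OF ig(1) ig(2), of i n] I[of i] by (simp add: Xn_def conv_weak_partial[OF g(2) kern_test])
  define L0 where "L0 = 2 + 8 * (I / (1 - contr)^4)"
  have L0: "L0 > 0" using I0 contr by (simp add: L0_def add_pos_nonneg)
  have "\<exists>u D. (\<forall>j. C11 (\<lambda>x. (u x :: real^2) $ j) (D j)) \<and> (\<forall>i j x. \<bar>D j x $ i\<bar> \<le> L0) \<and> (\<forall>j. (LINT x|torus. u x $ j) = 0)
      \<and> (\<forall>x. D 1 x $ 1 + D 2 x $ 2 = 0) \<and> (\<forall>x. \<bar>D 2 x $ 1 - D 1 x $ 2 - \<xi>n n x\<bar> \<le> 1 / Suc n)" for n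
    unfolding L0_def by (rule smooth_biot_savart[OF C z _ XI, of "1 / Suc n" n]) (simp, blast)
  then obtain u D where u: "\<And>n j. C11 (\<lambda>x. (u n x :: real^2) $ j) (D n j)" and D: "\<And>n i j x. \<bar>D n j x $ i\<bar> \<le> L0"
    and um: "\<And>n j. (LINT x|torus. u n x $ j) = 0" and udiv: "\<And>n x. D n 1 x $ 1 + D n 2 x $ 2 = 0"
    and ucurl: "\<And>n x. \<bar>D n 2 x $ 1 - D n 1 x $ 2 - \<xi>n n x\<bar> \<le> 1 / Suc n"
    by metis
  define L where "L = 2 * L0"
  have L: "L > 0" using L0 by (simp add: L_def)
  have DL: "norm (D n j x) \<le> L" for n j x unfolding L_def by (rule norm_vec2_le[OF D])
  have lipj: "\<bar>u n y $ j - u n x $ j\<bar> \<le> L * norm (y - x)" for n j x y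
    by (rule gradient_lipschitz[OF C11_has_derivative[OF u] DL])
  have lip: "norm (u n y - u n x) \<le> 2 * (L * norm (y - x))" for n x y
    by (rule norm_vec2_le) (use lipj in simp)
  have bd: "norm (u n x) \<le> 2 * (2 * L)" for n x
    by (rule norm_vec2_le, rule mean_zero_lipschitz_bound[OF C11_components(1,2)[OF u] um lipj]) (use L in simp)
  have uper: "periodic (u n)" for n
    using C11_components(2)[OF u, of n] by (simp add: periodic_def vec_eq_iff)
  have ucont: "continuous_on UNIV (u n)" for n
    using continuous_on_vec_lambda[of UNIV "\<lambda>j x. u n x $ j"] C11_components(1)[OF u, of n] by simp
  obtain g0 k where g0: "continuous_on (cbox 0 (1::real^2)) g0" and k: "strict_mono (k :: nat \<Rightarrow> nat)"
     and unif: "\<And>e. 0 < e \<Longrightarrow> \<exists>N. \<forall>n x. n \<ge> N \<and> x \<in> cbox 0 1 \<longrightarrow> norm (u (k n) x - g0 x) < e"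
  proof (rule Arzela_Ascoli[of "cbox 0 (1::real^2)" u "2 * (2 * L)"])
    fix x :: "real^2" and e :: real assume e: "0 < e"
    have "norm (u n x - u n y) < e" if "norm (x - y) < e / (2 * L)" for n y
    proof -
      have "2 * (L * norm (x - y)) < e" using that L by (simp add: field_simps)
      then show ?thesis using lip[of n x y] by simp
    qed
    then show "\<exists>d. 0 < d \<and> (\<forall>n y. y \<in> cbox 0 1 \<and> norm (x - y) < d \<longrightarrow> norm (u n x - u n y) < e)"
      using e L by (intro exI[of _ "e / (2 * L)"]) auto
  qed (use bd in auto)
  \<comment> \<open>Compactness is used on the closed cell only. The limit is extended by
    \<open>fracv\<close>, and uniform convergence carries over because each \<open>u n\<close> is
    periodic.\<close>
  define w where "w x = g0 (fracv x)" for x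
  have unifw: "\<forall>\<^sub>F n in sequentially. \<forall>x. norm (u (k n) x - w x) < e" if e: "e > 0" for e
  proof -
    obtain N where N: "\<And>n x. n \<ge> N \<Longrightarrow> x \<in> cbox 0 1 \<Longrightarrow> norm (u (k n) x - g0 x) < e"
      using unif[OF e] by blast
    have "norm (u (k n) x - w x) < e" if "n \<ge> N" for n x
    proof -
      have "fracv x \<in> cbox 0 1" using fracv_cell unit_cell_subset by blast
      then show ?thesis using N[OF that, of "fracv x"] periodic_fracv[OF uper] by (simp add: w_def)
    qed
    then show ?thesis by (auto simp: eventually_sequentially)
  qed
  have wc: "continuous_on UNIV w"
  proof (rule uniform_limit_theorem)
    show "uniform_limit UNIV (\<lambda>n. u (k n)) w sequentially"
      using unifw by (auto simp: uniform_limit_iff dist_norm)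
  qed (use ucont in auto)
  have wp: "periodic w"
  proof -
    have "fracv (x + axis i 1) = fracv x" for x i
      by (auto simp: fracv_def vec_eq_iff axis_def frac_1_eq)
    then show ?thesis by (simp add: periodic_def w_def)
  qed
  have wcj: "continuous_on UNIV (\<lambda>x. w x $ j)" for j by (intro continuous_intros wc)
  have ucj: "continuous_on UNIV (\<lambda>x. u n x $ j)" for j n by (intro continuous_intros ucont)
  have L1: "(\<lambda>n. LINT x|torus. \<bar>u (k n) x $ j - w x $ j\<bar>) \<longlonglongrightarrow> 0" for j
  proof (rule uniform_L1_limit[OF ucj wcj])
    fix e :: real assume "e > 0"
    from unifw[OF this] show "\<forall>\<^sub>F n in sequentially. \<forall>x. \<bar>u (k n) x $ j - w x $ j\<bar> < e"
    proof eventually_elim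
      case (elim n)
      have "\<bar>(u (k n) x - w x) $ j\<bar> < e" for x
        using elim component_le_norm_cart[of "u (k n) x - w x" j] by (meson le_less_trans)
      then show ?case by simp
    qed
  qed
  have iu: "integrable torus (\<lambda>x. u n x $ j)" "integrable torus (\<lambda>x. w x $ j)" for n j
    by (rule integrable_torus_continuous[OF ucj], rule integrable_torus_continuous[OF wcj])
  have weak: "(\<lambda>n. LINT x|torus. u (k n) x $ j * \<phi> x) \<longlonglongrightarrow> (LINT x|torus. w x $ j * \<phi> x)"
    if "continuous_on UNIV \<phi>" "periodic \<phi>" for \<phi> j
    by (rule L1_weak_limit[OF iu(1) iu(2) L1 that])
  have parts: "(LINT x|torus. u n x $ j * partial i \<phi> x) = - (LINT x|torus. D n j x $ i * \<phi> x)"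
    if "\<phi> \<in> test_functions" for \<phi> i j n
    using torus_by_parts[OF u[of n j] test_C11[OF that], of i] by simp
  have Dc: "continuous_on UNIV (\<lambda>x. D n j x $ i)" for n i j by (rule C11_components(3)[OF u])
  have iD: "integrable torus (\<lambda>x. D n j x $ i * \<phi> x)" if "\<phi> \<in> test_functions" for \<phi> i j n
    by (intro integrable_torus_continuous continuous_intros Dc test_continuous that)
  have iup: "integrable torus (\<lambda>x. u n x $ j * partial i \<phi> x)" "integrable torus (\<lambda>x. w x $ j * partial i \<phi> x)"
    if "\<phi> \<in> test_functions" for \<phi> i j n
    by (intro integrable_torus_continuous continuous_on_mult ucj wcj test_continuous test_partial that)+
  have mz: "mean_zero w"
  proof -
    have "(LINT x|torus. w x $ j) = 0" for j
    proof -
      have "(\<lambda>n. LINT x|torus. u (k n) x $ j * 1) \<longlonglongrightarrow> (LINT x|torus. w x $ j * 1)"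
        by (rule weak) (auto simp: periodic_def)
      then show ?thesis by (simp add: um LIMSEQ_const_iff)
    qed
    then show ?thesis unfolding mean_zero_def
      using vec_integral_component[OF integrable_torus_continuous[OF wc]] by (simp add: vec_eq_iff)
  qed
  have wd: "weak_div_free w"
    unfolding weak_div_free_def
  proof
    fix \<phi> assume p: "\<phi> \<in> test_functions"
    note pp = test_continuous[OF test_partial[OF p]] test_periodic[OF test_partial[OF p]]
    have "(LINT x|torus. u n x $ 1 * partial 1 \<phi> x + u n x $ 2 * partial 2 \<phi> x) = 0" for n
    proof -
      have "(LINT x|torus. u n x $ 1 * partial 1 \<phi> x + u n x $ 2 * partial 2 \<phi> x)
          = - (LINT x|torus. (D n 1 x $ 1 + D n 2 x $ 2) * \<phi> x)"
        using iup[OF p] iD[OF p] by (simp add: parts[OF p] distrib_right)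
      then show ?thesis by (simp add: udiv)
    qed
    moreover have "(\<lambda>n. LINT x|torus. u (k n) x $ 1 * partial 1 \<phi> x + u (k n) x $ 2 * partial 2 \<phi> x)
        \<longlonglongrightarrow> (LINT x|torus. w x $ 1 * partial 1 \<phi> x + w x $ 2 * partial 2 \<phi> x)"
      using iup[OF p] tendsto_add[OF weak[OF pp] weak[OF pp]] by simp
    ultimately show "(LINT x|torus. w x $ 1 * partial 1 \<phi> x + w x $ 2 * partial 2 \<phi> x) = 0"
      by (simp add: LIMSEQ_const_iff)
  qed
  have wcurl: "has_weak_curl w \<xi>"
    unfolding has_weak_curl_def
  proof
    fix \<phi> assume p: "\<phi> \<in> test_functions"
    note pp = test_continuous[OF test_partial[OF p]] test_periodic[OF test_partial[OF p]]
    let ?c = "\<lambda>n x. D n 2 x $ 1 - D n 1 x $ 2"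
    have eq: "(LINT x|torus. u n x $ 2 * partial 1 \<phi> x - u n x $ 1 * partial 2 \<phi> x) = - (LINT x|torus. ?c n x * \<phi> x)" for n
      using iup[OF p] iD[OF p] by (simp add: parts[OF p] left_diff_distrib)
    have ic: "integrable torus (?c n)" for n by (intro integrable_torus_continuous continuous_intros Dc)
    have i\<xi>n: "integrable torus (\<xi>n n)" for n by (intro integrable_torus_continuous C11_components(1)[OF C])
    have "(\<lambda>n. LINT x|torus. \<bar>?c n x - \<xi> x\<bar>) \<longlonglongrightarrow> 0"
    proof (rule Lim_null_comparison)
      show "\<forall>\<^sub>F n in sequentially. norm (LINT x|torus. \<bar>?c n x - \<xi> x\<bar>) \<le> 1 / Suc n + (LINT x|torus. \<bar>\<xi>n n x - \<xi> x\<bar>)"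
      proof (rule always_eventually, intro allI)
        fix n
        have "(LINT x|torus. \<bar>?c n x - \<xi> x\<bar>) \<le> (LINT x|torus. 1 / Suc n + \<bar>\<xi>n n x - \<xi> x\<bar>)"
        proof (rule integral_mono)
          show "\<bar>?c n x - \<xi> x\<bar> \<le> 1 / Suc n + \<bar>\<xi>n n x - \<xi> x\<bar>" for x
            using ucurl[where n=n and x=x] by linarith
        qed (use ic i\<xi> i\<xi>n in auto)
        also have "\<dots> = 1 / Suc n + (LINT x|torus. \<bar>\<xi>n n x - \<xi> x\<bar>)" using i\<xi> i\<xi>n by simp
        finally show "norm (LINT x|torus. \<bar>?c n x - \<xi> x\<bar>) \<le> 1 / Suc n + (LINT x|torus. \<bar>\<xi>n n x - \<xi> x\<bar>)" by simp
      qed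
      have "(\<lambda>n. LINT x|torus. \<bar>\<xi>n n x - \<xi> x\<bar>) \<longlonglongrightarrow> 0" unfolding \<xi>n_def by (rule conv_kern_tendsto_L1[OF i\<xi>])
      from tendsto_add[OF LIMSEQ_Suc[OF lim_1_over_n] this]
      show "(\<lambda>n. 1 / Suc n + (LINT x|torus. \<bar>\<xi>n n x - \<xi> x\<bar>)) \<longlonglongrightarrow> 0" by simp
    qed
    from LIMSEQ_subseq_LIMSEQ[OF L1_weak_limit[OF ic i\<xi> this test_continuous[OF p] test_periodic[OF p]] k]
    have "(\<lambda>n. LINT x|torus. ?c (k n) x * \<phi> x) \<longlonglongrightarrow> (LINT x|torus. \<xi> x * \<phi> x)" by (simp add: o_def)
    then have "(\<lambda>n. LINT x|torus. u (k n) x $ 2 * partial 1 \<phi> x - u (k n) x $ 1 * partial 2 \<phi> x) \<longlonglongrightarrow> - (LINT x|torus. \<xi> x * \<phi> x)"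
      unfolding eq by (rule tendsto_minus)
    moreover have "(\<lambda>n. LINT x|torus. u (k n) x $ 2 * partial 1 \<phi> x - u (k n) x $ 1 * partial 2 \<phi> x)
        \<longlonglongrightarrow> (LINT x|torus. w x $ 2 * partial 1 \<phi> x - w x $ 1 * partial 2 \<phi> x)"
      using iup[OF p] tendsto_diff[OF weak[OF pp] weak[OF pp]] by simp
    ultimately show "(LINT x|torus. w x $ 2 * partial 1 \<phi> x - w x $ 1 * partial 2 \<phi> x) = - (LINT x|torus. \<xi> x * \<phi> x)"
      using LIMSEQ_unique by blast
  qed
  have "approximable w L"
    unfolding approximable_def
  proof (intro allI impI)
    fix e :: real assume "e > 0"
    then obtain n where "\<forall>x. norm (u (k n) x - w x) < e"
      using eventually_happens'[OF sequentially_bot unifw] by blast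
    then show "\<exists>v D. (\<forall>j. C11 (\<lambda>x. v x $ j) (D j)) \<and> (\<forall>j x. norm (D j x) \<le> L) \<and> (\<forall>x. norm (v x - w x) < e)"
      using u DL by blast
  qed
  then show ?thesis using that wc wp mz wd wcurl L by blast
qed

text \<open>The difference between the representative chosen in \<open>biot_savart\<close> and the
  constructed field has zero mean, divergence and curl, so \<open>biot_savart_unique\<close> makes
  it vanish almost everywhere.\<close>

lemma biot_savart_continuous:
  assumes xi: "\<xi> \<in> W1p_torus 4 \<inter> E_space"
  obtains u L where "continuous_on UNIV u" "periodic u" "weak_div_free u"
    "L > 0" "approximable u L" "AE x in torus. biot_savart \<xi> x = u x"
proof -
  obtain u L where u: "continuous_on UNIV u" "periodic u" "mean_zero u" "weak_div_free u" "has_weak_curl u \<xi>"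
    "L > 0" "approximable u L" using biot_savart_exists[OF xi] by blast
  have "u \<in> Lp_torus 2"
    using u(1,2) continuous_torus_measurable[OF u(1)]
      integrable_torus_continuous[OF continuous_on_power[OF continuous_on_norm[OF u(1)]], of 2]
    unfolding Lp_torus_def by blast
  then have ex: "u \<in> Lp_torus 2 \<and> mean_zero u \<and> weak_div_free u \<and> has_weak_curl u \<xi>" using u by simp
  define b where "b = biot_savart \<xi>"
  have b: "b \<in> Lp_torus 2" "mean_zero b" "weak_div_free b" "has_weak_curl b \<xi>"
    using someI[of "\<lambda>u. u \<in> Lp_torus 2 \<and> mean_zero u \<and> weak_div_free u \<and> has_weak_curl u \<xi>", OF ex]
    unfolding b_def biot_savart_def by blast+
  have i: "integrable torus b" "integrable torus u"
    using b(1) ex by (auto intro: Lp_integrable[of _ 2])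
  note ij = vec_integrable_component[OF i(1)] vec_integrable_component[OF i(2)]
  have ip: "integrable torus (\<lambda>x. b x $ j * partial i \<phi> x)" "integrable torus (\<lambda>x. u x $ j * partial i \<phi> x)"
    if "\<phi> \<in> test_functions" for \<phi> i j
    using ij that by (auto intro!: integrable_mult_test test_continuous test_periodic test_partial)
  have "AE x in torus. b x - u x = 0"
  proof (rule biot_savart_unique)
    show "integrable torus (\<lambda>x. (b x - u x) $ j)" for j using ij by simp
    have "(LINT x|torus. b x $ j) = 0" "(LINT x|torus. u x $ j) = 0" for j
      using b(2) u(3) vec_integral_component[OF i(1), of j] vec_integral_component[OF i(2), of j]
      by (auto simp: mean_zero_def)
    then show "(LINT x|torus. (b x - u x) $ j) = 0" for j using ij by simp
    show "weak_div_free (\<lambda>x. b x - u x)"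
      unfolding weak_div_free_def
    proof
      fix \<phi> assume p: "\<phi> \<in> test_functions"
      have "(LINT x|torus. b x $ 1 * partial 1 \<phi> x + b x $ 2 * partial 2 \<phi> x) = 0"
           "(LINT x|torus. u x $ 1 * partial 1 \<phi> x + u x $ 2 * partial 2 \<phi> x) = 0"
        using b(3) u(4) p unfolding weak_div_free_def by blast+
      then show "(LINT x|torus. (b x - u x) $ 1 * partial 1 \<phi> x + (b x - u x) $ 2 * partial 2 \<phi> x) = 0"
        using ip[OF p] by (simp add: left_diff_distrib)
    qed
    show "has_weak_curl (\<lambda>x. b x - u x) (\<lambda>_. 0)"
      unfolding has_weak_curl_def
    proof
      fix \<phi> assume p: "\<phi> \<in> test_functions"
      have "(LINT x|torus. b x $ 2 * partial 1 \<phi> x - b x $ 1 * partial 2 \<phi> x) = - (LINT x|torus. \<xi> x * \<phi> x)"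
           "(LINT x|torus. u x $ 2 * partial 1 \<phi> x - u x $ 1 * partial 2 \<phi> x) = - (LINT x|torus. \<xi> x * \<phi> x)"
        using b(4) u(5) p unfolding has_weak_curl_def by blast+
      then show "(LINT x|torus. (b x - u x) $ 2 * partial 1 \<phi> x - (b x - u x) $ 1 * partial 2 \<phi> x) = - (LINT x|torus. 0 * \<phi> x)"
        using ip[OF p] by (simp add: left_diff_distrib)
    qed
  qed
  then have "AE x in torus. biot_savart \<xi> x = u x" by (simp add: b_def)
  then show ?thesis using that u by blast
qed

section \<open>The semi-discrete transport equation\<close>

text \<open>One explicit step backwards along the characteristics of u.\<close>

definition euler :: "real \<Rightarrow> (real^2 \<Rightarrow> real^2) \<Rightarrow> real^2 \<Rightarrow> real^2" where
  "euler h u x = x - h *\<^sub>R u x"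

text \<open>The chain rule for f(x - h u(x)): the transposed Jacobian of the step applied to G at
  the foot point, with \<open>D j\<close> in the role of the gradient of the component u_j.\<close>

definition pull_grad :: "real \<Rightarrow> (real^2 \<Rightarrow> real^2) \<Rightarrow> (2 \<Rightarrow> real^2 \<Rightarrow> real^2) \<Rightarrow> (real^2 \<Rightarrow> real^2) \<Rightarrow> real^2 \<Rightarrow> real^2" where
  "pull_grad h u D G x = G (euler h u x) - h *\<^sub>R (\<Sum>j\<in>UNIV. G (euler h u x) $ j *\<^sub>R D j x)"

locale velocity =
  fixes u :: "real^2 \<Rightarrow> real^2" and D :: "2 \<Rightarrow> real^2 \<Rightarrow> real^2" and L :: real
  assumes u: "\<And>j. C11 (\<lambda>x. u x $ j) (D j)" and D: "\<And>j x. norm (D j x) \<le> L" and L: "L > 0"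
begin

lemma u_periodic: "periodic u"
  using C11_components(2)[OF u] by (simp add: periodic_def vec_eq_iff)

lemma u_continuous: "continuous_on UNIV u"
  using continuous_on_vec_lambda[of UNIV "\<lambda>j x. u x $ j"] C11_components(1)[OF u] by simp

lemma u_lipschitz: "norm (u y - u x) \<le> 2 * (L * norm (y - x))"
  by (rule norm_vec2_le) (use gradient_lipschitz[OF C11_has_derivative[OF u] D] in simp)

lemma euler_diff: "0 \<le> h \<Longrightarrow> norm (euler h u (x + v) - euler h u x) \<le> (1 + 2 * (h * L)) * norm v"
proof -
  assume h: "0 \<le> h"
  have "euler h u (x + v) - euler h u x = v - h *\<^sub>R (u (x + v) - u x)"
    by (simp add: euler_def algebra_simps)
  also have "norm \<dots> \<le> norm v + h * norm (u (x + v) - u x)"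
    using norm_triangle_ineq4[of v "h *\<^sub>R (u (x + v) - u x)"] h by simp
  also have "\<dots> \<le> norm v + h * (2 * (L * norm v))"
    using u_lipschitz[of "x + v" x] h by (intro add_left_mono mult_left_mono) auto
  finally show ?thesis by (simp add: algebra_simps)
qed

lemma euler_continuous: "continuous_on UNIV (euler h u)"
  unfolding euler_def[abs_def] by (intro continuous_intros u_continuous)

lemma euler_shift: "k \<in> lattice \<Longrightarrow> euler h u (x + k) = euler h u x + k"
  using periodic_lattice[OF u_periodic] by (simp add: euler_def)

lemma periodic_euler: "periodic f \<Longrightarrow> periodic (\<lambda>x. f (euler h u x))"
  by (simp add: periodic_def euler_shift)

lemma euler_inj:
  assumes "0 \<le> h" "h * L \<le> 1/16" shows "inj (euler h u)"
proof (rule injI)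
  fix x y assume "euler h u x = euler h u y"
  then have "x - y = h *\<^sub>R (u x - u y)" by (simp add: euler_def algebra_simps)
  then have "norm (x - y) = h * norm (u x - u y)" using assms by simp
  also have "\<dots> \<le> h * (2 * (L * norm (x - y)))"
    using u_lipschitz[of x y] assms by (intro mult_left_mono) auto
  also have "\<dots> = 2 * (h * L) * norm (x - y)" by simp
  also have "\<dots> \<le> 1/8 * norm (x - y)" using assms by (intro mult_right_mono) auto
  finally show "x = y" by simp
qed

lemma euler_has_derivative:
  "(euler h u has_derivative (\<lambda>v. v - h *\<^sub>R (\<chi> j. D j x \<bullet> v))) (at x within S)"
proof -
  have "(u has_derivative (\<lambda>v. \<chi> j. D j x \<bullet> v)) (at x)"
    unfolding has_derivative_componentwise_within[of u]
    using C11_has_derivative[OF u] by (auto simp: Basis_vec_def inner_axis)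
  then have "(euler h u has_derivative (\<lambda>v. v - h *\<^sub>R (\<chi> j. D j x \<bullet> v))) (at x)"
    unfolding euler_def[abs_def] by (auto intro!: derivative_eq_intros)
  then show ?thesis by (rule has_derivative_at_withinI)
qed

text \<open>The entries of h Du have size at most y = h L, so the determinant is at least (1 - y)^2
  - y^2, and the squares cancel.\<close>

lemma euler_det:
  assumes "0 \<le> h" "h * L \<le> 1/16"
  shows "det (matrix (\<lambda>v. v - h *\<^sub>R (\<chi> j. D j x \<bullet> v))) \<ge> 1 - 2 * (h * L)"
proof -
  let ?m = "\<lambda>i j. h * D i x $ j"
  have m: "\<bar>?m i j\<bar> \<le> h * L" for i j
    using component_le_norm_cart[of "D i x" j] D[of i x] assms
    by (simp add: abs_mult mult_left_mono)
  have "(1 - ?m 1 1) * (1 - ?m 2 2) \<ge> (1 - h * L) * (1 - h * L)"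
    using m[of 1 1] m[of 2 2] assms by (intro mult_mono) (auto simp: abs_le_iff)
  moreover have "\<bar>?m 1 2 * ?m 2 1\<bar> \<le> (h * L) * (h * L)"
    unfolding abs_mult[of "?m 1 2"] using m[of 1 2] m[of 2 1] by (intro mult_mono) auto
  moreover have "det (matrix (\<lambda>v. v - h *\<^sub>R (\<chi> j. D j x \<bullet> v))) = (1 - ?m 1 1) * (1 - ?m 2 2) - ?m 1 2 * ?m 2 1"
    by (simp add: det_2 matrix_def axis_def[of _ "1::real"] inner_vec_def sum_2)
  ultimately show ?thesis by (simp add: algebra_simps abs_le_iff)
qed

text \<open>The step commutes with lattice translations and is injective, so the image of the open
  cell meets each lattice orbit at most once. Change of variables on the cell and the packing
  inequality for the image give the bound.\<close>

lemma euler_integral: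
  assumes F: "continuous_on UNIV F" "periodic F" "\<And>x. F x \<ge> 0" and h: "0 \<le> h" "h * L \<le> 1/16"
  shows "(1 - 2 * (h * L)) * (LINT x|torus. F (euler h u x)) \<le> (LINT x|torus. F x)"
proof -
  let ?Y = "euler h u" and ?S = "box 0 (1::real^2)"
  let ?g = "\<lambda>x v. v - h *\<^sub>R (\<chi> j. D j x \<bullet> v)"
  have [measurable]: "F \<in> borel_measurable borel" using F(1) by (rule borel_measurable_continuous_onI)
  have inj: "inj_on ?Y ?S" using euler_inj[OF h] by (rule inj_on_subset) simp
  \<comment> \<open>Invariance of domain; openness makes the image a Borel set, as the packing
    inequality asks.\<close>
  have op: "open (?Y ` ?S)"
    by (rule invariance_of_domain) (use inj euler_continuous in \<open>auto intro: continuous_on_subset\<close>)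
  then have [measurable]: "?Y ` ?S \<in> sets borel" by simp
  have "compact (?Y ` cbox 0 1)"
    using euler_continuous by (intro compact_continuous_image) (auto intro: continuous_on_subset)
  then have "bounded (?Y ` ?S)" using box_subset_cbox by (meson bounded_subset compact_imp_bounded image_mono)
  then obtain a where a: "?Y ` ?S \<subseteq> cbox (-a) a" using bounded_subset_cbox_symmetric by metis
  have FY: "set_integrable lborel (?Y ` ?S) F"
  proof (rule set_integrable_subset[OF _ _ a])
    show "set_integrable lborel (cbox (-a) a) F"
      using borel_set_integrable_continuous[OF compact_cbox F(1)] by (simp add: set_integrable_def)
  qed simp
  have abs: "F absolutely_integrable_on (?Y ` ?S)"
    using FY by (simp add: set_integrable_def integrable_completion)
  have S: "?S \<in> sets lebesgue" by simp
  note cov = change_of_variables_real[OF S euler_has_derivative inj abs]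
  have FYc: "continuous_on UNIV (\<lambda>x. F (?Y x))" by (rule continuous_on_compose2[OF F(1) euler_continuous]) auto
  have iFY: "(\<lambda>x. F (?Y x)) integrable_on ?S"
    using integrable_on_open_interval[of "\<lambda>x. F (?Y x)" 0 1] integrable_continuous[of 0 1 "\<lambda>x. F (?Y x)"]
      continuous_on_subset[OF FYc] by blast
  have "(LINT x|torus. F (?Y x)) = integral (cbox 0 1) (\<lambda>x. F (?Y x))"
    using integrable_torus_continuous[OF FYc] unfolding torus_def by (intro lebesgue_integral_eq_integral) auto
  also have "\<dots> = integral ?S (\<lambda>x. F (?Y x))" by (rule integral_open_interval[symmetric])
  finally have "(1 - 2 * (h * L)) * (LINT x|torus. F (?Y x)) = integral ?S (\<lambda>x. (1 - 2 * (h * L)) * F (?Y x))"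
    by simp
  also have "\<dots> \<le> integral ?S (\<lambda>x. \<bar>det (matrix (?g x))\<bar> * F (?Y x))"
  proof (rule integral_le)
    show "(\<lambda>x. (1 - 2 * (h * L)) * F (?Y x)) integrable_on ?S"
      using iFY by (rule integrable_on_mult_right)
    show "(\<lambda>x. \<bar>det (matrix (?g x))\<bar> * F (?Y x)) integrable_on ?S"
      using cov(1) by (simp add: absolutely_integrable_on_def)
    show "(1 - 2 * (h * L)) * F (?Y x) \<le> \<bar>det (matrix (?g x))\<bar> * F (?Y x)" for x
      using euler_det[OF h, of x] F(3) by (intro mult_right_mono) auto
  qed
  also have "\<dots> = integral (?Y ` ?S) F" by (rule cov(2))
  also have "\<dots> = (LINT x|lborel. indicator (?Y ` ?S) x * F x)"
    using set_borel_integral_eq_integral(2)[OF FY] by (simp add: set_lebesgue_integral_def)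
  also have "\<dots> \<le> (LINT x|torus. F x)"
  proof -
    have "ennreal (LINT x|lborel. indicator (?Y ` ?S) x * F x) = (\<integral>\<^sup>+x. ennreal (indicator (?Y ` ?S) x * F x) \<partial>lborel)"
      using FY F(3) by (intro nn_integral_eq_integral[symmetric]) (auto simp: set_integrable_def)
    also have "\<dots> = (\<integral>\<^sup>+x. ennreal (F x) * indicator (?Y ` ?S) x \<partial>lborel)"
      by (intro nn_integral_cong) (auto simp: indicator_def)
    also have "\<dots> \<le> (\<integral>\<^sup>+x. ennreal (F x) \<partial>torus)"
    proof (rule packing_nn_integral_le)
      fix y k assume y: "y \<in> ?Y ` ?S" and k: "k \<in> lattice" and yk: "y + k \<in> ?Y ` ?S"
      obtain p q where pq: "p \<in> ?S" "y = ?Y p" "q \<in> ?S" "y + k = ?Y q" using y yk by blast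
      then have "?Y (p + k) = ?Y q" using euler_shift[OF k] by simp
      then have "p + k = q" using euler_inj[OF h] by (rule injD[rotated])
      moreover have "?S \<subseteq> unit_cell" by (auto simp: unit_cell_def mem_box_cart less_imp_le)
      ultimately show "k = 0" using cell_packing[of p 0 k] pq k by auto
    qed (use F(2) in \<open>auto simp: periodic_def\<close>)
    also have "\<dots> = ennreal (LINT x|torus. F x)"
      using F by (intro nn_integral_eq_integral integrable_torus_continuous) auto
    finally show ?thesis using F(3) by (subst (asm) ennreal_le_iff) auto
  qed
  finally show ?thesis .
qed

lemma sum_grad_norm: "norm (\<Sum>j\<in>UNIV. g $ j *\<^sub>R D j x) \<le> 2 * (L * norm g)" for g :: "real^2"
proof -
  have "norm (\<Sum>j\<in>UNIV. g $ j *\<^sub>R D j x) \<le> (\<Sum>j\<in>UNIV. \<bar>g $ j\<bar> * norm (D j x))"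
    by (rule order_trans[OF norm_sum]) simp
  also have "\<dots> \<le> (\<Sum>j\<in>(UNIV :: 2 set). norm g * L)"
    using D component_le_norm_cart[of g] by (intro sum_mono mult_mono) auto
  finally show ?thesis by (simp add: mult.commute)
qed

lemma pull_grad_norm: "0 \<le> h \<Longrightarrow> norm (pull_grad h u D G x) \<le> (1 + 2 * (h * L)) * norm (G (euler h u x))"
proof -
  assume h: "0 \<le> h"
  let ?g = "G (euler h u x)"
  have "norm (pull_grad h u D G x) \<le> norm ?g + h * norm (\<Sum>j\<in>UNIV. ?g $ j *\<^sub>R D j x)"
    unfolding pull_grad_def using norm_triangle_ineq4[of ?g "h *\<^sub>R (\<Sum>j\<in>UNIV. ?g $ j *\<^sub>R D j x)"] h by simp
  also have "\<dots> \<le> norm ?g + h * (2 * (L * norm ?g))"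
    using sum_grad_norm h by (intro add_left_mono mult_left_mono) auto
  finally show ?thesis by (simp add: algebra_simps)
qed

lemma pull_continuous:
  assumes "continuous_on UNIV G" shows "continuous_on UNIV (pull_grad h u D G)"
  using u unfolding pull_grad_def[abs_def] C11_def
  by (intro continuous_intros continuous_on_compose2[OF assms euler_continuous]) auto

lemma pull_periodic:
  assumes "periodic G" shows "periodic (pull_grad h u D G)"
  using u periodic_euler[OF assms] by (simp add: pull_grad_def periodic_def C11_def)

text \<open>Two errors add up: the remainder of f for the displacement of the foot points, and the
  gradient of f against the remainder of h u. The second carries a factor h, which is what keeps the
  constants bounded when the step is repeated any number of times.\<close>

lemma pull_taylor:
  assumes f: "taylor M f G" and S: "\<And>x. norm (G x) \<le> S" and K: "\<And>j. taylor K (\<lambda>x. u x $ j) (D j)" and h: "0 \<le> h"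
  shows "taylor (M * (1 + 2 * (h * L))\<^sup>2 + 2 * S * h * K) (\<lambda>x. f (euler h u x)) (pull_grad h u D G)"
  unfolding taylor_def
proof (intro allI)
  fix x v
  let ?Y = "euler h u"
  let ?w = "?Y (x + v) - ?Y x" and ?g = "G (?Y x)"
  let ?r = "\<lambda>j. u (x + v) $ j - u x $ j - D j x \<bullet> v"
  have S0: "S \<ge> 0" using S[of 0] norm_ge_zero order_trans by blast
  have "\<bar>f (?Y x + ?w) - f (?Y x) - ?g \<bullet> ?w\<bar> \<le> M * (norm ?w)\<^sup>2" by (rule taylorD[OF f])
  also have "\<dots> \<le> M * ((1 + 2 * (h * L)) * norm v)\<^sup>2"
    using euler_diff[OF h, of x v] taylor_nonneg[OF f] by (intro mult_left_mono power_mono) auto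
  finally have 1: "\<bar>f (?Y (x + v)) - f (?Y x) - ?g \<bullet> ?w\<bar> \<le> M * (1 + 2 * (h * L))\<^sup>2 * (norm v)\<^sup>2"
    by (simp add: power_mult_distrib mult.assoc)
  have r: "\<bar>?g $ j * ?r j\<bar> \<le> S * (K * (norm v)\<^sup>2)" for j
    unfolding abs_mult using taylorD[OF K, of x v j] component_le_norm_cart[of ?g j] S[of "?Y x"] S0
    by (intro mult_mono) auto
  have "?g \<bullet> ?w - pull_grad h u D G x \<bullet> v = - h * (?g $ 1 * ?r 1 + ?g $ 2 * ?r 2)"
    by (simp add: pull_grad_def euler_def inner_vec_def sum_2 algebra_simps)
  then have "\<bar>?g \<bullet> ?w - pull_grad h u D G x \<bullet> v\<bar> = h * \<bar>?g $ 1 * ?r 1 + ?g $ 2 * ?r 2\<bar>"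
    using h by (simp add: abs_mult)
  also have "\<dots> \<le> h * (2 * (S * (K * (norm v)\<^sup>2)))"
    using r[of 1] r[of 2] h by (intro mult_left_mono) linarith+
  also have "\<dots> = 2 * S * h * K * (norm v)\<^sup>2" by simp
  finally show "\<bar>f (?Y (x + v)) - f (?Y x) - pull_grad h u D G x \<bullet> v\<bar>
      \<le> (M * (1 + 2 * (h * L))\<^sup>2 + 2 * S * h * K) * (norm v)\<^sup>2"
    using 1 by (simp only: distrib_right)
qed

end

section \<open>Iterates of the averaging map\<close>

lemma weighted_mean_eq: "(h / (h + t)) * p + (t / (h + t)) * q = (h * p + t * q) / (h + t)" for h :: real
  by (simp add: add_divide_distrib)

text \<open>With y = h L the left side is the growth in one step of fourth powers of gradient
  lengths, and 1 - 2 y bounds the Jacobian from below. The linear surplus 54 y outweighs all higher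
  powers for y \<le> 1/16.\<close>

lemma power4_ratio:
  fixes y :: real
  assumes "0 \<le> y" "y \<le> 1/16" shows "(1 + 2*y)^4 \<le> (1 + 64*y) * (1 - 2*y)"
proof -
  have "y^2 \<le> y * (1/16)" unfolding power2_eq_square using assms by (intro mult_left_mono) auto
  moreover have "y^3 \<le> y * (1/16)^2"
  proof -
    have "y * y^2 \<le> y * (1/16)^2" using assms by (intro mult_left_mono power_mono) auto
    then show ?thesis by (simp add: power3_eq_cube power2_eq_square)
  qed
  moreover have "y^4 \<le> y * (1/16)^3"
  proof -
    have "y * y^3 \<le> y * (1/16)^3" using assms by (intro mult_left_mono power_mono) auto
    then show ?thesis by (simp add: power3_eq_cube power4_eq_xxxx)
  qed
  moreover have "(1 + 64*y) * (1 - 2*y) - (1 + 2*y)^4 = 54 * y - 152 * y^2 - 32 * y^3 - 16 * y^4"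
    by algebra
  moreover have "y * (1/16)^2 = y / 256" "y * (1/16)^3 = y / 4096" by (simp_all add: power_divide)
  ultimately show ?thesis using assms by linarith
qed

text \<open>The difference scheme f + \<tau> (f - f o Y) / h = \<xi>, with Y the backward step,
  becomes f = (h \<xi> + \<tau> f o Y) / (h + \<tau>) when solved for its first f; these are the
  Picard iterates started at \<xi>.\<close>

primrec euler_iter :: "real \<Rightarrow> real \<Rightarrow> (real^2 \<Rightarrow> real^2) \<Rightarrow> (real^2 \<Rightarrow> real) \<Rightarrow> nat \<Rightarrow> real^2 \<Rightarrow> real" where
  "euler_iter h \<tau> u \<xi> 0 = \<xi>"
| "euler_iter h \<tau> u \<xi> (Suc n) = (\<lambda>x. (h / (h + \<tau>)) * \<xi> x + (\<tau> / (h + \<tau>)) * euler_iter h \<tau> u \<xi> n (euler h u x))"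

primrec euler_iter_grad :: "real \<Rightarrow> real \<Rightarrow> (real^2 \<Rightarrow> real^2) \<Rightarrow> (2 \<Rightarrow> real^2 \<Rightarrow> real^2) \<Rightarrow> (real^2 \<Rightarrow> real^2) \<Rightarrow> nat \<Rightarrow> real^2 \<Rightarrow> real^2" where
  "euler_iter_grad h \<tau> u D X 0 = X"
| "euler_iter_grad h \<tau> u D X (Suc n) = (\<lambda>x. (h / (h + \<tau>)) *\<^sub>R X x + (\<tau> / (h + \<tau>)) *\<^sub>R pull_grad h u D (euler_iter_grad h \<tau> u D X n) x)"

locale transport = velocity +
  fixes \<xi> :: "real^2 \<Rightarrow> real" and X :: "real^2 \<Rightarrow> real^2" and \<tau> :: real
  assumes X: "C11 \<xi> X" and tau: "\<tau> > 0" "128 * (\<tau> * L) \<le> 1"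
begin

abbreviation "\<eta> h \<equiv> euler_iter h \<tau> u \<xi>"
abbreviation "\<Gamma> h \<equiv> euler_iter_grad h \<tau> u D X"

lemma euler_iter_continuous: "continuous_on UNIV (\<eta> h n)" "continuous_on UNIV (\<Gamma> h n)"
proof (induction n)
  case 0
  { case 1 show ?case using X by (simp add: C11_def) }
  { case 2 show ?case using X by (simp add: C11_def) }
next
  case (Suc n)
  { case 1 show ?case using X Suc(1) unfolding euler_iter.simps C11_def
      by (intro continuous_intros continuous_on_compose2[OF Suc(1) euler_continuous]) auto }
  { case 2 show ?case using X unfolding euler_iter_grad.simps C11_def
      by (intro continuous_intros pull_continuous Suc) auto }
qed

lemma euler_iter_periodic: "periodic (\<eta> h n)" "periodic (\<Gamma> h n)"
proof (induction n)
  case 0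
  { case 1 show ?case using X by (simp add: C11_def) }
  { case 2 show ?case using X by (simp add: C11_def) }
next
  case (Suc n)
  { case 1 show ?case using X periodic_euler[OF Suc(1)] by (simp add: periodic_def C11_def) }
  { case 2 show ?case using X pull_periodic[OF Suc(2)] by (simp add: periodic_def C11_def) }
qed

text \<open>A step stretches the bounds by 1 + O(h L) and so contributes an excess of order h \<tau>
  L, while the data enter with weight h. Smallness of \<tau> L therefore closes the induction,
  uniformly in n.\<close>

lemma euler_iter_taylor:
  assumes h: "0 < h" "h * L \<le> 1/16" and S: "\<And>x. norm (X x) \<le> S" and M: "taylor M \<xi> X"
    and K: "\<And>j. taylor K (\<lambda>x. u x $ j) (D j)"
  shows "norm (\<Gamma> h n x) \<le> 2 * S \<and> taylor (2 * (M + 4 * \<tau> * S * K)) (\<eta> h n) (\<Gamma> h n)"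
proof (induction n arbitrary: x)
  case 0
  have S0: "S \<ge> 0" using S[of 0] norm_ge_zero order_trans by blast
  have "M \<ge> 0" "K \<ge> 0" using M K taylor_nonneg by auto
  then have "4 * \<tau> * S * K \<ge> 0" using tau S0 by simp
  then have "M \<le> 2 * (M + 4 * \<tau> * S * K)" using \<open>M \<ge> 0\<close> by simp
  then show ?case using taylor_mono[OF M] S[of x] S0 by simp
next
  case (Suc n)
  have S0: "S \<ge> 0" using S[of 0] norm_ge_zero order_trans by blast
  have K0: "K \<ge> 0" "M \<ge> 0" using M K taylor_nonneg by auto
  define a b where "a = h / (h + \<tau>)" and "b = \<tau> / (h + \<tau>)"
  have ab: "a \<ge> 0" "b \<ge> 0" using h tau by (auto simp: a_def b_def)
  have ht: "h + \<tau> > 0" using h tau by simp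
  \<comment> \<open>In one step the source 4 S h K from \<open>pull_taylor\<close> has weight \<tau>
    / (h + \<tau>) and M has weight h / (h + \<tau>); together they act like data of size M + 4
    \<tau> S K. P is twice that size.\<close>
  define P where "P = 2 * (M + 4 * \<tau> * S * K)"
  have P: "P \<ge> 0" "M + 4 * \<tau> * S * K = P / 2" using S0 K0 tau by (auto simp: P_def)
  have tl: "\<tau> * L \<le> 1/128" using tau by simp
  have "norm (\<Gamma> h (Suc n) x) \<le> a * S + b * ((1 + 2 * (h * L)) * (2 * S))"
  proof -
    have "norm (\<Gamma> h (Suc n) x) \<le> a * norm (X x) + b * norm (pull_grad h u D (\<Gamma> h n) x)"
      using norm_triangle_ineq[of "a *\<^sub>R X x" "b *\<^sub>R pull_grad h u D (\<Gamma> h n) x"] ab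
      by (simp add: a_def[symmetric] b_def[symmetric])
    also have "\<dots> \<le> a * S + b * ((1 + 2 * (h * L)) * norm (\<Gamma> h n (euler h u x)))"
      using S ab pull_grad_norm[of h "\<Gamma> h n" x] h by (intro add_mono mult_left_mono) auto
    also have "\<dots> \<le> a * S + b * ((1 + 2 * (h * L)) * (2 * S))"
      using Suc ab h L by (intro add_left_mono mult_left_mono) auto
    finally show ?thesis .
  qed
  also have "\<dots> = (h * S + 2 * \<tau> * S + 4 * (\<tau> * L) * (h * S)) / (h + \<tau>)"
    unfolding a_def b_def weighted_mean_eq by (simp add: algebra_simps)
  also have "\<dots> \<le> (h * S + 2 * \<tau> * S + 4 * (1/128) * (h * S)) / (h + \<tau>)"
    using tl S0 h ht by (intro divide_right_mono add_left_mono mult_right_mono mult_left_mono) auto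
  also have "\<dots> \<le> ((h + \<tau>) * (2 * S)) / (h + \<tau>)"
    using h S0 ht by (intro divide_right_mono) (auto simp: algebra_simps)
  also have "\<dots> = 2 * S" using ht by simp
  finally have 1: "norm (\<Gamma> h (Suc n) x) \<le> 2 * S" .
  have "taylor (\<bar>a\<bar> * M + \<bar>b\<bar> * (P * (1 + 2 * (h * L))\<^sup>2 + 2 * (2 * S) * h * K)) (\<eta> h (Suc n)) (\<Gamma> h (Suc n))"
    unfolding euler_iter.simps euler_iter_grad.simps a_def b_def
    by (rule taylor_lincomb[OF M pull_taylor]) (use Suc K h P_def in auto)
  moreover have "\<bar>a\<bar> * M + \<bar>b\<bar> * (P * (1 + 2 * (h * L))\<^sup>2 + 2 * (2 * S) * h * K) \<le> P"
  proof -
    have q: "(1 + 2 * (h * L))\<^sup>2 \<le> 1 + 5 * (h * L)"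
    proof -
      have "(h * L) * (h * L) \<le> (h * L) * (1/16)" using h L by (intro mult_left_mono) auto
      then show ?thesis using h L by (simp add: power2_eq_square algebra_simps)
    qed
    have "\<bar>a\<bar> * M + \<bar>b\<bar> * (P * (1 + 2 * (h * L))\<^sup>2 + 2 * (2 * S) * h * K)
        \<le> a * M + b * (P * (1 + 5 * (h * L)) + 2 * (2 * S) * h * K)"
    proof -
      have "P * (1 + 2 * (h * L))\<^sup>2 + 2 * (2 * S) * h * K \<le> P * (1 + 5 * (h * L)) + 2 * (2 * S) * h * K"
        using mult_left_mono[OF q P(1)] by simp
      from mult_left_mono[OF this ab(2)] show ?thesis using ab by (simp only: abs_of_nonneg add_left_mono)
    qed
    also have "\<dots> = (h * (M + 4 * \<tau> * S * K) + \<tau> * P + 5 * (\<tau> * L) * (h * P)) / (h + \<tau>)"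
      unfolding a_def b_def weighted_mean_eq by (simp add: algebra_simps)
    also have "\<dots> \<le> (h * (P / 2) + \<tau> * P + 5 * (1/128) * (h * P)) / (h + \<tau>)"
      unfolding P(2) using tl P h ht by (intro divide_right_mono add_left_mono mult_right_mono mult_left_mono) auto
    also have "\<dots> \<le> ((h + \<tau>) * P) / (h + \<tau>)"
      using h P ht by (intro divide_right_mono) (auto simp: algebra_simps)
    finally show ?thesis using ht by simp
  qed
  ultimately have "taylor P (\<eta> h (Suc n)) (\<Gamma> h (Suc n))" by (rule taylor_mono)
  then show ?case using 1 by (simp only: P_def)
qed

text \<open>The induction step shared by values and gradients. With J the integral of g, the bound 2
  J reproduces itself because the excess 128 \<tau> L h J is at most h J, the room left by the
  data.\<close>

lemma euler_iter_L4_aux: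
  assumes h: "0 < h" "h * L \<le> 1/16"
    and f: "continuous_on UNIV f" "periodic f" "\<And>x. f x \<ge> 0"
    and g: "continuous_on UNIV g"
    and k: "continuous_on UNIV k" "\<And>x. k x \<le> (h / (h + \<tau>)) * g x + (\<tau> / (h + \<tau>)) * ((1 + 2 * (h * L))^4 * f (euler h u x))"
    and I: "(LINT x|torus. f x) \<le> 2 * (LINT x|torus. g x)" and g0: "(LINT x|torus. g x) \<ge> 0"
  shows "(LINT x|torus. k x) \<le> 2 * (LINT x|torus. g x)"
proof -
  define J where "J = (LINT x|torus. g x)"
  define y where "y = h * L"
  have y: "0 \<le> y" "y \<le> 1/16" using h L by (auto simp: y_def)
  have ht: "h + \<tau> > 0" using h tau by simp
  let ?F = "LINT x|torus. f (euler h u x)"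
  have fY: "continuous_on UNIV (\<lambda>x. f (euler h u x))" by (rule continuous_on_compose2[OF f(1) euler_continuous]) auto
  have "(1 - 2 * y) * ?F \<le> 2 * J"
    using euler_integral[OF f _ h(2)] h I by (simp add: y_def J_def)
  then have "(1 + 64 * y) * ((1 - 2 * y) * ?F) \<le> (1 + 64 * y) * (2 * J)"
    using y by (intro mult_left_mono) auto
  moreover have "(1 + 2 * y)^4 * ?F \<le> (1 + 64 * y) * (1 - 2 * y) * ?F"
    using power4_ratio[OF y] f(3) by (intro mult_right_mono) auto
  ultimately have F: "(1 + 2 * y)^4 * ?F \<le> (1 + 64 * y) * (2 * J)" by (simp add: mult.assoc)
  have i: "integrable torus g" "integrable torus (\<lambda>x. f (euler h u x))" "integrable torus k"
    using g fY k(1) by (auto intro: integrable_torus_continuous)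
  have "(LINT x|torus. k x) \<le> (LINT x|torus. (h / (h + \<tau>)) * g x + (\<tau> / (h + \<tau>)) * ((1 + 2 * (h * L))^4 * f (euler h u x)))"
    using i k(2) by (intro integral_mono) auto
  also have "\<dots> = (h / (h + \<tau>)) * J + (\<tau> / (h + \<tau>)) * ((1 + 2 * y)^4 * ?F)"
    using i by (simp add: J_def y_def)
  also have "\<dots> \<le> (h / (h + \<tau>)) * J + (\<tau> / (h + \<tau>)) * ((1 + 64 * y) * (2 * J))"
    using F tau ht by (intro add_left_mono mult_left_mono) auto
  also have "\<dots> = (h * J + 2 * \<tau> * J + (128 * (\<tau> * L)) * (h * J)) / (h + \<tau>)"
    unfolding weighted_mean_eq by (simp add: y_def algebra_simps)
  also have "\<dots> \<le> (h * J + 2 * \<tau> * J + 1 * (h * J)) / (h + \<tau>)"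
    using tau h g0 ht by (intro divide_right_mono add_left_mono mult_right_mono) (auto simp: J_def)
  also have "\<dots> = 2 * J" using ht by (simp add: field_simps)
  finally show ?thesis by (simp add: J_def)
qed

lemma euler_iter_L4:
  assumes h: "0 < h" "h * L \<le> 1/16"
  shows "(LINT x|torus. \<eta> h n x ^ 4) \<le> 2 * (LINT x|torus. \<xi> x ^ 4)"
proof (induction n)
  case 0
  show ?case by simp
next
  case (Suc n)
  show ?case
  proof (rule euler_iter_L4_aux[OF h, of "\<lambda>x. \<eta> h n x ^ 4"])
    fix x
    \<comment> \<open>Values are not stretched by the composition; the factor is inserted to match
      the common induction step.\<close>
    have y: "1 \<le> (1 + 2 * (h * L))^4" using h L by (intro one_le_power) simp
    have "\<eta> h (Suc n) x ^ 4 \<le> (h / (h + \<tau>)) * \<xi> x ^ 4 + (\<tau> / (h + \<tau>)) * \<eta> h n (euler h u x) ^ 4"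
      unfolding euler_iter.simps using h tau by (intro power4_jensen2) (auto simp: add_divide_distrib[symmetric])
    also have "\<dots> \<le> (h / (h + \<tau>)) * \<xi> x ^ 4 + (\<tau> / (h + \<tau>)) * ((1 + 2 * (h * L))^4 * \<eta> h n (euler h u x) ^ 4)"
      using h tau mult_right_mono[OF y, of "\<eta> h n (euler h u x) ^ 4"] by (intro add_left_mono mult_left_mono) auto
    finally show "\<eta> h (Suc n) x ^ 4 \<le> \<dots>" .
  qed (use Suc X euler_iter_continuous euler_iter_periodic in \<open>auto intro!: continuous_intros simp: C11_def periodic_def simp del: euler_iter.simps\<close>)
qed

lemma euler_iter_grad_L4:
  assumes h: "0 < h" "h * L \<le> 1/16"
  shows "(LINT x|torus. norm (\<Gamma> h n x) ^ 4) \<le> 2 * (LINT x|torus. norm (X x) ^ 4)"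
proof (induction n)
  case 0
  show ?case by simp
next
  case (Suc n)
  show ?case
  proof (rule euler_iter_L4_aux[OF h, of "\<lambda>x. norm (\<Gamma> h n x) ^ 4"])
    fix x
    let ?a = "h / (h + \<tau>)" and ?b = "\<tau> / (h + \<tau>)"
    let ?p = "(1 + 2 * (h * L)) * norm (\<Gamma> h n (euler h u x))"
    have ab: "?a \<ge> 0" "?b \<ge> 0" "?a + ?b = 1" using h tau by (auto simp: add_divide_distrib[symmetric])
    have "norm (\<Gamma> h (Suc n) x) \<le> norm (?a *\<^sub>R X x) + norm (?b *\<^sub>R pull_grad h u D (\<Gamma> h n) x)"
      unfolding euler_iter_grad.simps by (rule norm_triangle_ineq)
    also have "\<dots> = ?a * norm (X x) + ?b * norm (pull_grad h u D (\<Gamma> h n) x)"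
      using ab(1,2) by (simp only: norm_scaleR abs_of_nonneg)
    also have "\<dots> \<le> ?a * norm (X x) + ?b * ?p"
      using ab h pull_grad_norm[of h "\<Gamma> h n" x] by (intro add_left_mono mult_left_mono) auto
    finally have "norm (\<Gamma> h (Suc n) x) ^ 4 \<le> (?a * norm (X x) + ?b * ?p)^4" by (rule power_mono) simp
    also have "\<dots> \<le> ?a * norm (X x) ^ 4 + ?b * ?p ^ 4" by (rule power4_jensen2[OF ab])
    finally show "norm (\<Gamma> h (Suc n) x) ^ 4 \<le> ?a * norm (X x) ^ 4 + ?b * ((1 + 2 * (h * L))^4 * norm (\<Gamma> h n (euler h u x)) ^ 4)"
      by (simp only: power_mult_distrib)
  qed (use Suc X euler_iter_continuous euler_iter_periodic in \<open>auto intro!: continuous_intros simp: C11_def periodic_def simp del: euler_iter_grad.simps\<close>)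
qed

text \<open>Composition with the step does not increase the supremum, so the averaging map contracts
  by \<tau> / (h + \<tau>). This ratio tends to 1 as h tends to 0, hence h is fixed before n in
  \<open>approximate_solution\<close>.\<close>

lemma euler_iter_step:
  assumes h: "0 < h" and S: "\<And>x. \<bar>\<xi> x\<bar> \<le> S"
  shows "\<bar>\<eta> h (Suc n) x - \<eta> h n x\<bar> \<le> (\<tau> / (h + \<tau>)) ^ n * (2 * S)"
proof (induction n arbitrary: x)
  case 0
  let ?a = "h / (h + \<tau>)" and ?b = "\<tau> / (h + \<tau>)"
  have ab: "?a \<ge> 0" "?b \<ge> 0" "?a + ?b = 1" using h tau by (auto simp: add_divide_distrib[symmetric])
  have S0: "S \<ge> 0" using S[of 0] by linarith
  have b1: "?b \<le> 1" using ab by linarith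
  have "\<eta> h (Suc 0) x - \<eta> h 0 x = ?b * (\<xi> (euler h u x) - \<xi> x) + (?a + ?b - 1) * \<xi> x"
    by (simp add: algebra_simps)
  also have "\<dots> = ?b * (\<xi> (euler h u x) - \<xi> x)" by (simp only: ab(3)) simp
  also have "\<bar>\<dots>\<bar> \<le> 1 * (2 * S)"
    unfolding abs_mult abs_of_nonneg[OF ab(2)] using ab b1 S[of x] S[of "euler h u x"] by (intro mult_mono) auto
  finally show ?case by simp
next
  case (Suc n)
  have b: "\<tau> / (h + \<tau>) \<ge> 0" using h tau by simp
  have "\<eta> h (Suc (Suc n)) x - \<eta> h (Suc n) x = (\<tau> / (h + \<tau>)) * (\<eta> h (Suc n) (euler h u x) - \<eta> h n (euler h u x))"
    by (subst (1 2) euler_iter.simps(2)) (simp add: right_diff_distrib)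
  also have "\<bar>\<dots>\<bar> = (\<tau> / (h + \<tau>)) * \<bar>\<eta> h (Suc n) (euler h u x) - \<eta> h n (euler h u x)\<bar>"
    using b by (simp only: abs_mult abs_of_nonneg)
  also have "\<dots> \<le> (\<tau> / (h + \<tau>)) * ((\<tau> / (h + \<tau>)) ^ n * (2 * S))"
    using b Suc by (intro mult_left_mono) auto
  finally show ?case by (simp only: power_Suc mult.assoc)
qed

lemma approximate_solution:
  assumes e: "e > 0"
  obtains f F where "C11 f F" "\<And>x. \<bar>f x + \<tau> * (u x \<bullet> F x) - \<xi> x\<bar> \<le> e"
    "(LINT x|torus. f x ^ 4) \<le> 2 * (LINT x|torus. \<xi> x ^ 4)"
    "(LINT x|torus. norm (F x) ^ 4) \<le> 2 * (LINT x|torus. norm (X x) ^ 4)"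
proof -
  obtain S where S: "\<And>x. norm (X x) \<le> S" using periodic_bounded X C11_def by metis
  obtain S0 where S0: "S0 \<ge> 0" "\<And>x. norm (\<xi> x) \<le> S0" using periodic_bounded X C11_def by metis
  obtain B where B: "B \<ge> 0" "\<And>x. norm (u x) \<le> B" using periodic_bounded[OF u_periodic u_continuous] by metis
  obtain M where M: "taylor M \<xi> X" using X by (auto simp: C11_def)
  have "\<exists>K. \<forall>j. taylor K (\<lambda>x. u x $ j) (D j)"
  proof -
    obtain K1 K2 where "taylor K1 (\<lambda>x. u x $ 1) (D 1)" "taylor K2 (\<lambda>x. u x $ 2) (D 2)"
      using u[of 1] u[of 2] unfolding C11_def by blast
    then have "\<forall>j. taylor (max K1 K2) (\<lambda>x. u x $ j) (D j)" by (auto simp: forall_2 intro: taylor_mono)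
    then show ?thesis by blast
  qed
  then obtain K where K: "\<And>j. taylor K (\<lambda>x. u x $ j) (D j)" by blast
  define P where "P = 2 * (M + 4 * \<tau> * S * K)"
  \<comment> \<open>The Taylor error P (h B)^2 of the difference quotient, multiplied by \<tau> / h,
    equals c h. P does not involve h, so h can be chosen afterwards.\<close>
  define c where "c = \<tau> * P * B\<^sup>2"
  have P0: "P \<ge> 0"
  proof -
    have "S \<ge> 0" using S[of 0] norm_ge_zero order_trans by blast
    then show ?thesis unfolding P_def using taylor_nonneg[OF M] taylor_nonneg[OF K] tau by simp
  qed
  have c0: "c \<ge> 0" using tau P0 by (simp add: c_def)
  \<comment> \<open>The first entry gives h L \<le> 1/16, the second c h \<le> e/2; the added 1
    covers c = 0.\<close>
  define h where "h = min (1 / (16 * L)) (e / (2 * (c + 1)))"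
  have h: "0 < h" "h * L \<le> 1/16" "c * h \<le> e / 2"
  proof -
    show "0 < h" using L e c0 by (simp add: h_def)
    have "h * L \<le> 1 / (16 * L) * L" using L by (intro mult_right_mono) (auto simp: h_def)
    then show "h * L \<le> 1/16" using L by simp
    have "c * h \<le> c * (e / (2 * (c + 1)))" using c0 by (intro mult_left_mono) (auto simp: h_def)
    also have "\<dots> \<le> e / 2" using c0 e by (simp add: field_simps)
    finally show "c * h \<le> e / 2" .
  qed
  define a b where "a = h / (h + \<tau>)" and "b = \<tau> / (h + \<tau>)"
  have ab: "a > 0" "b > 0" "b < 1" using h tau by (auto simp: a_def b_def)
  have "(\<lambda>n. b ^ n * (2 * S0) / a) \<longlonglongrightarrow> 0 * (2 * S0) / a"
    using ab by (intro tendsto_intros LIMSEQ_power_zero) auto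
  then have "\<forall>\<^sub>F n in sequentially. b ^ n * (2 * S0) / a < e / 2" using e by (intro order_tendstoD) auto
  then obtain n where n: "b ^ n * (2 * S0) / a < e / 2" by (auto simp: eventually_sequentially)
  let ?f = "\<eta> h n" and ?F = "\<Gamma> h n"
  have T: "taylor P ?f ?F" unfolding P_def using euler_iter_taylor[OF h(1,2) S M K] by blast
  have C: "C11 ?f ?F" using T euler_iter_continuous euler_iter_periodic unfolding C11_def by blast
  have "\<bar>?f x + \<tau> * (u x \<bullet> ?F x) - \<xi> x\<bar> \<le> e" for x
  proof -
    let ?y = "euler h u x"
    have st: "\<bar>(?f x - \<eta> h (Suc n) x) / a\<bar> \<le> e / 2"
    proof -
      have "\<bar>(?f x - \<eta> h (Suc n) x) / a\<bar> = \<bar>\<eta> h (Suc n) x - ?f x\<bar> / a"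
        using ab by (simp add: abs_minus_commute del: euler_iter.simps)
      also have "\<dots> \<le> b ^ n * (2 * S0) / a"
        using euler_iter_step[OF h(1), of S0 n x] S0 ab unfolding b_def by (intro divide_right_mono) auto
      also have "\<dots> \<le> e / 2" using n by (rule less_imp_le)
      finally show ?thesis .
    qed
    \<comment> \<open>Up to sign, the residual of the discrete equation at an iterate is the next
      increment divided by a; a large n makes it small for the fixed a.\<close>
    have id: "(?f x - \<eta> h (Suc n) x) / a = ?f x + (\<tau> / h) * (?f x - ?f ?y) - \<xi> x"
    proof -
      have quot: "(p - N / s) / (h / s) = (s * p - N) / h" if "s > 0" for p N s :: real
        using that h(1) by (simp add: field_simps)
      have "(?f x - \<eta> h (Suc n) x) / a = ((h + \<tau>) * ?f x - (h * \<xi> x + \<tau> * ?f ?y)) / h"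
        unfolding a_def euler_iter.simps weighted_mean_eq using h(1) tau by (intro quot) simp
      also have "\<dots> = ?f x + (\<tau> / h) * (?f x - ?f ?y) - \<xi> x" using h(1) by (simp add: field_simps)
      finally show ?thesis .
    qed
    have "\<bar>?f (x + (- h *\<^sub>R u x)) - ?f x - ?F x \<bullet> (- h *\<^sub>R u x)\<bar> \<le> P * (norm (- h *\<^sub>R u x))\<^sup>2"
      by (rule taylorD[OF T])
    then have "\<bar>?f ?y - ?f x + h * (u x \<bullet> ?F x)\<bar> \<le> P * (h * norm (u x))\<^sup>2"
      using h(1) by (simp add: euler_def inner_commute)
    also have "\<dots> \<le> P * (h * B)\<^sup>2" using P0 B h(1) by (intro mult_left_mono power_mono) auto
    finally have "(\<tau> / h) * \<bar>?f ?y - ?f x + h * (u x \<bullet> ?F x)\<bar> \<le> (\<tau> / h) * (P * (h * B)\<^sup>2)"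
      using tau h(1) by (intro mult_left_mono) auto
    also have "\<dots> = c * h" using h(1) by (simp add: c_def power2_eq_square field_simps)
    also note h(3)
    finally have t2: "\<bar>(\<tau> / h) * (?f ?y - ?f x + h * (u x \<bullet> ?F x))\<bar> \<le> e / 2"
      using tau h(1) by (simp add: abs_mult)
    have "?f x + \<tau> * (u x \<bullet> ?F x) - \<xi> x
        = (?f x + (\<tau> / h) * (?f x - ?f ?y) - \<xi> x) + (\<tau> / h) * (?f ?y - ?f x + h * (u x \<bullet> ?F x))"
      using h(1) by (simp add: field_simps)
    then show ?thesis
      using order_trans[OF abs_triangle_ineq add_mono[OF st[unfolded id] t2]]
      by (simp only: field_sum_of_halves)
  qed
  then show ?thesis using that[OF C] euler_iter_L4[OF h(1,2)] euler_iter_grad_L4[OF h(1,2)] by blast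
qed

end

section \<open>Strong solutions\<close>

lemma fatou_bound:
  fixes h :: "nat \<Rightarrow> 'a \<Rightarrow> real"
  assumes i: "\<And>n. integrable M (h n)" and nn: "\<And>n x. h n x \<ge> 0" and C: "\<And>n. (LINT x|M. h n x) \<le> C"
    and lim: "AE x in M. (\<lambda>n. h n x) \<longlonglongrightarrow> H x" and [measurable]: "H \<in> borel_measurable M"
  shows "integrable M H" "(LINT x|M. H x) \<le> C"
proof -
  have [measurable]: "h n \<in> borel_measurable M" for n using i by auto
  have H0: "AE x in M. 0 \<le> H x"
    using lim by eventually_elim (rule LIMSEQ_le_const, auto intro: nn)
  have "0 \<le> (LINT x|M. h 0 x)" using nn by simp
  then have C0: "C \<ge> 0" using C[of 0] by linarith
  have "(\<integral>\<^sup>+x. ennreal (H x) \<partial>M) = (\<integral>\<^sup>+x. liminf (\<lambda>n. ennreal (h n x)) \<partial>M)"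
  proof (rule nn_integral_cong_AE)
    show "AE x in M. ennreal (H x) = liminf (\<lambda>n. ennreal (h n x))"
      using lim
    proof eventually_elim
      case (elim x)
      then have "(\<lambda>n. ennreal (h n x)) \<longlonglongrightarrow> ennreal (H x)" by (rule tendsto_ennrealI)
      then show ?case by (simp add: lim_imp_Liminf)
    qed
  qed
  also have "\<dots> \<le> liminf (\<lambda>n. \<integral>\<^sup>+x. ennreal (h n x) \<partial>M)"
    by (rule nn_integral_liminf) simp
  also have "\<dots> \<le> ennreal C"
  proof (rule Liminf_le)
    show "\<forall>\<^sub>F n in sequentially. (\<integral>\<^sup>+x. ennreal (h n x) \<partial>M) \<le> ennreal C"
      using i nn C by (simp add: nn_integral_eq_integral ennreal_leI)
  qed simp
  finally have le: "(\<integral>\<^sup>+x. ennreal (H x) \<partial>M) \<le> ennreal C" .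
  then have "(\<integral>\<^sup>+x. ennreal (H x) \<partial>M) < \<infinity>" by (simp add: order_le_less_trans)
  then show iH: "integrable M H" using H0 by (intro integrableI_nonneg) auto
  have "ennreal (LINT x|M. H x) \<le> ennreal C" using le iH H0 by (simp add: nn_integral_eq_integral)
  then show "(LINT x|M. H x) \<le> C" using C0 by simp
qed

lemma Cauchy_Schwarz_integral:
  fixes f g :: "'a \<Rightarrow> real"
  assumes i: "integrable M (\<lambda>x. f x ^ 2)" "integrable M (\<lambda>x. g x ^ 2)"
    and [measurable]: "f \<in> borel_measurable M" "g \<in> borel_measurable M"
  shows "integrable M (\<lambda>x. f x * g x)"
    and "(LINT x|M. \<bar>f x * g x\<bar>) \<le> sqrt (LINT x|M. f x ^ 2) * sqrt (LINT x|M. g x ^ 2)"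
proof -
  have young: "2 * \<bar>a * b\<bar> \<le> a^2 + b^2" for a b :: real
    using zero_le_power2[of "\<bar>a\<bar> - \<bar>b\<bar>"] by (simp add: power2_diff abs_mult)
  show ifg: "integrable M (\<lambda>x. f x * g x)"
  proof (rule Bochner_Integration.integrable_bound)
    show "integrable M (\<lambda>x. f x ^ 2 + g x ^ 2)" using i by simp
    have "\<bar>f x * g x\<bar> \<le> f x ^ 2 + g x ^ 2" for x using young[of "f x" "g x"] by linarith
    then show "AE x in M. norm (f x * g x) \<le> norm (f x ^ 2 + g x ^ 2)" by (intro AE_I2) simp
  qed simp
  define A B where "A = (LINT x|M. f x ^ 2)" and "B = (LINT x|M. g x ^ 2)"
  have AB: "A \<ge> 0" "B \<ge> 0" by (auto simp: A_def B_def)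
  show "(LINT x|M. \<bar>f x * g x\<bar>) \<le> sqrt (LINT x|M. f x ^ 2) * sqrt (LINT x|M. g x ^ 2)"
  proof (cases "A = 0 \<or> B = 0")
    case True
    then have "(AE x in M. f x ^ 2 = 0) \<or> (AE x in M. g x ^ 2 = 0)"
      using integral_nonneg_eq_0_iff_AE[OF i(1)] integral_nonneg_eq_0_iff_AE[OF i(2)] by (auto simp: A_def B_def)
    then have "AE x in M. \<bar>f x * g x\<bar> = 0" by (auto elim!: eventually_mono)
    then have "(LINT x|M. \<bar>f x * g x\<bar>) = 0" by (rule integral_eq_zero_AE)
    then show ?thesis using AB by (simp add: A_def B_def)
  next
    case False
    then have p: "sqrt A > 0" "sqrt B > 0" using AB by auto
    \<comment> \<open>Young's inequality after scaling f by sqrt B and g by sqrt A, which makes both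
      square integrals equal to A B.\<close>
    have "(LINT x|M. 2 * (sqrt A * sqrt B) * \<bar>f x * g x\<bar>) \<le> (LINT x|M. B * f x ^ 2 + A * g x ^ 2)"
    proof (rule integral_mono)
      fix x
      have "2 * \<bar>(sqrt B * f x) * (sqrt A * g x)\<bar> \<le> (sqrt B * f x)^2 + (sqrt A * g x)^2" by (rule young)
      then show "2 * (sqrt A * sqrt B) * \<bar>f x * g x\<bar> \<le> B * f x ^ 2 + A * g x ^ 2"
        using AB by (simp add: abs_mult power_mult_distrib mult.assoc mult.left_commute mult.commute)
    qed (use i ifg in auto)
    also have "\<dots> = 2 * (A * B)" using i by (simp add: A_def B_def)
    also have "\<dots> = 2 * (sqrt A * sqrt B) * (sqrt A * sqrt B)" using AB by (simp add: mult.assoc mult.left_commute)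
    finally have "2 * (sqrt A * sqrt B) * (LINT x|M. \<bar>f x * g x\<bar>) \<le> 2 * (sqrt A * sqrt B) * (sqrt A * sqrt B)"
      by simp
    then have "(LINT x|M. \<bar>f x * g x\<bar>) \<le> sqrt A * sqrt B" using p by (simp add: mult_le_cancel_left_pos)
    then show ?thesis by (simp add: A_def B_def)
  qed
qed

lemma norm_midpoint_sq:
  fixes a b :: "'b::real_inner"
  shows "(norm (a - b))\<^sup>2 = 2 * (norm a)\<^sup>2 + 2 * (norm b)\<^sup>2 - 4 * (norm ((1/2) *\<^sub>R (a + b)))\<^sup>2"
  by (simp add: power2_norm_eq_inner inner_simps inner_commute algebra_simps)

text \<open>A substitute for weak compactness: nearly norm-minimal elements of decreasing convex sets
  form a Cauchy sequence, by the parallelogram law.\<close>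

lemma convex_L2_selection:
  fixes S :: "nat \<Rightarrow> (real^2 \<Rightarrow> 'b::euclidean_space) set"
  assumes dec: "\<And>n. S (Suc n) \<subseteq> S n" and ne: "\<And>n. S n \<noteq> {}"
    and mid: "\<And>n v w. v \<in> S n \<Longrightarrow> w \<in> S n \<Longrightarrow> (\<lambda>x. (1/2) *\<^sub>R (v x + w x)) \<in> S n"
    and m: "\<And>n w. w \<in> S n \<Longrightarrow> w \<in> borel_measurable torus"
    and i2: "\<And>n w. w \<in> S n \<Longrightarrow> integrable torus (\<lambda>x. (norm (w x))\<^sup>2)"
    and C: "\<And>n w. w \<in> S n \<Longrightarrow> (LINT x|torus. (norm (w x))\<^sup>2) \<le> C"
  obtains w where "\<And>n. w n \<in> S n" "AE x in torus. (\<lambda>n. w n x) \<longlonglongrightarrow> lim (\<lambda>n. w n x)"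
    "integrable torus (\<lambda>x. lim (\<lambda>n. w n x))"
    "(\<lambda>n. LINT x|torus. norm (w n x - lim (\<lambda>n. w n x))) \<longlonglongrightarrow> 0"
proof -
  have mono: "S m \<subseteq> S n" if "n \<le> m" for n m
    using that by (induction m rule: dec_induct) (use dec in auto)
  define N where "N w = (LINT x|torus. (norm (w x))\<^sup>2)" for w :: "real^2 \<Rightarrow> 'b"
  define I where "I n = Inf (N ` S n)" for n
  have N0: "N w \<ge> 0" for w by (simp add: N_def)
  have bb: "bdd_below (N ` S n)" for n by (rule bdd_belowI[of _ 0]) (auto simp: N0)
  have IN: "I n \<le> N w" if "w \<in> S n" for n w
    unfolding I_def using bb that by (intro cInf_lower) auto
  have Imono: "incseq I"
    unfolding I_def using ne mono bb by (intro monoI cInf_superset_mono image_mono) auto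
  have IC: "I n \<le> C" for n
  proof -
    obtain w where "w \<in> S n" using ne by blast
    then show ?thesis using IN[of w n] C[of w n] by (simp add: N_def)
  qed
  have "\<exists>w\<in>S n. N w < I n + 1 / Suc n" for n
  proof -
    have 1: "Inf (N ` S n) < I n + 1 / Suc n" by (simp add: I_def)
    have "N ` S n \<noteq> {}" using ne by simp
    from cInf_lessD[OF this 1] obtain y where "y \<in> N ` S n" "y < I n + 1 / Suc n" by blast
    then show ?thesis by blast
  qed
  then obtain v where v: "\<And>n. v n \<in> S n" "\<And>n. N (v n) < I n + 1 / Suc n" by metis
  have [measurable]: "v n \<in> borel_measurable torus" for n using v(1) m by blast
  have i1: "integrable torus (v n)" for n
  proof (rule Bochner_Integration.integrable_bound)
    show "integrable torus (\<lambda>x. 1 + (norm (v n x))\<^sup>2)" using i2[OF v(1)] by simp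
    have "norm (v n x) \<le> 1 + (norm (v n x))\<^sup>2" for x
      using self_le_power[of "norm (v n x)" 2] by (cases "norm (v n x) \<ge> 1") (auto intro: add_increasing2)
    then show "AE x in torus. norm (v n x) \<le> norm (1 + (norm (v n x))\<^sup>2)"
      by (intro AE_I2) (metis abs_ge_self order_trans real_norm_def)
  qed simp
  have diff: "integrable torus (\<lambda>x. (norm (v n x - v k x))\<^sup>2)"
    "(LINT x|torus. (norm (v n x - v k x))\<^sup>2) \<le> 2 * (I k - I n) + 4 / Suc n" if nk: "n \<le> k" for n k
  proof -
    let ?w = "\<lambda>x. (1/2) *\<^sub>R (v n x + v k x)"
    \<comment> \<open>The midpoint lies in the larger set S n, so its squared norm is at least I n.
      Both v n and v k are nearly minimal, and the parallelogram law bounds their distance by the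
      growth of I from n to k.\<close>
    have w: "?w \<in> S n" using mid v(1) mono[OF nk] by blast
    show "integrable torus (\<lambda>x. (norm (v n x - v k x))\<^sup>2)"
      unfolding norm_midpoint_sq using i2[OF v(1)] i2[OF w] by simp
    have "(LINT x|torus. (norm (v n x - v k x))\<^sup>2) = 2 * N (v n) + 2 * N (v k) - 4 * N ?w"
      unfolding norm_midpoint_sq N_def using i2[OF v(1)] i2[OF w] by simp
    moreover have "I n \<le> N ?w" by (rule IN[OF w])
    moreover have "1 / real (Suc k) \<le> 1 / Suc n" using nk by (intro divide_left_mono) auto
    moreover have lin: "a \<le> 2 * (k - i) + 4 * p"
      if "a = 2 * b + 2 * c - 4 * d" "i \<le> d" "q \<le> p" "b < i + p" "c < k + q" for a b c d i k p q :: real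
      using that by simp
    ultimately show "(LINT x|torus. (norm (v n x - v k x))\<^sup>2) \<le> 2 * (I k - I n) + 4 / Suc n"
      using lin[OF _ _ _ v(2)[of n] v(2)[of k]] by simp
  qed
  have L1: "\<exists>n0. \<forall>n\<ge>n0. \<forall>k\<ge>n0. (LINT x|torus. norm (v n x - v k x)) < e" if e: "e > 0" for e
  proof -
    \<comment> \<open>The infima increase because the sets shrink, and they are bounded by C, so
      late increments are small.\<close>
    obtain l where "I \<longlonglongrightarrow> l" using incseq_convergent[OF Imono] IC by blast
    then have "convergent I" by (rule convergentI)
    then have "Cauchy I" by (rule convergent_Cauchy)
    then obtain n1 where n1: "\<And>n k. n \<ge> n1 \<Longrightarrow> k \<ge> n1 \<Longrightarrow> \<bar>I k - I n\<bar> < e^2 / 16"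
      using e unfolding Cauchy_def dist_real_def by (metis divide_pos_pos zero_less_numeral zero_less_power)
    obtain n2 :: nat where n2: "32 / e^2 < n2" using reals_Archimedean2 by blast
    have *: "(LINT x|torus. norm (v n x - v k x)) < e" if "n \<ge> max n1 n2" "k \<ge> n" for n k
    proof -
      have "4 / Suc n < e^2 / 8"
      proof -
        have "32 / e^2 < Suc n" using n2 that by linarith
        then show ?thesis using e by (simp add: field_simps)
      qed
      have q: "(LINT x|torus. (norm (v n x - v k x))\<^sup>2) < e^2 / 4"
      proof -
        have lin: "a < b / 4" if "a \<le> 2 * c + q" "q < b / 8" "\<bar>c\<bar> < b / 16" for a b c q :: real
          using that by (auto simp: abs_less_iff)
        show ?thesis using \<open>4 / Suc n < e^2 / 8\<close> n1[of n k] that by (intro lin[OF diff(2)[OF that(2)]]) auto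
      qed
      have "(LINT x|torus. norm (v n x - v k x)) \<le> (LINT x|torus. e/2 + (norm (v n x - v k x))\<^sup>2 * (2/e))"
      proof (rule integral_mono)
        show "integrable torus (\<lambda>x. norm (v n x - v k x))" using i1 by simp
        show "integrable torus (\<lambda>x. e/2 + (norm (v n x - v k x))\<^sup>2 * (2/e))" using diff(1)[OF that(2)] by simp
        fix x
        let ?a = "norm (v n x - v k x)"
        \<comment> \<open>Either the value is at most e/2 or it is at most its square times 2/e;
          this passes from L^2 to L^1.\<close>
        have "?a \<le> e/2 + ?a\<^sup>2 * (2/e)"
        proof (cases "?a \<le> e/2")
          case True
          have "?a\<^sup>2 * (2/e) \<ge> 0" using e by simp
          then show ?thesis using True by linarith
        next
          case False
          then have "?a * 1 \<le> ?a * (?a * (2/e))" using e by (intro mult_left_mono) (auto simp: field_simps)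
          then show ?thesis using e by (simp add: power2_eq_square mult.assoc)
        qed
        then show "norm (v n x - v k x) \<le> e/2 + (norm (v n x - v k x))\<^sup>2 * (2/e)" .
      qed
      also have "\<dots> = e/2 + (LINT x|torus. (norm (v n x - v k x))\<^sup>2) * (2/e)" using diff(1)[OF that(2)] by simp
      also have "\<dots> < e/2 + (e^2 / 4) * (2/e)" using q e by (intro add_strict_left_mono mult_strict_right_mono) auto
      also have "\<dots> = e" using e by (simp add: power2_eq_square)
      finally show ?thesis .
    qed
    have "(LINT x|torus. norm (v n x - v k x)) < e" if "n \<ge> max n1 n2" "k \<ge> max n1 n2" for n k
      using *[of n k] *[of k n] that by (cases "n \<le> k") (auto simp: norm_minus_commute)
    then show ?thesis by blast
  qed
  \<comment> \<open>A subsequence that is Cauchy almost everywhere provides the pointwise limit; n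
    \<le> r n keeps its n-th term in S n.\<close>
  obtain r where r: "strict_mono r" "AE x in torus. Cauchy (\<lambda>n. v (r n) x)"
    using cauchy_L1_AE_cauchy_subseq[of torus v, OF i1 L1] by blast
  define w where "w n = v (r n)" for n
  have rn: "n \<le> r n" for n using r(1) by (rule strict_mono_imp_increasing)
  have wS: "w n \<in> S n" for n using v(1)[of "r n"] mono[OF rn] by (auto simp: w_def)
  have lim: "AE x in torus. (\<lambda>n. w n x) \<longlonglongrightarrow> lim (\<lambda>n. w n x)"
    using r(2) by eventually_elim (auto simp: w_def Cauchy_convergent_iff convergent_LIMSEQ_iff)
  have [measurable]: "w n \<in> borel_measurable torus" for n by (simp add: w_def)
  have Lm [measurable]: "(\<lambda>x. lim (\<lambda>n. w n x)) \<in> borel_measurable torus" by measurable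
  have iw: "integrable torus (w n)" for n by (simp add: w_def i1)
  have b: "integrable torus (\<lambda>x. norm (w n x - lim (\<lambda>n. w n x))) \<and> (LINT x|torus. norm (w n x - lim (\<lambda>n. w n x))) \<le> e"
    if n0: "\<And>n k. n \<ge> n0 \<Longrightarrow> k \<ge> n0 \<Longrightarrow> (LINT x|torus. norm (v n x - v k x)) < e" and n: "n \<ge> n0" for e n n0
  proof -
    have le: "(LINT x|torus. norm (w n x - w (k + n0) x)) \<le> e" for k
      unfolding w_def using less_imp_le[OF n0, of "r n" "r (k + n0)"] n rn[of n] rn[of "k + n0"] by auto
    have "AE x in torus. (\<lambda>k. norm (w n x - w (k + n0) x)) \<longlonglongrightarrow> norm (w n x - lim (\<lambda>n. w n x))"
      using lim
    proof eventually_elim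
      case (elim x)
      show ?case by (intro tendsto_intros LIMSEQ_ignore_initial_segment elim)
    qed
    then show ?thesis
      using fatou_bound[of torus "\<lambda>k x. norm (w n x - w (k + n0) x)" e "\<lambda>x. norm (w n x - lim (\<lambda>n. w n x))"] le iw by auto
  qed
  have conv: "(\<lambda>n. LINT x|torus. norm (w n x - lim (\<lambda>n. w n x))) \<longlonglongrightarrow> 0"
  proof (rule LIMSEQ_I)
    fix e :: real assume e: "e > 0"
    obtain n0 where n0: "\<And>n k. n \<ge> n0 \<Longrightarrow> k \<ge> n0 \<Longrightarrow> (LINT x|torus. norm (v n x - v k x)) < e/2"
      using L1[of "e/2"] e by auto
    have "norm ((LINT x|torus. norm (w n x - lim (\<lambda>n. w n x))) - 0) < e" if "n \<ge> n0" for n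
      using b[OF n0 that] e by simp
    then show "\<exists>n0. \<forall>n\<ge>n0. norm ((LINT x|torus. norm (w n x - lim (\<lambda>n. w n x))) - 0) < e" by blast
  qed
  have "integrable torus (\<lambda>x. lim (\<lambda>n. w n x))"
  proof -
    obtain n0 where "\<And>n k. n \<ge> n0 \<Longrightarrow> k \<ge> n0 \<Longrightarrow> (LINT x|torus. norm (v n x - v k x)) < 1"
      using L1[of 1] by auto
    then have "integrable torus (\<lambda>x. norm (w n0 x - lim (\<lambda>n. w n x)))" using b by blast
    then have "integrable torus (\<lambda>x. w n0 x - lim (\<lambda>n. w n x))" by (rule integrable_norm_cancel) simp
    from Bochner_Integration.integrable_diff[OF iw[of n0] this] show ?thesis by simp
  qed
  then show ?thesis using that wS lim conv by blast
qed

section \<open>Weak gradients and divergence-free transport\<close>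

lemma weak_grad_AE:
  assumes "has_weak_partial i f g" shows "AE x in torus. weak_grad f x $ i = g x"
  using weak_partial_unique[OF someI[of "has_weak_partial i f", OF assms] assms] by (simp add: weak_grad_def)

lemma has_weak_partial_integrable:
  assumes "has_weak_partial i f g" shows "integrable torus f" "integrable torus g"
  using assms Lp_integrable[where p=1] by (auto simp: has_weak_partial_def)

lemma conv_partial_weak:
  assumes "has_weak_partial i f g" shows "partial i (conv f (kern n)) x = conv g (kern n) x"
  by (simp add: conv_partial[OF has_weak_partial_integrable(1)[OF assms] kern_test] conv_weak_partial[OF assms kern_test])

locale div_free =
  fixes u :: "real^2 \<Rightarrow> real^2"
  assumes uc: "continuous_on UNIV u" and up: "periodic u" and ud: "weak_div_free u"
begin

lemma ucomp: "continuous_on UNIV (\<lambda>x. u x $ j)" "periodic (\<lambda>x. u x $ j)"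
  using up by (auto intro!: continuous_intros uc simp: periodic_def)

text \<open>The mollified w is itself a test function for \<open>weak_div_free\<close>, and its
  gradient converges in L^1 against the bounded u. This is what preserves the zero mean of the
  solution.\<close>

lemma integral_u_grad:
  assumes g: "\<And>i. has_weak_partial i w (g i)"
  shows "(LINT x|torus. u x $ 1 * g 1 x + u x $ 2 * g 2 x) = 0"
proof -
  note i = has_weak_partial_integrable[OF g]
  have ic: "integrable torus (conv (g j) (kern n))" for n j
    by (rule integrable_torus_continuous[OF test_continuous[OF conv_test[OF i(2) kern_test]]])
  have lim: "(\<lambda>n. LINT x|torus. conv (g j) (kern n) x * u x $ j) \<longlonglongrightarrow> (LINT x|torus. g j x * u x $ j)" for j
    by (rule L1_weak_limit[OF ic i(2) conv_kern_tendsto_L1[OF i(2)] ucomp])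
  have m: "integrable torus (\<lambda>x. conv (g j) (kern n) x * u x $ j)" "integrable torus (\<lambda>x. g j x * u x $ j)" for n j
    by (rule integrable_mult_test[OF ic ucomp], rule integrable_mult_test[OF i(2) ucomp])
  have "(LINT x|torus. u x $ 1 * partial 1 (conv w (kern n)) x + u x $ 2 * partial 2 (conv w (kern n)) x) = 0" for n
    using ud conv_test[OF i(1) kern_test] unfolding weak_div_free_def by blast
  then have "(LINT x|torus. conv (g 1) (kern n) x * u x $ 1) + (LINT x|torus. conv (g 2) (kern n) x * u x $ 2) = 0" for n
    using m by (simp add: conv_partial_weak[OF g] mult.commute)
  moreover have "(\<lambda>n. (LINT x|torus. conv (g 1) (kern n) x * u x $ 1) + (LINT x|torus. conv (g 2) (kern n) x * u x $ 2))
      \<longlonglongrightarrow> (LINT x|torus. g 1 x * u x $ 1) + (LINT x|torus. g 2 x * u x $ 2)"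
    by (intro tendsto_add lim)
  ultimately have "(LINT x|torus. g 1 x * u x $ 1) + (LINT x|torus. g 2 x * u x $ 2) = 0"
    by (simp add: LIMSEQ_const_iff)
  then show ?thesis using m by (simp add: mult.commute)
qed

text \<open>Both factors converge in L^2 thanks to the L^4 bounds, so the difference of the
  products, split as A B + a B + A b with A and B the errors, tends to zero by
  Cauchy-Schwarz.\<close>

lemma L2_product_limit:
  assumes a: "integrable torus a" "integrable torus (\<lambda>x. a x ^ 4)" and b: "integrable torus b" "integrable torus (\<lambda>x. b x ^ 4)"
  shows "(\<lambda>n. LINT x|torus. \<bar>conv a (kern n) x * conv b (kern n) x - a x * b x\<bar>) \<longlonglongrightarrow> 0"
    and "integrable torus (\<lambda>x. a x * b x)"
proof -
  have ab [measurable]: "a \<in> borel_measurable torus" "b \<in> borel_measurable torus" using a b by auto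
  note i2 = integrable_square_of_power4
  have cc: "continuous_on UNIV (conv f (kern n))" if "integrable torus f" for f n
    by (rule test_continuous[OF conv_test[OF that kern_test]])
  have d: "integrable torus (\<lambda>x. (conv f (kern n) x - f x)^2)" "(\<lambda>x. conv f (kern n) x - f x) \<in> borel_measurable torus"
    if f: "integrable torus f" "integrable torus (\<lambda>x. f x ^ 4)" for f n
  proof -
    have [measurable]: "f \<in> borel_measurable torus" "conv f (kern n) \<in> borel_measurable torus"
      using borel_measurable_integrable[OF f(1)] continuous_torus_measurable[OF cc[OF f(1)]] by blast+
    show "(\<lambda>x. conv f (kern n) x - f x) \<in> borel_measurable torus" by measurable
    show "integrable torus (\<lambda>x. (conv f (kern n) x - f x)^2)"
    proof (rule Bochner_Integration.integrable_bound)
      show "integrable torus (\<lambda>x. 2 * conv f (kern n) x ^ 2 + 2 * f x ^ 2)"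
        by (intro Bochner_Integration.integrable_add integrable_mult_right integrable_torus_continuous[OF continuous_on_power[OF cc[OF f(1)]]]
              i2[OF _ f(2)]) simp
      have "(s - t)^2 \<le> 2 * s^2 + 2 * t^2" for s t :: real
        using zero_le_power2[of "s + t"] by (simp add: power2_diff power2_sum)
      then show "AE x in torus. norm ((conv f (kern n) x - f x)^2) \<le> norm (2 * conv f (kern n) x ^ 2 + 2 * f x ^ 2)"
        by (intro AE_I2) simp
    qed simp
  qed
  have a2: "integrable torus (\<lambda>x. a x ^ 2)" "integrable torus (\<lambda>x. b x ^ 2)" using a b i2 by auto
  show iab: "integrable torus (\<lambda>x. a x * b x)" by (rule Cauchy_Schwarz_integral(1)[OF a2 ab])
  let ?A = "\<lambda>n x. conv a (kern n) x - a x" and ?B = "\<lambda>n x. conv b (kern n) x - b x"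
  note dA = d[OF a] and dB = d[OF b]
  have p: "integrable torus (\<lambda>x. ?A n x * ?B n x)" "integrable torus (\<lambda>x. a x * ?B n x)" "integrable torus (\<lambda>x. ?A n x * b x)" for n
    by (rule Cauchy_Schwarz_integral(1)[OF dA(1) dB(1) dA(2) dB(2)])
       (rule Cauchy_Schwarz_integral(1)[OF a2(1) dB(1) ab(1) dB(2)],
        rule Cauchy_Schwarz_integral(1)[OF dA(1) a2(2) dA(2) ab(2)])
  have q: "(LINT x|torus. \<bar>?A n x * ?B n x\<bar>) \<le> sqrt (LINT x|torus. ?A n x ^ 2) * sqrt (LINT x|torus. ?B n x ^ 2)"
      "(LINT x|torus. \<bar>a x * ?B n x\<bar>) \<le> sqrt (LINT x|torus. a x ^ 2) * sqrt (LINT x|torus. ?B n x ^ 2)"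
      "(LINT x|torus. \<bar>?A n x * b x\<bar>) \<le> sqrt (LINT x|torus. ?A n x ^ 2) * sqrt (LINT x|torus. b x ^ 2)" for n
    by (rule Cauchy_Schwarz_integral(2)[OF dA(1) dB(1) dA(2) dB(2)])
       (rule Cauchy_Schwarz_integral(2)[OF a2(1) dB(1) ab(1) dB(2)],
        rule Cauchy_Schwarz_integral(2)[OF dA(1) a2(2) dA(2) ab(2)])
  show "(\<lambda>n. LINT x|torus. \<bar>conv a (kern n) x * conv b (kern n) x - a x * b x\<bar>) \<longlonglongrightarrow> 0"
  proof (rule Lim_null_comparison)
    let ?bd = "\<lambda>n. sqrt (LINT x|torus. ?A n x ^ 2) * sqrt (LINT x|torus. ?B n x ^ 2)
        + sqrt (LINT x|torus. a x ^ 2) * sqrt (LINT x|torus. ?B n x ^ 2)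
        + sqrt (LINT x|torus. ?A n x ^ 2) * sqrt (LINT x|torus. b x ^ 2)"
    show "\<forall>\<^sub>F n in sequentially. norm (LINT x|torus. \<bar>conv a (kern n) x * conv b (kern n) x - a x * b x\<bar>) \<le> ?bd n"
    proof (rule always_eventually, intro allI)
      fix n
      have eq: "conv a (kern n) x * conv b (kern n) x - a x * b x = ?A n x * ?B n x + a x * ?B n x + ?A n x * b x" for x
        by (simp add: algebra_simps)
      have "(LINT x|torus. \<bar>conv a (kern n) x * conv b (kern n) x - a x * b x\<bar>)
          \<le> (LINT x|torus. \<bar>?A n x * ?B n x\<bar> + \<bar>a x * ?B n x\<bar> + \<bar>?A n x * b x\<bar>)"
        unfolding eq
      proof (rule integral_mono)
        show "integrable torus (\<lambda>x. \<bar>?A n x * ?B n x + a x * ?B n x + ?A n x * b x\<bar>)"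
          by (intro integrable_abs Bochner_Integration.integrable_add p)
        show "integrable torus (\<lambda>x. \<bar>?A n x * ?B n x\<bar> + \<bar>a x * ?B n x\<bar> + \<bar>?A n x * b x\<bar>)"
          by (intro integrable_abs Bochner_Integration.integrable_add p)
        show "\<bar>?A n x * ?B n x + a x * ?B n x + ?A n x * b x\<bar> \<le> \<bar>?A n x * ?B n x\<bar> + \<bar>a x * ?B n x\<bar> + \<bar>?A n x * b x\<bar>" for x
          by (rule order_trans[OF abs_triangle_ineq add_right_mono[OF abs_triangle_ineq]])
      qed
      also have "\<dots> = (LINT x|torus. \<bar>?A n x * ?B n x\<bar>) + (LINT x|torus. \<bar>a x * ?B n x\<bar>) + (LINT x|torus. \<bar>?A n x * b x\<bar>)"
        by (simp only: Bochner_Integration.integral_add Bochner_Integration.integrable_add integrable_abs p)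
      also have "\<dots> \<le> ?bd n" by (intro add_mono q)
      finally show "norm (LINT x|torus. \<bar>conv a (kern n) x * conv b (kern n) x - a x * b x\<bar>) \<le> ?bd n" by simp
    qed
    have "?bd \<longlonglongrightarrow> sqrt 0 * sqrt 0 + sqrt (LINT x|torus. a x ^ 2) * sqrt 0 + sqrt 0 * sqrt (LINT x|torus. b x ^ 2)"
      by (intro tendsto_intros conv_kern_tendsto_L2 a b)
    then show "?bd \<longlonglongrightarrow> 0" by simp
  qed
qed

text \<open>The square of the mollified w is the test function; its gradient is twice the product of
  the mollified w and the mollified gradient, and \<open>L2_product_limit\<close> passes to the
  limit in that product.\<close>

lemma integral_u_grad_energy:
  assumes g: "\<And>i. has_weak_partial i w (g i)" and w4: "integrable torus (\<lambda>x. w x ^ 4)"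
    and g4: "\<And>i. integrable torus (\<lambda>x. g i x ^ 4)"
  shows "(LINT x|torus. w x * (u x $ 1 * g 1 x + u x $ 2 * g 2 x)) = 0"
proof -
  note i = has_weak_partial_integrable[OF g]
  let ?W = "\<lambda>n. conv w (kern n)" and ?G = "\<lambda>j n. conv (g j) (kern n)"
  have tW: "?W n \<in> test_functions" for n by (rule conv_test[OF i(1) kern_test])
  have tG: "?G j n \<in> test_functions" for j n by (rule conv_test[OF i(2) kern_test])
  have ic: "integrable torus (\<lambda>x. ?W n x * ?G j n x)" for n j
    by (intro integrable_torus_continuous continuous_intros test_continuous tW tG)
  note prod = L2_product_limit[OF i(1) w4 i(2) g4]
  have lim: "(\<lambda>n. LINT x|torus. (?W n x * ?G j n x) * u x $ j) \<longlonglongrightarrow> (LINT x|torus. (w x * g j x) * u x $ j)" for j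
    by (rule L1_weak_limit[OF ic prod(2) prod(1) ucomp])
  have m: "integrable torus (\<lambda>x. (?W n x * ?G j n x) * u x $ j)" "integrable torus (\<lambda>x. (w x * g j x) * u x $ j)" for n j
    by (rule integrable_mult_test[OF ic ucomp], rule integrable_mult_test[OF prod(2) ucomp])
  have part: "partial j (\<lambda>x. ?W n x * ?W n x) x = 2 * (?W n x * ?G j n x)" for j n x
    by (simp add: partial_mult[OF test_differentiable[OF tW] test_differentiable[OF tW]] conv_partial_weak[OF g])
  have e1: "(LINT x|torus. u x $ 1 * partial 1 (\<lambda>x. ?W n x * ?W n x) x + u x $ 2 * partial 2 (\<lambda>x. ?W n x * ?W n x) x) = 0" for n
    using ud test_mult[OF tW tW] unfolding weak_div_free_def by blast
  have e2: "(LINT x|torus. u x $ 1 * partial 1 (\<lambda>x. ?W n x * ?W n x) x + u x $ 2 * partial 2 (\<lambda>x. ?W n x * ?W n x) x)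
      = 2 * ((LINT x|torus. (?W n x * ?G 1 n x) * u x $ 1) + (LINT x|torus. (?W n x * ?G 2 n x) * u x $ 2))" for n
  proof -
    have "(LINT x|torus. u x $ 1 * partial 1 (\<lambda>x. ?W n x * ?W n x) x + u x $ 2 * partial 2 (\<lambda>x. ?W n x * ?W n x) x)
      = (LINT x|torus. 2 * ((?W n x * ?G 1 n x) * u x $ 1 + (?W n x * ?G 2 n x) * u x $ 2))"
      unfolding part by (rule Bochner_Integration.integral_cong) (auto simp: algebra_simps)
    then show ?thesis using m(1) by simp
  qed
  have "(LINT x|torus. (?W n x * ?G 1 n x) * u x $ 1) + (LINT x|torus. (?W n x * ?G 2 n x) * u x $ 2) = 0" for n
    using trans[OF sym[OF e2] e1, of n] by simp
  moreover have "(\<lambda>n. (LINT x|torus. (?W n x * ?G 1 n x) * u x $ 1) + (LINT x|torus. (?W n x * ?G 2 n x) * u x $ 2))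
      \<longlonglongrightarrow> (LINT x|torus. (w x * g 1 x) * u x $ 1) + (LINT x|torus. (w x * g 2 x) * u x $ 2)"
    by (intro tendsto_add lim)
  ultimately have "(LINT x|torus. (w x * g 1 x) * u x $ 1) + (LINT x|torus. (w x * g 2 x) * u x $ 2) = 0"
    by (simp add: LIMSEQ_const_iff)
  moreover have "(LINT x|torus. w x * (u x $ 1 * g 1 x + u x $ 2 * g 2 x))
      = (LINT x|torus. (w x * g 1 x) * u x $ 1 + (w x * g 2 x) * u x $ 2)"
    by (rule Bochner_Integration.integral_cong) (auto simp: algebra_simps)
  ultimately show ?thesis using m(2) by simp
qed

end

section \<open>Uniqueness and existence of strong solutions\<close>

lemma W1p_gradE:
  assumes "f \<in> W1p_torus 4"
  obtains g where "\<And>i. has_weak_partial i f (g i)" "\<And>i. g i \<in> Lp_torus 4"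
  using assms unfolding W1p_torus_def by (auto, metis)

lemma Lp4_power4: "f \<in> Lp_torus 4 \<Longrightarrow> integrable torus (\<lambda>x. f x ^ 4)" for f :: "real^2 \<Rightarrow> real"
  by (simp add: Lp_torus_def power_even_abs)

lemma strong_solution_gradE:
  assumes s: "strong_solution \<tau> \<xi> f" and b: "AE x in torus. biot_savart \<xi> x = u x"
  obtains g where "\<And>i. has_weak_partial i f (g i)" "\<And>i. integrable torus (\<lambda>x. g i x ^ 4)"
    "integrable torus (\<lambda>x. f x ^ 4)"
    "AE x in torus. f x = \<xi> x - \<tau> * (u x $ 1 * g 1 x + u x $ 2 * g 2 x)"
proof -
  have f: "f \<in> W1p_torus 4" and eq: "AE x in torus. f x = \<xi> x - \<tau> * (biot_savart \<xi> x \<bullet> weak_grad f x)"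
    using s by (auto simp: strong_solution_def)
  obtain g where g: "\<And>i. has_weak_partial i f (g i)" "\<And>i. g i \<in> Lp_torus 4" using W1p_gradE[OF f] by blast
  have "AE x in torus. f x = \<xi> x - \<tau> * (u x $ 1 * g 1 x + u x $ 2 * g 2 x)"
    using eq b weak_grad_AE[OF g(1)[of 1]] weak_grad_AE[OF g(1)[of 2]]
    by eventually_elim (simp add: inner_vec_def sum_2)
  then show ?thesis using that g(1) Lp4_power4[OF g(2)] Lp4_power4[of f] f by (auto simp: W1p_torus_def)
qed

lemma has_weak_partial_diff:
  assumes "has_weak_partial i f g" "has_weak_partial i f' g'"
  shows "has_weak_partial i (\<lambda>x. f x - f' x) (\<lambda>x. g x - g' x)"
proof -
  note i = has_weak_partial_integrable[OF assms(1)] has_weak_partial_integrable[OF assms(2)]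
  have per: "periodic f" "periodic g" "periodic f'" "periodic g'"
    using assms by (auto simp: has_weak_partial_def Lp_torus_def)
  have L: "(\<lambda>x. f x - f' x) \<in> Lp_torus 1" "(\<lambda>x. g x - g' x) \<in> Lp_torus 1"
    using i per by (auto simp: Lp_torus_def periodic_def)
  have "(LINT x|torus. (f x - f' x) * partial i \<phi> x) = - (LINT x|torus. (g x - g' x) * \<phi> x)"
    if p: "\<phi> \<in> test_functions" for \<phi>
  proof -
    have e: "(LINT x|torus. f x * partial i \<phi> x) = - (LINT x|torus. g x * \<phi> x)"
      "(LINT x|torus. f' x * partial i \<phi> x) = - (LINT x|torus. g' x * \<phi> x)"
      using assms p by (auto simp: has_weak_partial_def)
    note pp = test_continuous[OF test_partial[OF p]] test_periodic[OF test_partial[OF p]]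
    show ?thesis
      using e integrable_mult_test[OF i(1) pp] integrable_mult_test[OF i(3) pp]
        integrable_mult_test[OF i(2) test_continuous[OF p] test_periodic[OF p]]
        integrable_mult_test[OF i(4) test_continuous[OF p] test_periodic[OF p]]
      by (simp add: left_diff_distrib)
  qed
  then show ?thesis using L by (simp add: has_weak_partial_def)
qed

lemma power4_diff_integrable:
  fixes f g :: "real^2 \<Rightarrow> real"
  assumes "integrable torus (\<lambda>x. f x ^ 4)" "integrable torus (\<lambda>x. g x ^ 4)"
    and [measurable]: "f \<in> borel_measurable torus" "g \<in> borel_measurable torus"
  shows "integrable torus (\<lambda>x. (f x - g x) ^ 4)"
proof (rule Bochner_Integration.integrable_bound)
  show "integrable torus (\<lambda>x. 8 * (f x ^ 4 + g x ^ 4))" using assms by simp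
  show "AE x in torus. norm ((f x - g x)^4) \<le> norm (8 * (f x ^ 4 + g x ^ 4))"
  proof (rule AE_I2)
    show "norm ((f x - g x)^4) \<le> norm (8 * (f x ^ 4 + g x ^ 4))" for x
      using power4_add_le[of "f x" "- g x"] by simp
  qed
qed simp

text \<open>The velocity is determined by \<xi> alone, so the equation is linear in the unknown: the
  difference of two solutions satisfies w = - \<tau> u . grad w, and multiplication by w turns this
  into the vanishing of the integral of w^2. The argument works for any \<tau>.\<close>

lemma strong_solution_unique:
  assumes u: "continuous_on UNIV u" "periodic u" "weak_div_free u" and b: "AE x in torus. biot_savart \<xi> x = u x"
    and s: "strong_solution \<tau> \<xi> f" "strong_solution \<tau> \<xi> f'"
  shows "AE x in torus. f x = f' x"
proof -
  interpret div_free u using u by unfold_locales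
  obtain g where g: "\<And>i. has_weak_partial i f (g i)" "\<And>i. integrable torus (\<lambda>x. g i x ^ 4)"
    "integrable torus (\<lambda>x. f x ^ 4)" "AE x in torus. f x = \<xi> x - \<tau> * (u x $ 1 * g 1 x + u x $ 2 * g 2 x)"
    using strong_solution_gradE[OF s(1) b] by blast
  obtain g' where g': "\<And>i. has_weak_partial i f' (g' i)" "\<And>i. integrable torus (\<lambda>x. g' i x ^ 4)"
    "integrable torus (\<lambda>x. f' x ^ 4)" "AE x in torus. f' x = \<xi> x - \<tau> * (u x $ 1 * g' 1 x + u x $ 2 * g' 2 x)"
    using strong_solution_gradE[OF s(2) b] by blast
  let ?w = "\<lambda>x. f x - f' x" and ?g = "\<lambda>i x. g i x - g' i x"
  have [measurable]: "f \<in> borel_measurable torus" "f' \<in> borel_measurable torus"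
    using has_weak_partial_integrable(1)[OF g(1)] has_weak_partial_integrable(1)[OF g'(1)] by auto
  have gm: "g i \<in> borel_measurable torus" "g' i \<in> borel_measurable torus" for i
    using has_weak_partial_integrable(2)[OF g(1)] has_weak_partial_integrable(2)[OF g'(1)] by auto
  have w4: "integrable torus (\<lambda>x. ?w x ^ 4)" by (rule power4_diff_integrable[OF g(3) g'(3)]) auto
  have en: "(LINT x|torus. ?w x * (u x $ 1 * ?g 1 x + u x $ 2 * ?g 2 x)) = 0"
    by (rule integral_u_grad_energy[OF has_weak_partial_diff[OF g(1) g'(1)] w4 power4_diff_integrable[OF g(2) g'(2) gm]])
  have um: "(\<lambda>x. u x $ j) \<in> borel_measurable torus" for j by (rule continuous_torus_measurable[OF ucomp(1)])
  have "(LINT x|torus. ?w x ^ 2) = (LINT x|torus. - \<tau> * (?w x * (u x $ 1 * ?g 1 x + u x $ 2 * ?g 2 x)))"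
  proof (rule integral_cong_AE)
    show "AE x in torus. ?w x ^ 2 = - \<tau> * (?w x * (u x $ 1 * ?g 1 x + u x $ 2 * ?g 2 x))"
      using g(4) g'(4)
    proof eventually_elim
      case (elim x)
      have "?w x = - \<tau> * (u x $ 1 * ?g 1 x + u x $ 2 * ?g 2 x)" by (subst (1) elim(1), subst elim(2)) (simp add: algebra_simps)
      then show ?case unfolding power2_eq_square by (metis mult.left_commute)
    qed
  qed (use gm um in measurable)
  also have "\<dots> = 0" using en by simp
  finally have "(LINT x|torus. ?w x ^ 2) = 0" .
  moreover have "integrable torus (\<lambda>x. ?w x ^ 2)" by (rule integrable_square_of_power4[OF _ w4]) simp
  ultimately have "AE x in torus. ?w x ^ 2 = 0"
    using integral_nonneg_eq_0_iff_AE[of torus "\<lambda>x. ?w x ^ 2"] by simp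
  then show ?thesis by (rule eventually_mono) simp
qed

text \<open>A function and its gradient are stored as one map into a product space, so a single
  selection makes both converge strongly. Every condition is convex, and none bounds the Taylor
  constant, which may blow up as e decreases.\<close>

definition admissible :: "(real^2 \<Rightarrow> real^2) \<Rightarrow> (real^2 \<Rightarrow> real) \<Rightarrow> real \<Rightarrow> real \<Rightarrow> real \<Rightarrow> (real^2 \<Rightarrow> real \<times> (real^2)) set" where
  "admissible u \<xi> \<tau> C e = {w. C11 (\<lambda>x. fst (w x)) (\<lambda>x. snd (w x)) \<and>
     (LINT x|torus. fst (w x) ^ 4) \<le> C \<and> (LINT x|torus. norm (snd (w x)) ^ 4) \<le> C \<and>
     (LINT x|torus. \<bar>fst (w x) + \<tau> * (u x \<bullet> snd (w x)) - \<xi> x\<bar>) \<le> e}"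

lemma admissible_mid:
  assumes v: "v \<in> admissible u \<xi> \<tau> C e" and w: "w \<in> admissible u \<xi> \<tau> C e"
    and i\<xi>: "integrable torus \<xi>" and u: "continuous_on UNIV u"
  shows "(\<lambda>x. (1/2) *\<^sub>R (v x + w x)) \<in> admissible u \<xi> \<tau> C e"
proof -
  have cv: "C11 (\<lambda>x. fst (v x)) (\<lambda>x. snd (v x))" and cw: "C11 (\<lambda>x. fst (w x)) (\<lambda>x. snd (w x))"
    using v w by (auto simp: admissible_def)
  have C: "C11 (\<lambda>x. (1/2) * fst (v x) + (1/2) * fst (w x)) (\<lambda>x. (1/2) *\<^sub>R snd (v x) + (1/2) *\<^sub>R snd (w x))"
    by (rule C11_lincomb[OF cv cw])
  have cont: "continuous_on UNIV (\<lambda>x. fst (v x))" "continuous_on UNIV (\<lambda>x. snd (v x))"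
      "continuous_on UNIV (\<lambda>x. fst (w x))" "continuous_on UNIV (\<lambda>x. snd (w x))"
    using cv cw by (auto simp: C11_def)
  have 1: "(LINT x|torus. ((1/2) * fst (v x) + (1/2) * fst (w x)) ^ 4) \<le> C"
  proof -
    have "(LINT x|torus. ((1/2) * fst (v x) + (1/2) * fst (w x)) ^ 4) \<le> (LINT x|torus. (1/2) * fst (v x) ^ 4 + (1/2) * fst (w x) ^ 4)"
    proof (rule integral_mono)
      show "((1/2) * fst (v x) + (1/2) * fst (w x)) ^ 4 \<le> (1/2) * fst (v x) ^ 4 + (1/2) * fst (w x) ^ 4" for x
        by (rule power4_jensen2) auto
    qed (intro integrable_torus_continuous continuous_intros cont)+
    also have "\<dots> = (1/2) * (LINT x|torus. fst (v x) ^ 4) + (1/2) * (LINT x|torus. fst (w x) ^ 4)"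
      using integrable_torus_continuous[OF continuous_on_power[OF cont(1)]] integrable_torus_continuous[OF continuous_on_power[OF cont(3)]] by simp
    also have "\<dots> \<le> C" using v w by (simp add: admissible_def)
    finally show ?thesis .
  qed
  have 2: "(LINT x|torus. norm ((1/2) *\<^sub>R snd (v x) + (1/2) *\<^sub>R snd (w x)) ^ 4) \<le> C"
  proof -
    have le: "norm ((1/2) *\<^sub>R a + (1/2) *\<^sub>R b) ^ 4 \<le> (1/2) * norm a ^ 4 + (1/2) * norm b ^ 4" for a b :: "real^2"
    proof -
      have "norm ((1/2) *\<^sub>R a + (1/2) *\<^sub>R b) \<le> (1/2) * norm a + (1/2) * norm b"
        using norm_triangle_ineq[of "(1/2) *\<^sub>R a" "(1/2) *\<^sub>R b"] by simp
      then have "norm ((1/2) *\<^sub>R a + (1/2) *\<^sub>R b) ^ 4 \<le> ((1/2) * norm a + (1/2) * norm b) ^ 4" by (rule power_mono) simp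
      also have "\<dots> \<le> (1/2) * norm a ^ 4 + (1/2) * norm b ^ 4" by (rule power4_jensen2) auto
      finally show ?thesis .
    qed
    have "(LINT x|torus. norm ((1/2) *\<^sub>R snd (v x) + (1/2) *\<^sub>R snd (w x)) ^ 4) \<le> (LINT x|torus. (1/2) * norm (snd (v x)) ^ 4 + (1/2) * norm (snd (w x)) ^ 4)"
      by (rule integral_mono[OF _ _ le]) (auto intro!: integrable_torus_continuous continuous_intros cont)
    also have "\<dots> = (1/2) * (LINT x|torus. norm (snd (v x)) ^ 4) + (1/2) * (LINT x|torus. norm (snd (w x)) ^ 4)"
      using integrable_torus_continuous[OF continuous_on_power[OF continuous_on_norm[OF cont(2)]]]
        integrable_torus_continuous[OF continuous_on_power[OF continuous_on_norm[OF cont(4)]]] by simp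
    also have "\<dots> \<le> C" using v w by (simp add: admissible_def)
    finally show ?thesis .
  qed
  have 3: "(LINT x|torus. \<bar>((1/2) * fst (v x) + (1/2) * fst (w x)) + \<tau> * (u x \<bullet> ((1/2) *\<^sub>R snd (v x) + (1/2) *\<^sub>R snd (w x))) - \<xi> x\<bar>) \<le> e"
  proof -
    let ?r = "\<lambda>v x. fst (v x) + \<tau> * (u x \<bullet> snd (v x)) - \<xi> x"
    have i: "integrable torus (?r v)" "integrable torus (?r w)"
      by (rule Bochner_Integration.integrable_diff[OF integrable_torus_continuous i\<xi>], intro continuous_intros cont u)+
    have eq: "((1/2) * fst (v x) + (1/2) * fst (w x)) + \<tau> * (u x \<bullet> ((1/2) *\<^sub>R snd (v x) + (1/2) *\<^sub>R snd (w x))) - \<xi> x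
        = (1/2) * ?r v x + (1/2) * ?r w x" for x
      by (simp add: inner_add_right algebra_simps)
    have "(LINT x|torus. \<bar>(1/2) * ?r v x + (1/2) * ?r w x\<bar>) \<le> (LINT x|torus. (1/2) * \<bar>?r v x\<bar> + (1/2) * \<bar>?r w x\<bar>)"
    proof (rule integral_mono)
      show "\<bar>(1/2) * ?r v x + (1/2) * ?r w x\<bar> \<le> (1/2) * \<bar>?r v x\<bar> + (1/2) * \<bar>?r w x\<bar>" for x
        using abs_triangle_ineq[of "(1/2) * ?r v x" "(1/2) * ?r w x"] by (simp add: abs_mult)
      show "integrable torus (\<lambda>x. \<bar>(1/2) * ?r v x + (1/2) * ?r w x\<bar>)"
        by (intro integrable_abs Bochner_Integration.integrable_add integrable_mult_right i)
      show "integrable torus (\<lambda>x. (1/2) * \<bar>?r v x\<bar> + (1/2) * \<bar>?r w x\<bar>)"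
        by (intro integrable_abs Bochner_Integration.integrable_add integrable_mult_right i)
    qed
    also have "\<dots> = (1/2) * (LINT x|torus. \<bar>?r v x\<bar>) + (1/2) * (LINT x|torus. \<bar>?r w x\<bar>)"
      by (simp only: Bochner_Integration.integral_add integral_mult_right_zero integrable_abs integrable_mult_right i)
    also have "\<dots> \<le> e" using v w by (simp add: admissible_def)
    finally show ?thesis by (simp only: eq)
  qed
  show ?thesis using C 1 2 3 by (simp add: admissible_def scaleR_add_right)
qed

text \<open>The point is that one C serves all e. Mollification does not increase L^4 norms and the
  scheme at most doubles the fourth-power integrals, whereas whatever depends on e stays inside the
  choice of the element.\<close>

lemma admissible_nonempty:
  assumes xi: "\<xi> \<in> W1p_torus 4 \<inter> E_space" and u: "continuous_on UNIV u" "approximable u L" "L > 0"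
    and tau: "\<tau> > 0" "128 * (\<tau> * L) \<le> 1"
  obtains C where "\<And>e. e > 0 \<Longrightarrow> admissible u \<xi> \<tau> C e \<noteq> {}"
proof -
  have W: "\<xi> \<in> W1p_torus 4" using xi by simp
  obtain g where g: "\<And>i. has_weak_partial i \<xi> (g i)" "\<And>i. g i \<in> Lp_torus 4" using W1p_gradE[OF W] by blast
  have ig: "integrable torus (g i)" "integrable torus (\<lambda>x. g i x ^ 4)" for i
    using has_weak_partial_integrable(2)[OF g(1)] Lp4_power4[OF g(2)] by auto
  have i\<xi>: "integrable torus \<xi>" "integrable torus (\<lambda>x. \<xi> x ^ 4)"
    using has_weak_partial_integrable(1)[OF g(1)] Lp4_power4[of \<xi>] W by (auto simp: W1p_torus_def)
  have cu: "continuous_on UNIV u" by (rule u(1))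
  \<comment> \<open>Bounds the fourth-power integral of the mollified gradient; the 8 comes from (a
    + b)^4 \<le> 8 (a^4 + b^4) for the two components.\<close>
  define J where "J = 8 * ((LINT x|torus. g 1 x ^ 4) + (LINT x|torus. g 2 x ^ 4))"
  define C where "C = 2 * ((LINT x|torus. \<xi> x ^ 4) + J)"
  have J0: "J \<ge> 0" by (simp add: J_def)
  have C: "2 * (LINT x|torus. \<xi> x ^ 4) \<le> C" "2 * J \<le> C" "C \<ge> 0" using J0 by (auto simp: C_def)
  have "admissible u \<xi> \<tau> C e \<noteq> {}" if e: "e > 0" for e
  proof -
    have "\<forall>\<^sub>F n in sequentially. (LINT x|torus. \<bar>conv \<xi> (kern n) x - \<xi> x\<bar>) < e/3"
      using conv_kern_tendsto_L1[OF i\<xi>(1)] e by (intro order_tendstoD) auto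
    then obtain n where n: "(LINT x|torus. \<bar>conv \<xi> (kern n) x - \<xi> x\<bar>) < e/3" by (auto simp: eventually_sequentially)
    let ?\<xi> = "conv \<xi> (kern n)" and ?X = "\<lambda>x. \<chi> i. conv \<xi> (partial i (kern n)) x"
    have X: "C11 ?\<xi> ?X" by (rule conv_C11[OF i\<xi>(1) kern_test])
    have Xi: "?X x $ i = conv (g i) (kern n) x" for x i by (simp add: conv_weak_partial[OF g(1) kern_test])
    have cg: "continuous_on UNIV (conv (g i) (kern n))" for i by (rule test_continuous[OF conv_test[OF ig(1) kern_test]])
    have XJ: "(LINT x|torus. norm (?X x) ^ 4) \<le> J"
    proof -
      have "(LINT x|torus. norm (?X x) ^ 4) \<le> (LINT x|torus. 8 * (conv (g 1) (kern n) x ^ 4 + conv (g 2) (kern n) x ^ 4))"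
      proof (rule integral_mono)
        show "integrable torus (\<lambda>x. norm (?X x) ^ 4)"
          using X unfolding C11_def by (intro integrable_torus_continuous continuous_on_power continuous_on_norm) blast
        show "integrable torus (\<lambda>x. 8 * (conv (g 1) (kern n) x ^ 4 + conv (g 2) (kern n) x ^ 4))"
          by (intro integrable_torus_continuous continuous_intros cg)
        fix x
        have "norm (?X x) \<le> \<bar>conv (g 1) (kern n) x\<bar> + \<bar>conv (g 2) (kern n) x\<bar>"
          using norm_le_l1_cart[of "?X x"] by (simp only: sum_2 Xi)
        then have "norm (?X x) ^ 4 \<le> (\<bar>conv (g 1) (kern n) x\<bar> + \<bar>conv (g 2) (kern n) x\<bar>) ^ 4" by (rule power_mono) simp
        also have "\<dots> \<le> 8 * (\<bar>conv (g 1) (kern n) x\<bar> ^ 4 + \<bar>conv (g 2) (kern n) x\<bar> ^ 4)" by (rule power4_add_le)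
        finally show "norm (?X x) ^ 4 \<le> 8 * (conv (g 1) (kern n) x ^ 4 + conv (g 2) (kern n) x ^ 4)"
          by (simp add: power_even_abs)
      qed
      also have "\<dots> = 8 * ((LINT x|torus. conv (g 1) (kern n) x ^ 4) + (LINT x|torus. conv (g 2) (kern n) x ^ 4))"
        using integrable_torus_continuous[OF continuous_on_power[OF cg]] by simp
      also have "\<dots> \<le> J" unfolding J_def using conv_L4[OF ig] by (intro mult_left_mono add_mono) auto
      finally show ?thesis .
    qed
    \<comment> \<open>The error e is split in three: the scheme, the mollification of \<xi>, and the
      replacement of u by v. Since the integral of |F| is at most 1 + C, the last costs \<tau> d (1
      + C) = e/3.\<close>
    define d where "d = e / (3 * (\<tau> * (1 + C)))"
    have d: "d > 0" using e tau C by (simp add: d_def)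
    then obtain v D where v: "\<And>j. C11 (\<lambda>x. v x $ j) (D j)" "\<And>j x. norm (D j x) \<le> L" "\<And>x. norm (v x - u x) < d"
      using u(2) unfolding approximable_def by blast
    interpret transport v D L ?\<xi> ?X \<tau>
      using v u(3) X tau by unfold_locales auto
    obtain f F where f: "C11 f F" "\<And>x. \<bar>f x + \<tau> * (v x \<bullet> F x) - ?\<xi> x\<bar> \<le> e/3"
      "(LINT x|torus. f x ^ 4) \<le> 2 * (LINT x|torus. ?\<xi> x ^ 4)"
      "(LINT x|torus. norm (F x) ^ 4) \<le> 2 * (LINT x|torus. norm (?X x) ^ 4)"
      using approximate_solution[of "e/3"] e by auto
    have 1: "(LINT x|torus. f x ^ 4) \<le> C" using f(3) conv_L4[OF i\<xi>, of n] C(1) by linarith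
    have 2: "(LINT x|torus. norm (F x) ^ 4) \<le> C" using f(4) XJ C(2) by linarith
    have fc: "continuous_on UNIV f" "continuous_on UNIV F" using f(1) by (auto simp: C11_def)
    have i\<xi>n: "integrable torus ?\<xi>" using X by (auto intro!: integrable_torus_continuous simp: C11_def)
    have iF: "integrable torus (\<lambda>x. norm (F x))" "integrable torus (\<lambda>x. norm (F x) ^ 4)"
      by (intro integrable_torus_continuous continuous_intros fc)+
    have F1: "(LINT x|torus. norm (F x)) \<le> 1 + C"
    proof -
      have "(LINT x|torus. norm (F x)) \<le> (LINT x|torus. 1 + norm (F x) ^ 4)"
        using iF by (intro integral_mono le_one_plus_power4) auto
      also have "\<dots> = 1 + (LINT x|torus. norm (F x) ^ 4)" using iF by simp
      finally show ?thesis using 2 by simp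
    qed
    have "(LINT x|torus. \<bar>f x + \<tau> * (u x \<bullet> F x) - \<xi> x\<bar>) \<le> (LINT x|torus. e/3 + (\<tau> * d) * norm (F x) + \<bar>?\<xi> x - \<xi> x\<bar>)"
    proof (rule integral_mono)
      show "integrable torus (\<lambda>x. \<bar>f x + \<tau> * (u x \<bullet> F x) - \<xi> x\<bar>)"
        by (intro integrable_abs Bochner_Integration.integrable_diff[OF _ i\<xi>(1)] integrable_torus_continuous continuous_intros fc cu)
      show "integrable torus (\<lambda>x. e/3 + (\<tau> * d) * norm (F x) + \<bar>?\<xi> x - \<xi> x\<bar>)" using iF i\<xi> i\<xi>n by simp
      fix x
      have "\<bar>(u x - v x) \<bullet> F x\<bar> \<le> norm (u x - v x) * norm (F x)" by (rule Cauchy_Schwarz_ineq2)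
      also have "\<dots> \<le> d * norm (F x)" using v(3)[of x] by (intro mult_right_mono) (auto simp: norm_minus_commute)
      finally have "\<tau> * \<bar>(u x - v x) \<bullet> F x\<bar> \<le> \<tau> * (d * norm (F x))" using tau by (intro mult_left_mono) auto
      then have "\<bar>\<tau> * ((u x - v x) \<bullet> F x)\<bar> \<le> (\<tau> * d) * norm (F x)" using tau by (simp add: abs_mult mult.assoc)
      moreover have "f x + \<tau> * (u x \<bullet> F x) - \<xi> x = (f x + \<tau> * (v x \<bullet> F x) - ?\<xi> x) + \<tau> * ((u x - v x) \<bullet> F x) + (?\<xi> x - \<xi> x)"
        by (simp add: inner_diff_left algebra_simps)
      ultimately show "\<bar>f x + \<tau> * (u x \<bullet> F x) - \<xi> x\<bar> \<le> e/3 + (\<tau> * d) * norm (F x) + \<bar>?\<xi> x - \<xi> x\<bar>"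
        using f(2)[of x] by linarith
    qed
    also have "\<dots> = e/3 + (\<tau> * d) * (LINT x|torus. norm (F x)) + (LINT x|torus. \<bar>?\<xi> x - \<xi> x\<bar>)"
      using iF i\<xi> i\<xi>n by simp
    also have "(\<tau> * d) * (LINT x|torus. norm (F x)) \<le> (\<tau> * d) * (1 + C)"
      using F1 tau d by (intro mult_left_mono) auto
    also have "(\<tau> * d) * (1 + C) = e/3"
    proof -
      have quot: "s * (e / (3 * s)) = e/3" if "s > 0" for s using that by simp
      have "(\<tau> * d) * (1 + C) = (\<tau> * (1 + C)) * d" by simp
      also have "\<dots> = e/3" unfolding d_def using tau C by (intro quot) simp
      finally show ?thesis .
    qed
    finally have 3: "(LINT x|torus. \<bar>f x + \<tau> * (u x \<bullet> F x) - \<xi> x\<bar>) \<le> e" using n by linarith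
    have "(\<lambda>x. (f x, F x)) \<in> admissible u \<xi> \<tau> C e" using f(1) 1 2 3 by (simp add: admissible_def)
    then show ?thesis by blast
  qed
  then show ?thesis using that by blast
qed

lemma strong_solution_exists:
  assumes xi: "\<xi> \<in> W1p_torus 4 \<inter> E_space"
    and u: "continuous_on UNIV u" "periodic u" "weak_div_free u" "approximable u L" "L > 0"
    and b: "AE x in torus. biot_savart \<xi> x = u x"
    and tau: "\<tau> > 0" "128 * (\<tau> * L) \<le> 1"
  obtains \<Phi> where "strong_solution \<tau> \<xi> \<Phi>"
proof -
  interpret div_free u using u by unfold_locales
  obtain C where ne: "\<And>e. e > 0 \<Longrightarrow> admissible u \<xi> \<tau> C e \<noteq> {}"
    using admissible_nonempty[OF xi u(1,4,5) tau] by blast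
  have i\<xi>: "integrable torus \<xi>" using xi by (auto simp: W1p_torus_def intro: Lp_integrable)
  have [measurable]: "\<xi> \<in> borel_measurable torus" using i\<xi> by auto
  have um [measurable]: "u \<in> borel_measurable torus" by (rule continuous_torus_measurable[OF u(1)])
  let ?S = "\<lambda>n. admissible u \<xi> \<tau> C (1 / Suc n)"
  have cont: "continuous_on UNIV (\<lambda>x. fst (w x))" "continuous_on UNIV (\<lambda>x. snd (w x))" "continuous_on UNIV w"
    if "w \<in> ?S n" for w n
  proof -
    show c: "continuous_on UNIV (\<lambda>x. fst (w x))" "continuous_on UNIV (\<lambda>x. snd (w x))"
      using that by (auto simp: admissible_def C11_def)
    show "continuous_on UNIV w" using continuous_on_Pair[OF c] by simp
  qed
  obtain w where wS: "\<And>n. w n \<in> ?S n" and lim: "AE x in torus. (\<lambda>n. w n x) \<longlonglongrightarrow> lim (\<lambda>n. w n x)"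
    and iL: "integrable torus (\<lambda>x. lim (\<lambda>n. w n x))"
    and L1: "(\<lambda>n. LINT x|torus. norm (w n x - lim (\<lambda>n. w n x))) \<longlonglongrightarrow> 0"
  \<comment> \<open>The constant comes from a^2 \<le> 1 + a^4, applied to the value and to the norm
    of the gradient.\<close>
  proof (rule convex_L2_selection[of ?S "2 + 2 * C"])
    show "?S (Suc n) \<subseteq> ?S n" for n
    proof -
      have "1 / real (Suc (Suc n)) \<le> 1 / Suc n" by (intro divide_left_mono) auto
      then show ?thesis unfolding admissible_def by (auto intro: order_trans)
    qed
    show "?S n \<noteq> {}" for n by (rule ne) simp
    show "(\<lambda>x. (1/2) *\<^sub>R (v x + w x)) \<in> ?S n" if "v \<in> ?S n" "w \<in> ?S n" for n v w
      using admissible_mid[OF that i\<xi> u(1)] .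
    fix n w assume w: "w \<in> ?S n"
    note c = cont[OF w]
    show "w \<in> borel_measurable torus" by (rule continuous_torus_measurable[OF c(3)])
    show "integrable torus (\<lambda>x. (norm (w x))\<^sup>2)" by (intro integrable_torus_continuous continuous_intros c)
    have i: "integrable torus (\<lambda>x. fst (w x) ^ 4)" "integrable torus (\<lambda>x. norm (snd (w x)) ^ 4)"
      by (intro integrable_torus_continuous continuous_intros c)+
    have "(LINT x|torus. (norm (w x))\<^sup>2) \<le> (LINT x|torus. 2 + fst (w x) ^ 4 + norm (snd (w x)) ^ 4)"
    proof (rule integral_mono)
      show "integrable torus (\<lambda>x. (norm (w x))\<^sup>2)" by (intro integrable_torus_continuous continuous_intros c)
      show "integrable torus (\<lambda>x. 2 + fst (w x) ^ 4 + norm (snd (w x)) ^ 4)" using i by simp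
      fix x
      have sq: "a\<^sup>2 \<le> 1 + a^4" for a :: real
      proof -
        have "0 \<le> (a\<^sup>2 - 1)\<^sup>2 + a\<^sup>2 * 1" by simp
        also have "\<dots> = a^4 + 1 - a\<^sup>2" by algebra
        finally show ?thesis by simp
      qed
      have "(norm (w x))\<^sup>2 = (fst (w x))\<^sup>2 + (norm (snd (w x)))\<^sup>2"
        by (simp add: norm_prod_def)
      then show "(norm (w x))\<^sup>2 \<le> 2 + fst (w x) ^ 4 + norm (snd (w x)) ^ 4"
        using sq[of "fst (w x)"] sq[of "norm (snd (w x))"] by linarith
    qed
    also have "\<dots> = 2 + (LINT x|torus. fst (w x) ^ 4) + (LINT x|torus. norm (snd (w x)) ^ 4)" using i by simp
    also have "\<dots> \<le> 2 + 2 * C" using w by (simp add: admissible_def)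
    finally show "(LINT x|torus. (norm (w x))\<^sup>2) \<le> 2 + 2 * C" .
  qed blast
  \<comment> \<open>\<open>lim\<close> gives some value also where the sequence diverges, and it
    depends on the sequence alone. Hence W is periodic at every point, as \<open>Lp_torus\<close>
    demands, and not just almost everywhere.\<close>
  define W where "W x = lim (\<lambda>n. w n x)" for x
  define \<Phi> where "\<Phi> x = fst (W x)" for x
  define G where "G i x = snd (W x) $ i" for i x
  have C11w: "C11 (\<lambda>x. fst (w n x)) (\<lambda>x. snd (w n x))" for n using wS[of n] by (simp add: admissible_def)
  note cw = cont[OF wS]
  have iW: "integrable torus W" using iL by (simp add: W_def[abs_def])
  have i\<Phi>: "integrable torus \<Phi>" unfolding \<Phi>_def[abs_def] by (rule integrable_bounded_linear[OF bounded_linear_fst iW])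
  have iG: "integrable torus (G i)" for i unfolding G_def[abs_def]
    by (rule integrable_bounded_linear[OF bounded_linear_compose[OF bounded_linear_vec_nth bounded_linear_snd] iW])
  have [measurable]: "W \<in> borel_measurable torus" "\<Phi> \<in> borel_measurable torus" "G i \<in> borel_measurable torus" for i
    using iW i\<Phi> iG by auto
  have limW: "AE x in torus. (\<lambda>n. w n x) \<longlonglongrightarrow> W x" using lim by (simp add: W_def)
  have limf: "AE x in torus. (\<lambda>n. fst (w n x)) \<longlonglongrightarrow> \<Phi> x"
    using limW by eventually_elim (simp add: \<Phi>_def tendsto_fst)
  have limg: "AE x in torus. (\<lambda>n. snd (w n x) $ i) \<longlonglongrightarrow> G i x" for i
    using limW by eventually_elim (auto simp: G_def intro!: tendsto_intros)
  have wper: "w n (x + axis i 1) = w n x" for n x i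
    using C11w[of n] by (simp add: C11_def periodic_def prod_eq_iff)
  have per: "periodic \<Phi>" "periodic (G j)" for j
    by (auto simp: periodic_def \<Phi>_def G_def W_def wper)
  have ci: "integrable torus (\<lambda>x. fst (w n x) ^ 4)" "integrable torus (\<lambda>x. norm (snd (w n x)) ^ 4)"
      "integrable torus (\<lambda>x. (snd (w n x) $ i) ^ 4)" for n i
    by (intro integrable_torus_continuous continuous_intros cw)+
  have \<Phi>4: "integrable torus (\<lambda>x. \<Phi> x ^ 4)"
  proof (rule fatou_bound(1)[of torus "\<lambda>n x. fst (w n x) ^ 4" C])
    show "(LINT x|torus. fst (w n x) ^ 4) \<le> C" for n using wS[of n] by (simp add: admissible_def)
    show "AE x in torus. (\<lambda>n. fst (w n x) ^ 4) \<longlonglongrightarrow> \<Phi> x ^ 4"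
      using limf by eventually_elim (rule tendsto_power)
  qed (use ci in auto)
  have G4: "integrable torus (\<lambda>x. G i x ^ 4)" for i
  proof (rule fatou_bound(1)[of torus "\<lambda>n x. (snd (w n x) $ i) ^ 4" C])
    show "(LINT x|torus. (snd (w n x) $ i) ^ 4) \<le> C" for n
    proof -
      have "(LINT x|torus. (snd (w n x) $ i) ^ 4) \<le> (LINT x|torus. norm (snd (w n x)) ^ 4)"
      proof (rule integral_mono[OF ci(3) ci(2)])
        show "(snd (w n x) $ i) ^ 4 \<le> norm (snd (w n x)) ^ 4" for x
          using power_mono[OF component_le_norm_cart[of "snd (w n x)" i], of 4] by (simp add: power_even_abs)
      qed
      also have "\<dots> \<le> C" using wS[of n] by (simp add: admissible_def)
      finally show ?thesis .
    qed
    show "AE x in torus. (\<lambda>n. (snd (w n x) $ i) ^ 4) \<longlonglongrightarrow> G i x ^ 4"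
      using limg by eventually_elim (rule tendsto_power)
  qed (use ci in auto)
  have iwf: "integrable torus (\<lambda>x. fst (w n x))" "integrable torus (\<lambda>x. snd (w n x) $ i)" "integrable torus (w n)" for n i
    by (intro integrable_torus_continuous continuous_intros cw)+
  have L1W: "(\<lambda>n. LINT x|torus. norm (w n x - W x)) \<longlonglongrightarrow> 0" using L1 by (simp add: W_def)
  have L1f: "(\<lambda>n. LINT x|torus. \<bar>fst (w n x) - \<Phi> x\<bar>) \<longlonglongrightarrow> 0"
  proof (rule Lim_null_comparison[OF always_eventually L1W], intro allI)
    fix n
    have "(LINT x|torus. \<bar>fst (w n x) - \<Phi> x\<bar>) \<le> (LINT x|torus. norm (w n x - W x))"
    proof (rule integral_mono)
      show "\<bar>fst (w n x) - \<Phi> x\<bar> \<le> norm (w n x - W x)" for x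
        unfolding \<Phi>_def fst_diff[symmetric] by (metis norm_fst_le prod.collapse real_norm_def)
    qed (use iwf i\<Phi> iW in auto)
    then show "norm (LINT x|torus. \<bar>fst (w n x) - \<Phi> x\<bar>) \<le> (LINT x|torus. norm (w n x - W x))" by simp
  qed
  have L1g: "(\<lambda>n. LINT x|torus. \<bar>snd (w n x) $ i - G i x\<bar>) \<longlonglongrightarrow> 0" for i
  proof (rule Lim_null_comparison[OF always_eventually L1W], intro allI)
    fix n
    have "(LINT x|torus. \<bar>snd (w n x) $ i - G i x\<bar>) \<le> (LINT x|torus. norm (w n x - W x))"
    proof (rule integral_mono)
      fix x
      have "\<bar>(snd (w n x - W x)) $ i\<bar> \<le> norm (snd (w n x - W x))" by (rule component_le_norm_cart)
      also have "\<dots> \<le> norm (w n x - W x)"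
        by (metis norm_snd_le prod.collapse)
      finally show "\<bar>snd (w n x) $ i - G i x\<bar> \<le> norm (w n x - W x)" by (simp add: G_def)
    qed (use iwf iG iW in auto)
    then show "norm (LINT x|torus. \<bar>snd (w n x) $ i - G i x\<bar>) \<le> (LINT x|torus. norm (w n x - W x))" by simp
  qed
  have hw: "has_weak_partial i \<Phi> (G i)" for i
    unfolding has_weak_partial_def
  proof (intro conjI ballI)
    show "\<Phi> \<in> Lp_torus 1" "G i \<in> Lp_torus 1" using per i\<Phi> iG by (auto simp: Lp_torus_def)
    fix \<phi> assume p: "\<phi> \<in> test_functions"
    have "(\<lambda>n. LINT x|torus. fst (w n x) * partial i \<phi> x) \<longlonglongrightarrow> (LINT x|torus. \<Phi> x * partial i \<phi> x)"
      by (rule L1_weak_limit[OF iwf(1) i\<Phi> L1f test_continuous[OF test_partial[OF p]] test_periodic[OF test_partial[OF p]]])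
    moreover have "(LINT x|torus. fst (w n x) * partial i \<phi> x) = - (LINT x|torus. snd (w n x) $ i * \<phi> x)" for n
      using torus_by_parts[OF C11w test_C11[OF p], of n i] by simp
    moreover have "(\<lambda>n. - (LINT x|torus. snd (w n x) $ i * \<phi> x)) \<longlonglongrightarrow> - (LINT x|torus. G i x * \<phi> x)"
      by (intro tendsto_minus L1_weak_limit[OF iwf(2) iG L1g test_continuous[OF p] test_periodic[OF p]])
    ultimately show "(LINT x|torus. \<Phi> x * partial i \<phi> x) = - (LINT x|torus. G i x * \<phi> x)"
      using LIMSEQ_unique by simp
  qed
  define H where "H x = \<bar>\<Phi> x + \<tau> * (u x $ 1 * G 1 x + u x $ 2 * G 2 x) - \<xi> x\<bar>" for x
  have um': "(\<lambda>x. u x $ j) \<in> borel_measurable torus" for j by (rule continuous_torus_measurable[OF ucomp(1)])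
  have Hm: "H \<in> borel_measurable torus" unfolding H_def[abs_def] using um' by measurable
  \<comment> \<open>Fatou is applied to the sequence shifted by N, all of whose residuals are at
    most 1 / Suc N; with N arbitrary, the residual of the limit has integral zero.\<close>
  have HN: "integrable torus H \<and> (LINT x|torus. H x) \<le> 1 / Suc N" for N
  proof -
    let ?h = "\<lambda>n x. \<bar>fst (w (n + N) x) + \<tau> * (u x \<bullet> snd (w (n + N) x)) - \<xi> x\<bar>"
    have ih: "integrable torus (?h n)" for n
      by (intro integrable_abs Bochner_Integration.integrable_diff[OF _ i\<xi>] integrable_torus_continuous continuous_intros cw u)
    have hC: "(LINT x|torus. ?h n x) \<le> 1 / Suc N" for n
    proof -
      have "(LINT x|torus. ?h n x) \<le> 1 / Suc (n + N)" using wS[of "n + N"] by (simp add: admissible_def)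
      also have "\<dots> \<le> 1 / Suc N" by (intro divide_left_mono) auto
      finally show ?thesis .
    qed
    have hl: "AE x in torus. (\<lambda>n. ?h n x) \<longlonglongrightarrow> H x"
      using limf limg[of 1] limg[of 2]
    proof eventually_elim
      case (elim x)
      have "(\<lambda>n. \<bar>fst (w n x) + \<tau> * (u x $ 1 * snd (w n x) $ 1 + u x $ 2 * snd (w n x) $ 2) - \<xi> x\<bar>) \<longlonglongrightarrow> H x"
        unfolding H_def by (intro tendsto_intros elim)
      then have "(\<lambda>n. \<bar>fst (w n x) + \<tau> * (u x \<bullet> snd (w n x)) - \<xi> x\<bar>) \<longlonglongrightarrow> H x"
        by (simp add: inner_vec_def sum_2)
      then show ?case by (rule LIMSEQ_ignore_initial_segment)
    qed
    show ?thesis using fatou_bound[OF ih _ hC hl Hm] by simp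
  qed
  have iH: "integrable torus H" using HN by blast
  have "(LINT x|torus. H x) \<le> 0"
  proof (rule LIMSEQ_le_const)
    show "(\<lambda>N. 1 / real (Suc N)) \<longlonglongrightarrow> 0" using LIMSEQ_Suc[OF lim_1_over_n] by simp
  qed (use HN in blast)
  moreover have "(LINT x|torus. H x) \<ge> 0" unfolding H_def by simp
  ultimately have "(LINT x|torus. H x) = 0" by simp
  moreover have "AE x in torus. 0 \<le> H x" by (simp add: H_def)
  ultimately have "AE x in torus. H x = 0" using integral_nonneg_eq_0_iff_AE[OF iH] by blast
  then have eq: "AE x in torus. \<Phi> x = \<xi> x - \<tau> * (u x $ 1 * G 1 x + u x $ 2 * G 2 x)"
    by (rule eventually_mono) (simp add: H_def)
  have Lp: "\<Phi> \<in> Lp_torus 4" "G i \<in> Lp_torus 4" "\<Phi> \<in> Lp_torus 2" for i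
    using per \<Phi>4 G4 integrable_square_of_power4[OF _ \<Phi>4] by (auto simp: Lp_torus_def power_even_abs)
  have iug: "integrable torus (\<lambda>x. u x $ j * G j x)" for j
    using integrable_mult_test[OF iG ucomp, of j] by (simp add: mult.commute)
  \<comment> \<open>The transport term has integral zero, so the mean of \<Phi> is that of
    \<xi>.\<close>
  have mz: "mean_zero \<Phi>"
  proof -
    have "(LINT x|torus. \<Phi> x) = (LINT x|torus. \<xi> x - \<tau> * (u x $ 1 * G 1 x + u x $ 2 * G 2 x))"
      by (rule integral_cong_AE[OF _ _ eq]) (use um' in measurable)
    also have "\<dots> = (LINT x|torus. \<xi> x) - \<tau> * (LINT x|torus. u x $ 1 * G 1 x + u x $ 2 * G 2 x)"
      using i\<xi> iug by simp
    also have "\<dots> = 0" using integral_u_grad[OF hw] xi by (simp add: E_space_def mean_zero_def)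
    finally show ?thesis by (simp add: mean_zero_def)
  qed
  have "AE x in torus. \<Phi> x = \<xi> x - \<tau> * (biot_savart \<xi> x \<bullet> weak_grad \<Phi> x)"
    using eq b weak_grad_AE[OF hw[of 1]] weak_grad_AE[OF hw[of 2]]
    by eventually_elim (simp add: inner_vec_def sum_2)
  moreover have "\<Phi> \<in> W1p_torus 4 \<inter> E_space"
    using Lp hw mz by (auto simp: W1p_torus_def E_space_def)
  ultimately have "strong_solution \<tau> \<xi> \<Phi>" unfolding strong_solution_def by blast
  then show ?thesis by (rule that)
qed

theorem lemma3p4:
  fixes \<xi> :: "real^2 \<Rightarrow> real"
  assumes "\<xi> \<in> W1p_torus 4 \<inter> E_space"
  shows "\<exists>\<tau>\<^sub>0>0. \<forall>\<tau>. 0 < \<tau> \<and> \<tau> < \<tau>\<^sub>0 \<longrightarrow>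
           (\<exists>\<Phi>. strong_solution \<tau> \<xi> \<Phi> \<and>
              (\<forall>\<Psi>. strong_solution \<tau> \<xi> \<Psi> \<longrightarrow> (AE x in torus. \<Psi> x = \<Phi> x)))"
proof -
  obtain u L where u: "continuous_on UNIV u" "periodic u" "weak_div_free u" "L > 0" "approximable u L"
    and b: "AE x in torus. biot_savart \<xi> x = u x"
    using biot_savart_continuous[OF assms] by blast
  show ?thesis
  \<comment> \<open>L depends on \<xi> only, and below this threshold the condition 128 \<tau> L
    \<le> 1 of \<open>transport\<close> holds.\<close>
  proof (intro exI[of _ "1 / (128 * L)"] conjI allI impI)
    show "0 < 1 / (128 * L)" using u(4) by simp
    fix \<tau> assume tau: "0 < \<tau> \<and> \<tau> < 1 / (128 * L)"
    then have "128 * (\<tau> * L) \<le> 1" using u(4) by (simp add: field_simps)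
    then obtain \<Phi> where \<Phi>: "strong_solution \<tau> \<xi> \<Phi>"
      using strong_solution_exists[OF assms u(1-3,5,4) b] tau by blast
    then show "\<exists>\<Phi>. strong_solution \<tau> \<xi> \<Phi> \<and> (\<forall>\<Psi>. strong_solution \<tau> \<xi> \<Psi> \<longrightarrow> (AE x in torus. \<Psi> x = \<Phi> x))"
      using strong_solution_unique[OF u(1-3) b] by blast
  qed
qed

end
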